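(* Let $N\ge2$, let $\Omega\subset\mathbb{R}^N$ be a smooth bounded domain, and let $q(p)$ be a function of $p$ with $\lim_{p\to\infty}q(p)/p=Q$, where either $Q\in(0,1)$ and $N<q(p)<p$, or $Q\in(1,\infty)$ and $N<p<q(p)$. Let $c>1$ and $\lambda_p:=c|\Omega|(\Lambda_\infty)^p$. For $p$ large, let $u_p$ be a nonnegative least energy solution of $$-(\Delta_p+\Delta_{q(p)})u=\lambda_p\|u\|_\infty^{p-1}\delta_{x_u}\ \text{ in }\Omega,\qquad u=0\ \text{ on }\partial\Omega,$$ and let $x_p$ be the only maximum point of $u_p$. Then, in both cases $Q\in(0,1)$ and $Q\in(1,\infty)$: (i) for every $m>N$, $\limsup_{p\to\infty}\|\nabla u_p\|_m\le|\Omega|^{1/m}$, and $\liminf_{p\to\infty}\|u_p\|_\infty\ge(\Lambda_\infty)^{-1}$; (ii) there exist a sequence $p_n\to\infty$, a point $x_{\Lambda_\infty}\in\Omega$ and a function $u_{\Lambda_\infty}\in W^{1,\infty}(\Omega)\cap C_0(\overline\Omega)$ such that $x_{p_n}\to x_{\Lambda_\infty}$ and $u_{p_n}\to u_{\Lambda_\infty}$ uniformly in $\overline\Omega$; moreover $\|\nabla u_{\Lambda_\infty}\|_\infty\le1$ and $u_{\Lambda_\infty}(x_{\Lambda_\infty})=\|u_{\Lambda_\infty}\|_\infty\ge(\Lambda_\infty)^{-1}$; (iii) for $(u_{\Lambda_\infty},x_{\Lambda_\infty})$ as in (ii), $\|u_{\Lambda_\infty}\|_\infty=1/\Lambda_\infty$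 and $\Lambda_\infty=\|\nabla u_{\Lambda_\infty}\|_\infty/\|u_{\Lambda_\infty}\|_\infty$; $x_{\Lambda_\infty}$ is a maximum point of $\rho$; and $0\le u_{\Lambda_\infty}(x)\le\rho(x)$ for all $x\in\overline\Omega$, with equality in the second inequality holding on $\partial\Omega\cup\{x_{\Lambda_\infty}\}$.
   Context: $\|\cdot\|_s$ is the norm of $L^s(\Omega)$ and $|\Omega|$ the Lebesgue measure of $\Omega$. $\rho(x):=\inf\{|x-y|:y\in\partial\Omega\}$ for $x\in\overline\Omega$. $C_0(\overline\Omega):=\{u\in C(\overline\Omega):u=0\text{ on }\partial\Omega\}$ and $\Lambda_\infty:=\min\{\|\nabla u\|_\infty/\|u\|_\infty:0\not\equiv u\in W^{1,\infty}(\Omega)\cap C_0(\overline\Omega)\}$; it is known that $\Lambda_\infty=\|\rho\|_\infty^{-1}$. $(\Delta_p+\Delta_q)u:=\operatorname{div}[(|\nabla u|^{p-2}+|\nabla u|^{q-2})\nabla u]$; $x_u$ denotes the maximum point of $|u|$ and $\delta_{x_u}$ the Dirac delta supported at $x_u$. Least energy solutions: with $q=q(p)$ and $\lambda=\lambda_p$, let $X_{p,q}:=W_0^{1,\max\{p,q\}}(\Omega)\hookrightarrow C(\overline\Omega)$, $J_\lambda(u):=\frac1p\|\nabla u\|_p^p+\frac1q\|\nabla u\|_q^q-\frac{\lambda}{p}\|u\|_\infty^p$ for $u\in X_{p,q}$, and $\mathcal N_{\lambda,\infty}:=\{u\in X_{p,q}\setminus\{0\}:\|\nabla u\|_p^p+\|\nabla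 u\|_q^q=\lambda\|u\|_\infty^p\}$. A least energy solution is a function $u\in X_{p,q}$ minimizing $J_\lambda$ over $X_{p,q}$ if $N<p<q$, or over $\mathcal N_{\lambda,\infty}$ (with $u\in\mathcal N_{\lambda,\infty}$) if $N<q<p$. Nonnegative least energy solutions exist, and have a unique maximum point, whenever $\lambda>\lambda_\infty(p):=\min\{\|\nabla v\|_p^p/\|v\|_\infty^p:v\in W_0^{1,p}(\Omega)\setminus\{0\}\}$. It is known that $p\mapsto(|\Omega|^{-1}\lambda_\infty(p))^{1/p}$ is increasing on $(N,\infty)$ with limit $\Lambda_\infty$ as $p\to\infty$. *)

theory Defs
  imports "HOL-Analysis.Analysis" "HOL-Probability.Essential_Supremum"
begin

text \<open>
  The space \<open>\<real>\<^sup>N\<close> is an arbitrary type \<open>'a::euclidean_space\<close> with \<open>N = DIM('a)\<close>.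
  Functions on \<open>\<Omega>\<close> or on its closure are total functions on \<open>'a\<close>; their values elsewhere
  play no role.
\<close>

fun Ck :: "nat \<Rightarrow> 'a::euclidean_space set \<Rightarrow> ('a \<Rightarrow> real) \<Rightarrow> bool" where
  "Ck 0 U f \<longleftrightarrow> continuous_on U f"
| "Ck (Suc k) U f \<longleftrightarrow> (\<forall>x\<in>U. f differentiable (at x)) \<and>
      (\<forall>b\<in>Basis. Ck k U (\<lambda>x. frechet_derivative f (at x) b))"

definition smooth :: "('a::euclidean_space \<Rightarrow> real) \<Rightarrow> bool" where
  "smooth f \<longleftrightarrow> (\<forall>k. Ck k UNIV f)"

text \<open>
  Near each boundary point the domain is the strict epigraph of a smooth function over
  the hyperplane orthogonal to some unit vector \<open>e\<close>. The function \<open>\<gamma>\<close> is defined on the whole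
  space but only evaluated on that hyperplane.
\<close>

definition smooth_boundary :: "'a::euclidean_space set \<Rightarrow> bool" where
  "smooth_boundary \<Omega> \<longleftrightarrow>
     (\<forall>x0\<in>frontier \<Omega>. \<exists>r>0. \<exists>e \<gamma>. norm e = 1 \<and> smooth \<gamma> \<and>
        \<Omega> \<inter> ball x0 r = {x \<in> ball x0 r. \<gamma> (x - (x \<bullet> e) *\<^sub>R e) < x \<bullet> e})"

definition smooth_bounded_domain :: "'a::euclidean_space set \<Rightarrow> bool" where
  "smooth_bounded_domain \<Omega> \<longleftrightarrow>
     open \<Omega> \<and> connected \<Omega> \<and> \<Omega> \<noteq> {} \<and> bounded \<Omega> \<and> smooth_boundary \<Omega>"

definition Lspace :: "'a::euclidean_space set \<Rightarrow> real \<Rightarrow> ('a \<Rightarrow> 'b::euclidean_space) set" where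
  "Lspace \<Omega> s = {f. f \<in> borel_measurable (lebesgue_on \<Omega>) \<and>
                     integrable (lebesgue_on \<Omega>) (\<lambda>x. norm (f x) powr s)}"

definition Lnorm :: "'a::euclidean_space set \<Rightarrow> real \<Rightarrow> ('a \<Rightarrow> 'b::euclidean_space) \<Rightarrow> real" where
  "Lnorm \<Omega> s f = (integral\<^sup>L (lebesgue_on \<Omega>) (\<lambda>x. norm (f x) powr s)) powr (1 / s)"

definition Linf_space :: "'a::euclidean_space set \<Rightarrow> ('a \<Rightarrow> 'b::euclidean_space) set" where
  "Linf_space \<Omega> = {f. f \<in> borel_measurable (lebesgue_on \<Omega>) \<and>
                        esssup (lebesgue_on \<Omega>) (\<lambda>x. ereal (norm (f x))) < \<infinity>}"

definition Linf_norm :: "'a::euclidean_space set \<Rightarrow> ('a \<Rightarrow> 'b::euclidean_space) \<Rightarrow> real" where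
  "Linf_norm \<Omega> f = real_of_ereal (esssup (lebesgue_on \<Omega>) (\<lambda>x. ereal (norm (f x))))"

definition test_function :: "'a::euclidean_space set \<Rightarrow> ('a \<Rightarrow> real) \<Rightarrow> bool" where
  "test_function \<Omega> \<phi> \<longleftrightarrow>
     smooth \<phi> \<and> compact (closure {x. \<phi> x \<noteq> 0}) \<and> closure {x. \<phi> x \<noteq> 0} \<subseteq> \<Omega>"

definition locally_integrable ::
    "'a::euclidean_space set \<Rightarrow> ('a \<Rightarrow> 'b::euclidean_space) \<Rightarrow> bool" where
  "locally_integrable \<Omega> f \<longleftrightarrow> (\<forall>K. compact K \<and> K \<subseteq> \<Omega> \<longrightarrow> integrable (lebesgue_on K) f)"

definition has_weak_gradient ::
    "'a::euclidean_space set \<Rightarrow> ('a \<Rightarrow> real) \<Rightarrow> ('a \<Rightarrow> 'a) \<Rightarrow> bool" where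
  "has_weak_gradient \<Omega> u g \<longleftrightarrow> locally_integrable \<Omega> u \<and> locally_integrable \<Omega> g \<and>
     (\<forall>\<phi>. test_function \<Omega> \<phi> \<longrightarrow> (\<forall>b\<in>Basis.
        integral\<^sup>L (lebesgue_on \<Omega>) (\<lambda>x. u x * frechet_derivative \<phi> (at x) b) =
        - integral\<^sup>L (lebesgue_on \<Omega>) (\<lambda>x. (g x \<bullet> b) * \<phi> x)))"

text \<open>
  A weak gradient is unique up to null sets, so the choice affects neither norms nor integrals.
\<close>

definition weak_gradient :: "'a::euclidean_space set \<Rightarrow> ('a \<Rightarrow> real) \<Rightarrow> 'a \<Rightarrow> 'a" where
  "weak_gradient \<Omega> u = (SOME g. has_weak_gradient \<Omega> u g)"

definition W1 :: "'a::euclidean_space set \<Rightarrow> real \<Rightarrow> ('a \<Rightarrow> real) set" where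
  "W1 \<Omega> s = {u \<in> Lspace \<Omega> s. \<exists>g. has_weak_gradient \<Omega> u g \<and> g \<in> Lspace \<Omega> s}"

definition W1_inf :: "'a::euclidean_space set \<Rightarrow> ('a \<Rightarrow> real) set" where
  "W1_inf \<Omega> = {u \<in> Linf_space \<Omega>. \<exists>g. has_weak_gradient \<Omega> u g \<and> g \<in> Linf_space \<Omega>}"

definition W1_norm :: "'a::euclidean_space set \<Rightarrow> real \<Rightarrow> ('a \<Rightarrow> real) \<Rightarrow> real" where
  "W1_norm \<Omega> s u = Lnorm \<Omega> s u + Lnorm \<Omega> s (weak_gradient \<Omega> u)"

definition W1_0 :: "'a::euclidean_space set \<Rightarrow> real \<Rightarrow> ('a \<Rightarrow> real) set" where
  "W1_0 \<Omega> s = {u \<in> W1 \<Omega> s. \<exists>\<phi>. (\<forall>n::nat. test_function \<Omega> (\<phi> n)) \<and>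
                  (\<lambda>n. W1_norm \<Omega> s (\<lambda>x. u x - \<phi> n x)) \<longlonglongrightarrow> 0}"

definition C_0 :: "'a::euclidean_space set \<Rightarrow> ('a \<Rightarrow> real) set" where
  "C_0 \<Omega> = {u. continuous_on (closure \<Omega>) u \<and> (\<forall>x\<in>frontier \<Omega>. u x = 0)}"

text \<open>The minimum in the definition of \<open>\<Lambda>\<^sub>\<infinity>\<close> is attained and hence equals this infimum.\<close>

definition Lambda_inf :: "'a::euclidean_space set \<Rightarrow> real" where
  "Lambda_inf \<Omega> = Inf {Linf_norm \<Omega> (weak_gradient \<Omega> u) / Linf_norm \<Omega> u | u.
                         u \<in> W1_inf \<Omega> \<inter> C_0 \<Omega> \<and> (\<exists>x\<in>\<Omega>. u x \<noteq> 0)}"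

definition bdist :: "'a::euclidean_space set \<Rightarrow> 'a \<Rightarrow> real" where
  "bdist \<Omega> x = infdist x (frontier \<Omega>)"

text \<open>
  For \<open>max p q > DIM('a)\<close> every class in \<open>W1_0 \<Omega> (max p q)\<close> has a representative that is
  continuous up to the boundary; the continuity requirement below selects it. It then
  vanishes on \<open>frontier \<Omega>\<close>.
\<close>

definition X_space :: "'a::euclidean_space set \<Rightarrow> real \<Rightarrow> real \<Rightarrow> ('a \<Rightarrow> real) set" where
  "X_space \<Omega> p q = {u \<in> W1_0 \<Omega> (max p q). continuous_on (closure \<Omega>) u}"

definition J_energy ::
    "'a::euclidean_space set \<Rightarrow> real \<Rightarrow> real \<Rightarrow> real \<Rightarrow> ('a \<Rightarrow> real) \<Rightarrow> real" where
  "J_energy \<Omega> p q lam u =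
     1 / p * Lnorm \<Omega> p (weak_gradient \<Omega> u) powr p
     + 1 / q * Lnorm \<Omega> q (weak_gradient \<Omega> u) powr q
     - lam / p * Linf_norm \<Omega> u powr p"

definition Nehari ::
    "'a::euclidean_space set \<Rightarrow> real \<Rightarrow> real \<Rightarrow> real \<Rightarrow> ('a \<Rightarrow> real) set" where
  "Nehari \<Omega> p q lam = {u \<in> X_space \<Omega> p q. (\<exists>x\<in>\<Omega>. u x \<noteq> 0) \<and>
     Lnorm \<Omega> p (weak_gradient \<Omega> u) powr p + Lnorm \<Omega> q (weak_gradient \<Omega> u) powr q
       = lam * Linf_norm \<Omega> u powr p}"

text \<open>
  The least energy solutions of
  \<open>-(\<Delta>\<^sub>p + \<Delta>\<^sub>q) u = lam \<parallel>u\<parallel>\<^sub>\<infinity>\<^sup>p\<^sup>-\<^sup>1 \<delta>\<^bsub>x_u\<^esub>\<close> in \<open>\<Omega>\<close>, \<open>u = 0\<close> on \<open>frontier \<Omega>\<close>, are by definition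
  the minimizers of the energy, over the whole space or over the Nehari set.
\<close>

definition least_energy_solution ::
    "'a::euclidean_space set \<Rightarrow> real \<Rightarrow> real \<Rightarrow> real \<Rightarrow> ('a \<Rightarrow> real) \<Rightarrow> bool" where
  "least_energy_solution \<Omega> p q lam u \<longleftrightarrow>
     (real DIM('a) < p \<and> p < q \<and> u \<in> X_space \<Omega> p q \<and>
        (\<forall>v\<in>X_space \<Omega> p q. J_energy \<Omega> p q lam u \<le> J_energy \<Omega> p q lam v)) \<or>
     (real DIM('a) < q \<and> q < p \<and> u \<in> Nehari \<Omega> p q lam \<and>
        (\<forall>v\<in>Nehari \<Omega> p q lam. J_energy \<Omega> p q lam u \<le> J_energy \<Omega> p q lam v))"

definition max_points :: "'a::euclidean_space set \<Rightarrow> ('a \<Rightarrow> real) \<Rightarrow> 'a set" where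
  "max_points \<Omega> u = {x \<in> closure \<Omega>. \<forall>y\<in>closure \<Omega>. u y \<le> u x}"

text \<open>
  The pair \<open>(u\<^sub>0, x\<^sub>0)\<close> is a limit of the family \<open>(u\<^sub>p, x\<^sub>p)\<close> along the sequence \<open>pn\<close> and has
  the accompanying properties.
\<close>

definition limit_pair ::
    "'a::euclidean_space set \<Rightarrow> (real \<Rightarrow> 'a \<Rightarrow> real) \<Rightarrow> (real \<Rightarrow> 'a) \<Rightarrow>
     (nat \<Rightarrow> real) \<Rightarrow> ('a \<Rightarrow> real) \<Rightarrow> 'a \<Rightarrow> bool" where
  "limit_pair \<Omega> u x pn u0 x0 \<longleftrightarrow>
     filterlim pn at_top sequentially \<and> x0 \<in> \<Omega> \<and> u0 \<in> W1_inf \<Omega> \<inter> C_0 \<Omega> \<and>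
     (\<lambda>n. x (pn n)) \<longlonglongrightarrow> x0 \<and>
     uniform_limit (closure \<Omega>) (\<lambda>n. u (pn n)) u0 sequentially \<and>
     Linf_norm \<Omega> (weak_gradient \<Omega> u0) \<le> 1 \<and>
     u0 x0 = Linf_norm \<Omega> u0 \<and> Linf_norm \<Omega> u0 \<ge> 1 / Lambda_inf \<Omega>"

end

theory Submission
  imports Defs "HOL-Complex_Analysis.Great_Picard" "HOL-Real_Asymp.Real_Asymp"
begin

text \<open>
  Averaging over small cubes gives Morrey's inequality
  \<open>\<bar>v x - v y\<bar> \<le> H\<^sub>p(\<bar>x - y\<bar>) \<parallel>\<nabla>v\<parallel>\<^sub>p\<close> for test functions, with \<open>H\<^sub>p(d)\<close> tending to \<open>d\<close> as \<open>p\<close> grows,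
  and by density for all members of the solution space extended by zero. Taking \<open>y\<close> on the
  boundary, \<open>\<parallel>v\<parallel>\<^sub>\<infinity> \<le> K\<^sub>p \<parallel>\<nabla>v\<parallel>\<^sub>p\<close> where \<open>K\<^sub>p\<close> tends to the inradius \<open>R\<close> of \<open>\<Omega>\<close>; moreover
  \<open>R = 1 / \<Lambda>\<^sub>\<infinity>\<close>, because the distance to the boundary is an admissible function and mollification
  shows that \<open>\<bar>u\<bar> \<le> \<parallel>\<nabla>u\<parallel>\<^sub>\<infinity> \<rho>\<close> for every admissible \<open>u\<close>.

  On the Nehari set, which contains every least energy solution, the energy is the multiple
  \<open>1 / q - 1 / p\<close> of \<open>\<parallel>\<nabla>u\<parallel>\<^sub>q\<^sup>q\<close>. Comparing a least energy solution with a scaled mollification of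
  the truncated distance function, and combining Hoelder's inequality with the bound by \<open>K\<^sub>p\<close>,
  one bounds \<open>\<parallel>\<nabla>u\<^sub>p\<parallel>\<^sub>q\<close> from above by a quantity tending to \<open>1\<close> and \<open>\<parallel>u\<^sub>p\<parallel>\<^sub>\<infinity>\<close> from below by one tending
  to \<open>R\<close>. Compactness follows from Morrey's inequality for one fixed exponent, and letting the
  exponent tend to infinity shows that every limit is \<open>1\<close>-Lipschitz and hence lies below the distance
  to the boundary. At the limit of the maximum points both equal \<open>R\<close>.
\<close>

section \<open>Smooth functions\<close>

text \<open>All constants have to be sharp in the limit: a Morrey inequality with an unspecified
  constant would give compactness, but neither the exact value of the limit maximum nor the
  Lipschitz constant 1. The two regimes mirror each other because \<open>1 / q - 1 / p\<close>
  changes sign. For \<open>p < q\<close> minimality bounds the \<open>q\<close>-norm of the gradient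
  from below, which the Nehari identity turns into a lower bound for the maximum, while Morrey's
  inequality inserted into that identity bounds a positive power of the norm from above. For
  \<open>q < p\<close> the same two arguments yield the opposite bounds and exchange their roles.
  The hypothesis \<open>c > 1\<close> leaves the gap \<open>(c - 1) / 2\<close> in the energy
  balance of the competitor; it makes the scaling factor of the competitor positive and bounded, and
  all constants it produces disappear under roots whose order tends to infinity. That the distance
  function is admissible for the quotient defining \<open>Lambda_inf\<close> rests on the weak
  gradient of a Lipschitz function, which is obtained variationally and not through
  differentiability almost everywhere.\<close>

lemma Ck_Suc_imp_Ck: "Ck (Suc k) UNIV f \<Longrightarrow> Ck k UNIV f"
proof (induction k arbitrary: f)
  case 0
  then show ?case
    by (auto intro!: differentiable_imp_continuous_on simp: differentiable_on_def)
next
  case (Suc k)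
  show ?case
    unfolding Ck.simps(2)[of k] using Suc.prems Suc.IH by (metis Ck.simps(2))
qed

text \<open>Lets the derivative be given explicitly, so that \<open>frechet_derivative\<close> need
  not be computed inside the inductions.\<close>

lemma Ck_SucI:
  assumes "\<And>x. (f has_derivative D x) (at x)" "\<And>b. b \<in> Basis \<Longrightarrow> Ck k UNIV (\<lambda>x. D x b)"
  shows "Ck (Suc k) UNIV f"
proof -
  have "frechet_derivative f (at x) = D x" for x
    using assms(1) frechet_derivative_at by metis
  with assms show ?thesis by (auto simp: differentiable_def)
qed

lemma Ck_Suc_has_derivative:
  "Ck (Suc k) UNIV f \<Longrightarrow> (f has_derivative frechet_derivative f (at x)) (at x)"
  using frechet_derivative_works by auto

lemma Ck_const: "Ck k UNIV (\<lambda>x. c)"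
  by (induction k arbitrary: c) (auto simp: frechet_derivative_const)

lemma Ck_add: "Ck k UNIV f \<Longrightarrow> Ck k UNIV g \<Longrightarrow> Ck k UNIV (\<lambda>x. f x + g x)"
proof (induction k arbitrary: f g)
  case 0
  then show ?case by (auto intro: continuous_intros)
next
  case (Suc k)
  show ?case
    by (rule Ck_SucI[OF has_derivative_add[OF Suc.prems[THEN Ck_Suc_has_derivative]]])
       (use Suc in auto)
qed

lemma Ck_mult: "Ck k UNIV f \<Longrightarrow> Ck k UNIV g \<Longrightarrow> Ck k UNIV (\<lambda>x. f x * g x)"
proof (induction k arbitrary: f g)
  case 0
  then show ?case by (auto intro: continuous_intros)
next
  case (Suc k)
  show ?case
  proof (rule Ck_SucI[OF has_derivative_mult[OF Suc.prems[THEN Ck_Suc_has_derivative]]])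
    fix b :: 'a assume "b \<in> Basis"
    \<comment> \<open>The product rule keeps one factor undifferentiated, so the lower regularity of
      the factors themselves is needed as well.\<close>
    with Suc.prems Suc.IH Ck_Suc_imp_Ck[OF Suc.prems(1)] Ck_Suc_imp_Ck[OF Suc.prems(2)]
    show "Ck k UNIV (\<lambda>x. f x * frechet_derivative g (at x) b + frechet_derivative f (at x) b * g x)"
      by (intro Ck_add) auto
  qed
qed

text \<open>Taking a whole chain of derivatives \<open>D n\<close> as hypothesis makes the induction
  close without a general chain rule for \<open>Ck\<close>: every partial derivative is again a
  member of the chain times a constant.\<close>

lemma Ck_compose_affine:
  assumes "\<And>n t. (D n has_real_derivative D (Suc n) t) (at t)"
  shows "Ck k UNIV (\<lambda>x. D n (s * (x \<bullet> a) + c))"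
proof (induction k arbitrary: n)
  case 0
  have "continuous_on UNIV (D n)"
    using assms by (meson DERIV_continuous_on has_field_derivative_at_within)
  then show ?case
    by (auto intro!: continuous_intros continuous_on_compose2[of UNIV "D n"])
next
  case (Suc k)
  have "((\<lambda>x. D n (s * (x \<bullet> a) + c)) has_derivative
      (\<lambda>h. (s * (h \<bullet> a)) * D (Suc n) (s * (x \<bullet> a) + c))) (at x)" for x
    by (rule DERIV_compose_FDERIV[OF assms]) (auto intro!: derivative_eq_intros)
  then show ?case
    by (rule Ck_SucI) (intro Ck_mult Ck_const Suc)
qed

lemma smooth_const: "smooth (\<lambda>x. c)"
  by (simp add: smooth_def Ck_const)

lemma smooth_add: "smooth f \<Longrightarrow> smooth g \<Longrightarrow> smooth (\<lambda>x. f x + g x)"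
  by (simp add: smooth_def Ck_add)

lemma smooth_mult: "smooth f \<Longrightarrow> smooth g \<Longrightarrow> smooth (\<lambda>x. f x * g x)"
  by (simp add: smooth_def Ck_mult)

lemma smooth_prod: "finite I \<Longrightarrow> (\<And>i. i \<in> I \<Longrightarrow> smooth (f i)) \<Longrightarrow> smooth (\<lambda>x. \<Prod>i\<in>I. f i x)"
  by (induction I rule: finite_induct) (auto intro: smooth_const smooth_mult)

definition gradient :: "('a::euclidean_space \<Rightarrow> real) \<Rightarrow> 'a \<Rightarrow> 'a" where
  "gradient f x = (\<Sum>b\<in>Basis. frechet_derivative f (at x) b *\<^sub>R b)"

lemma gradient_inner_Basis: "b \<in> Basis \<Longrightarrow> gradient f x \<bullet> b = frechet_derivative f (at x) b"
  by (simp add: gradient_def inner_sum_left inner_Basis if_distrib cong: if_cong)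

lemma differentiable_has_gradient:
  assumes "f differentiable (at x)"
  shows "(f has_derivative (\<lambda>h. gradient f x \<bullet> h)) (at x)"
proof -
  have D: "(f has_derivative frechet_derivative f (at x)) (at x)"
    using assms frechet_derivative_works by blast
  then interpret bounded_linear "frechet_derivative f (at x)"
    by (rule has_derivative_bounded_linear)
  have "frechet_derivative f (at x) h = gradient f x \<bullet> h" for h
  proof -
    have "frechet_derivative f (at x) h = frechet_derivative f (at x) (\<Sum>b\<in>Basis. (h \<bullet> b) *\<^sub>R b)"
      by (simp add: euclidean_representation)
    also have "\<dots> = (\<Sum>b\<in>Basis. (h \<bullet> b) * frechet_derivative f (at x) b)"
      by (simp add: sum scaleR)
    also have "\<dots> = (\<Sum>b\<in>Basis. frechet_derivative f (at x) b * (b \<bullet> h))"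
      by (simp add: inner_commute mult.commute)
    finally show ?thesis
      by (simp add: gradient_def inner_sum_left)
  qed
  then have "frechet_derivative f (at x) = (\<lambda>h. gradient f x \<bullet> h)" by blast
  with D show ?thesis by simp
qed

lemma gradient_eqI:
  assumes "(f has_derivative (\<lambda>h. v \<bullet> h)) (at x)"
  shows "gradient f x = v"
  using frechet_derivative_at[OF assms]
  by (metis (mono_tags, lifting) euclidean_eqI gradient_inner_Basis)

lemma smooth_has_gradient: "smooth f \<Longrightarrow> (f has_derivative (\<lambda>h. gradient f x \<bullet> h)) (at x)"
  unfolding smooth_def by (rule differentiable_has_gradient) (metis Ck.simps(2) UNIV_I)

lemma smooth_continuous: "smooth f \<Longrightarrow> continuous_on S f"
  unfolding smooth_def by (metis Ck.simps(1) continuous_on_subset subset_UNIV)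

lemma smooth_partial: "smooth f \<Longrightarrow> b \<in> Basis \<Longrightarrow> smooth (\<lambda>x. gradient f x \<bullet> b)"
  unfolding smooth_def by (simp add: gradient_inner_Basis) (metis Ck.simps(2))

lemma smooth_gradient_continuous: "smooth f \<Longrightarrow> continuous_on S (gradient f)"
  by (rule continuous_on_componentwise[THEN iffD2]) (simp add: smooth_continuous smooth_partial)

lemma gradient_eq_0_outside:
  assumes "x \<notin> closure {x. f x \<noteq> 0}"
  shows "gradient f x = 0"
proof (rule gradient_eqI)
  have "((\<lambda>_. 0) has_derivative (\<lambda>h. 0 \<bullet> h)) (at x)" by simp
  then show "(f has_derivative (\<lambda>h. 0 \<bullet> h)) (at x)"
  proof (rule has_derivative_transform_within_open[where s="- closure {x. f x \<noteq> 0}"])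
    show "0 = f y" if "y \<in> - closure {x. f x \<noteq> 0}" for y
      using that closure_subset[of "{x. f x \<noteq> 0}"] by auto
  qed (use assms in auto)
qed

lemma gradient_add:
  "smooth f \<Longrightarrow> smooth g \<Longrightarrow> gradient (\<lambda>x. f x + g x) x = gradient f x + gradient g x"
  by (rule gradient_eqI)
     (auto intro!: derivative_eq_intros smooth_has_gradient simp: inner_add_left)

lemma gradient_mult:
  "smooth f \<Longrightarrow> smooth g \<Longrightarrow>
    gradient (\<lambda>x. f x * g x) x = g x *\<^sub>R gradient f x + f x *\<^sub>R gradient g x"
  by (rule gradient_eqI)
     (auto intro!: derivative_eq_intros smooth_has_gradient simp: algebra_simps inner_add_left)

lemma gradient_cmult: "smooth f \<Longrightarrow> gradient (\<lambda>x. t * f x) x = t *\<^sub>R gradient f x"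
  by (rule gradient_eqI) (auto intro!: derivative_eq_intros smooth_has_gradient)

lemma lipschitz_const_nonneg:
  fixes f :: "'a::euclidean_space \<Rightarrow> real"
  assumes "\<And>x y. \<bar>f x - f y\<bar> \<le> L * norm (x - y)"
  shows "0 \<le> L"
proof -
  obtain b :: 'a where "b \<in> Basis" using nonempty_Basis by blast
  with assms[of b 0] show ?thesis by (simp add: order_trans[OF abs_ge_zero])
qed

lemma lipschitz_imp_continuous:
  fixes f :: "'a::euclidean_space \<Rightarrow> real"
  assumes "\<And>x y. \<bar>f x - f y\<bar> \<le> L * norm (x - y)"
  shows "continuous_on S f"
  by (rule lipschitz_on_continuous_on[of L])
     (use assms lipschitz_const_nonneg[of f L] in \<open>auto simp: lipschitz_on_def dist_norm\<close>)

text \<open>Along the direction \<open>?v\<close> of the gradient itself the difference quotient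
  tends to \<open>?v \<bullet> ?v\<close>, while the Lipschitz condition bounds it by
  \<open>L * norm ?v\<close>.\<close>

lemma lipschitz_norm_gradient_le:
  assumes "smooth f" and lip: "\<And>x y. \<bar>f x - f y\<bar> \<le> L * norm (x - y)"
  shows "norm (gradient f x) \<le> L"
proof (cases "gradient f x = 0")
  case True
  then show ?thesis using lipschitz_const_nonneg[OF lip] by simp
next
  case False
  let ?v = "gradient f x"
  have D: "((\<lambda>t. f (x + t *\<^sub>R ?v)) has_real_derivative ?v \<bullet> ?v) (at 0)"
  proof -
    have "((\<lambda>t. x + t *\<^sub>R ?v) has_derivative (\<lambda>t. t *\<^sub>R ?v)) (at 0)"
      by (auto intro!: derivative_eq_intros)
    from has_derivative_compose[OF this, of f "\<lambda>h. ?v \<bullet> h"] smooth_has_gradient[OF assms(1)]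
    show ?thesis by (simp add: has_field_derivative_def mult_commute_abs)
  qed
  have "((\<lambda>t. (f (x + t *\<^sub>R ?v) - f x) / t) \<longlongrightarrow> ?v \<bullet> ?v) (at 0)"
    using D by (simp add: has_field_derivative_iff)
  moreover have "eventually (\<lambda>t. (f (x + t *\<^sub>R ?v) - f x) / t \<le> L * norm ?v) (at 0)"
  proof (rule eventually_at_ball'[THEN eventually_mono, of 1])
    fix t :: real assume "t \<in> ball 0 1 \<and> t \<noteq> 0 \<and> t \<in> UNIV"
    then have "t \<noteq> 0" by simp
    have "(f (x + t *\<^sub>R ?v) - f x) / t \<le> \<bar>f (x + t *\<^sub>R ?v) - f x\<bar> / \<bar>t\<bar>"
      by (metis abs_divide abs_ge_self)
    also have "\<dots> \<le> (L * (\<bar>t\<bar> * norm ?v)) / \<bar>t\<bar>"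
      using lip[of "x + t *\<^sub>R ?v" x] by (intro divide_right_mono) auto
    finally show "(f (x + t *\<^sub>R ?v) - f x) / t \<le> L * norm ?v"
      using \<open>t \<noteq> 0\<close> by simp
  qed simp
  ultimately have "?v \<bullet> ?v \<le> L * norm ?v"
    by (rule tendsto_upperbound) simp
  with False show ?thesis by (simp add: dot_square_norm power2_eq_square)
qed

section \<open>Test functions\<close>

lemma test_functionI:
  assumes "smooth \<phi>" "compact K" "K \<subseteq> \<Omega>" "\<And>x. x \<notin> K \<Longrightarrow> \<phi> x = 0"
  shows "test_function \<Omega> \<phi>"
proof -
  have "closure {x. \<phi> x \<noteq> 0} \<subseteq> K"
    using assms by (intro closure_minimal) (auto intro: compact_imp_closed)
  with assms show ?thesis
    unfolding test_function_def
    by (metis closed_closure compact_Int_closed inf.absorb_iff2 subset_trans)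
qed

lemma test_function_support:
  assumes "test_function \<Omega> \<phi>"
  obtains K where "compact K" "K \<subseteq> \<Omega>" "\<And>x. x \<notin> K \<Longrightarrow> \<phi> x = 0" "\<And>x. x \<notin> K \<Longrightarrow> gradient \<phi> x = 0"
proof
  show "compact (closure {x. \<phi> x \<noteq> 0})" "closure {x. \<phi> x \<noteq> 0} \<subseteq> \<Omega>"
    using assms by (auto simp: test_function_def)
  show "\<phi> x = 0" "gradient \<phi> x = 0" if "x \<notin> closure {x. \<phi> x \<noteq> 0}" for x
    using that closure_subset[of "{x. \<phi> x \<noteq> 0}"] gradient_eq_0_outside[of x \<phi>] by blast+
qed

lemma test_function_outside:
  assumes "test_function \<Omega> \<phi>" "x \<notin> \<Omega>"
  shows "\<phi> x = 0" "gradient \<phi> x = 0"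
  by (rule test_function_support[OF assms(1)], use assms(2) in blast)+

lemma test_function_smooth: "test_function \<Omega> \<phi> \<Longrightarrow> smooth \<phi>"
  by (simp add: test_function_def)

lemma test_function_mono: "test_function \<Omega> \<phi> \<Longrightarrow> \<Omega> \<subseteq> \<Omega>' \<Longrightarrow> test_function \<Omega>' \<phi>"
  by (auto simp: test_function_def)

lemma test_function_partial:
  assumes "test_function \<Omega> \<phi>" "b \<in> Basis"
  shows "test_function \<Omega> (\<lambda>x. gradient \<phi> x \<bullet> b)"
proof -
  obtain K where "compact K" "K \<subseteq> \<Omega>" "\<And>x. x \<notin> K \<Longrightarrow> gradient \<phi> x = 0"
    by (rule test_function_support[OF assms(1)]) blast
  then show ?thesis
    using assms by (intro test_functionI[of _ K]) (auto intro: smooth_partial test_function_smooth)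
qed

lemma test_function_mult_left:
  assumes "smooth f" "test_function \<Omega> \<phi>"
  shows "test_function \<Omega> (\<lambda>x. f x * \<phi> x)"
proof -
  obtain K where "compact K" "K \<subseteq> \<Omega>" "\<And>x. x \<notin> K \<Longrightarrow> \<phi> x = 0"
    by (rule test_function_support[OF assms(2)]) blast
  then show ?thesis
    using assms by (intro test_functionI[of _ K]) (auto intro: smooth_mult test_function_smooth)
qed

lemma test_function_continuous:
  "test_function \<Omega> \<phi> \<Longrightarrow> continuous_on S \<phi> \<and> continuous_on S (gradient \<phi>)"
  by (simp add: smooth_continuous smooth_gradient_continuous test_function_smooth)

lemma test_function_bounded:
  assumes "test_function \<Omega> \<phi>"
  obtains B where "0 < B" "\<And>x. \<bar>\<phi> x\<bar> \<le> B" "\<And>x. norm (gradient \<phi> x) \<le> B"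
proof -
  obtain K where K: "compact K" "\<And>x. x \<notin> K \<Longrightarrow> \<phi> x = 0" "\<And>x. x \<notin> K \<Longrightarrow> gradient \<phi> x = 0"
    by (rule test_function_support[OF assms]) blast
  have "compact (\<phi> ` K)" "compact (gradient \<phi> ` K)"
    using test_function_continuous[OF assms] K by (auto intro: compact_continuous_image)
  then obtain B C where "\<And>x. x \<in> K \<Longrightarrow> norm (\<phi> x) \<le> B" "\<And>x. x \<in> K \<Longrightarrow> norm (gradient \<phi> x) \<le> C"
    by (metis bounded_iff compact_imp_bounded imageI)
  then have *: "\<bar>\<phi> x\<bar> \<le> max (max B C) 1" "norm (gradient \<phi> x) \<le> max (max B C) 1" for x
    using K(2,3)[of x] by (cases "x \<in> K"; force simp: le_max_iff_disj)+
  show thesis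
    by (rule that[OF _ *]) simp
qed

subsection \<open>Bumps on boxes\<close>

text \<open>
  For \<open>t > 0\<close> the \<open>n\<close>-th derivative of \<open>exp (- 1 / t)\<close> is \<open>P\<^sub>n (1 / t) * exp (- 1 / t)\<close>, where \<open>P\<^sub>n\<close> is the
  following polynomial.
\<close>

primrec flat_poly :: "nat \<Rightarrow> real poly" where
  "flat_poly 0 = 1"
| "flat_poly (Suc n) = monom 1 2 * (flat_poly n - pderiv (flat_poly n))"

definition flat_exp :: "nat \<Rightarrow> real \<Rightarrow> real" where
  "flat_exp n t = (if t \<le> 0 then 0 else poly (flat_poly n) (inverse t) * exp (- inverse t))"

text \<open>The extra power \<open>s ^ k\<close> makes the induction on the coefficients work:
  \<open>pCons a p\<close> moves one factor \<open>s\<close> from the polynomial into the power. The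
  instance \<open>k = 1\<close> yields the derivative of \<open>flat_exp\<close> at 0, where the
  difference quotient contributes one more factor \<open>1 / t\<close>.\<close>

lemma tendsto_power_mult_poly_exp: "((\<lambda>s. s ^ k * poly p s * exp (- s)) \<longlongrightarrow> (0::real)) at_top"
proof (induction p arbitrary: k)
  case 0
  then show ?case by simp
next
  case (pCons a p)
  have "((\<lambda>s. a * (s ^ k / exp s) + s ^ Suc k * poly p s * exp (- s)) \<longlongrightarrow> a * 0 + 0) at_top"
    by (intro tendsto_intros tendsto_power_div_exp_0 pCons)
  then show ?case
    by (rule Lim_transform_eventually[THEN tendsto_eq_rhs])
       (auto simp: exp_minus divide_inverse algebra_simps)
qed

lemma flat_exp_DERIV: "(flat_exp n has_real_derivative flat_exp (Suc n) t) (at t)"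
proof -
  consider "t < 0" | "t > 0" | "t = 0" by linarith
  then show ?thesis
  proof cases
    case 1
    have "((\<lambda>_. 0) has_real_derivative flat_exp (Suc n) t) (at t)"
      using 1 by (simp add: flat_exp_def)
    then show ?thesis
      by (rule has_field_derivative_transform_within_open[of _ _ _ "{..<0}"])
         (use 1 in \<open>auto simp: flat_exp_def\<close>)
  next
    case 2
    have "((\<lambda>t. poly (flat_poly n) (inverse t) * exp (- inverse t)) has_real_derivative flat_exp (Suc n) t) (at t)"
      using 2
      by (auto intro!: derivative_eq_intros DERIV_chain2[OF poly_DERIV] simp: flat_exp_def poly_monom algebra_simps power2_eq_square)
    then show ?thesis
      by (rule has_field_derivative_transform_within_open[of _ _ _ "{0<..}"])
         (use 2 in \<open>auto simp: flat_exp_def\<close>)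
  next
    case 3
    have "((\<lambda>y. flat_exp n y / y) \<longlongrightarrow> 0) (at 0)"
    proof (rule filterlim_split_at)
      show "((\<lambda>y. flat_exp n y / y) \<longlongrightarrow> 0) (at_left 0)"
        by (rule Lim_transform_eventually[OF tendsto_const])
           (auto simp: flat_exp_def eventually_at_filter)
      have "((\<lambda>t. inverse t ^ 1 * poly (flat_poly n) (inverse t) * exp (- inverse t)) \<longlongrightarrow> 0) (at_right 0)"
        by (rule filterlim_compose[OF tendsto_power_mult_poly_exp filterlim_inverse_at_top_right])
      then show "((\<lambda>y. flat_exp n y / y) \<longlongrightarrow> 0) (at_right 0)"
        by (rule Lim_transform_eventually)
           (auto simp: flat_exp_def eventually_at_filter divide_inverse)
    qed
    with 3 show ?thesis
      by (simp add: has_field_derivative_iff flat_exp_def)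
  qed
qed

lemma flat_exp_0: "flat_exp 0 t = (if t \<le> 0 then 0 else exp (- inverse t))"
  by (simp add: flat_exp_def)

text \<open>The steepness \<open>k\<close> is a parameter because for growing \<open>k\<close> the
  bumps approximate the indicator of the open box, while the instance \<open>k = 1\<close> serves as
  profile of the mollifiers.\<close>

definition box_bump :: "real \<Rightarrow> 'a::euclidean_space \<Rightarrow> 'a \<Rightarrow> 'a \<Rightarrow> real" where
  "box_bump k a b x = (\<Prod>i\<in>Basis. flat_exp 0 (k * (x \<bullet> i - a \<bullet> i)) * flat_exp 0 (k * (b \<bullet> i - x \<bullet> i)))"

lemma smooth_box_bump: "smooth (box_bump k a b)"
proof -
  have "smooth (\<lambda>x. flat_exp 0 (k * (x \<bullet> i - a \<bullet> i)))" "smooth (\<lambda>x. flat_exp 0 (k * (b \<bullet> i - x \<bullet> i)))" for i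
    using Ck_compose_affine[of flat_exp _ 0 k i "- k * (a \<bullet> i)", OF flat_exp_DERIV]
      Ck_compose_affine[of flat_exp _ 0 "-k" i "k * (b \<bullet> i)", OF flat_exp_DERIV]
    by (simp_all add: smooth_def algebra_simps)
  then show ?thesis
    unfolding box_bump_def by (intro smooth_prod smooth_mult) auto
qed

lemma box_bump_bounds: "0 \<le> box_bump k a b x" "box_bump k a b x \<le> 1"
proof -
  have "0 \<le> flat_exp 0 t" "flat_exp 0 t \<le> 1" for t
    by (auto simp: flat_exp_0)
  then show "0 \<le> box_bump k a b x" "box_bump k a b x \<le> 1"
    unfolding box_bump_def by (auto intro!: prod_nonneg prod_le_1 mult_nonneg_nonneg mult_le_one)
qed

lemma box_bump_outside: "0 < k \<Longrightarrow> x \<notin> box a b \<Longrightarrow> box_bump k a b x = 0"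
  by (auto simp: box_bump_def box_def flat_exp_0 not_less mult_le_0_iff intro!: prod_zero)

lemma box_bump_pos: "0 < k \<Longrightarrow> x \<in> box a b \<Longrightarrow> 0 < box_bump k a b x"
  by (auto simp: box_bump_def box_def flat_exp_0 not_le intro!: prod_pos)
 
lemma test_function_box_bump:
  assumes "0 < k" "cbox a b \<subseteq> \<Omega>"
  shows "test_function \<Omega> (box_bump k a b)"
  by (rule test_functionI[of _ "cbox a b"])
     (use assms box_subset_cbox in \<open>auto simp: smooth_box_bump intro!: box_bump_outside\<close>)

lemma box_bump_tendsto_indicator: "(\<lambda>n. box_bump (real (Suc n)) a b x) \<longlonglongrightarrow> indicator (box a b) x"
proof (cases "x \<in> box a b")
  case True
  have *: "(\<lambda>n. flat_exp 0 (real (Suc n) * t)) \<longlonglongrightarrow> 1" if "t > 0" for t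
  proof -
    have "(\<lambda>n. exp (- inverse (real (Suc n) * t))) \<longlonglongrightarrow> 1"
      using that by real_asymp
    moreover have "\<not> real (Suc n) * t \<le> 0" for n
      using that by (simp add: mult_le_0_iff)
    ultimately show ?thesis by (simp only: flat_exp_0 if_False)
  qed
  have "(\<lambda>n. box_bump (real (Suc n)) a b x) \<longlonglongrightarrow> (\<Prod>i\<in>(Basis::'a set). 1 * 1)"
    unfolding box_bump_def using True by (intro tendsto_intros *) (auto simp: box_def)
  with True show ?thesis by simp
next
  case False
  then show ?thesis by (simp add: box_bump_outside)
qed

section \<open>Weak gradients\<close>

lemma integrable_lebesgue_on_iff:
  fixes f :: "'a::euclidean_space \<Rightarrow> 'b::{banach, second_countable_topology}"
  assumes "S \<in> sets lebesgue"
  shows "integrable (lebesgue_on S) f \<longleftrightarrow> integrable lebesgue (\<lambda>x. indicator S x *\<^sub>R f x)"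
  using assms by (intro integrable_restrict_space) simp

lemma integral_lebesgue_on_eq:
  fixes f :: "'a::euclidean_space \<Rightarrow> 'b::{banach, second_countable_topology}"
  assumes "S \<in> sets lebesgue"
  shows "integral\<^sup>L (lebesgue_on S) f = integral\<^sup>L lebesgue (\<lambda>x. indicator S x *\<^sub>R f x)"
  using assms by (intro integral_restrict_space) simp

lemma open_sets_lebesgue: "open S \<Longrightarrow> S \<in> sets lebesgue"
  by (simp add: borel_open)

lemma compact_sets_lebesgue: "compact S \<Longrightarrow> S \<in> sets lebesgue"
  by (simp add: borel_compact)

lemma borel_measurable_continuous_lebesgue:
  fixes f :: "'a::euclidean_space \<Rightarrow> 'b::euclidean_space"
  assumes "continuous_on UNIV f"
  shows "f \<in> borel_measurable lebesgue"
  using borel_measurable_continuous_onI[OF assms] by (simp add: measurable_completion)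

lemma integrable_compact_support:
  fixes f :: "'a::euclidean_space \<Rightarrow> 'b::euclidean_space"
  assumes "continuous_on UNIV f" "compact K" "\<And>x. x \<notin> K \<Longrightarrow> f x = 0"
  shows "integrable lborel f" "integrable lebesgue f" "integral\<^sup>L lebesgue f = integral\<^sup>L lborel f"
proof -
  have "f = (\<lambda>x. indicator K x *\<^sub>R f x)"
    using assms(3) by (auto simp: indicator_def)
  moreover have "integrable lborel (\<lambda>x. indicator K x *\<^sub>R f x)"
    using assms by (intro borel_integrable_compact) (auto intro: continuous_on_subset)
  ultimately show f: "integrable lborel f" by metis
  have "f \<in> borel_measurable lborel"
    using borel_measurable_continuous_onI[OF assms(1)] by simp
  with f show "integrable lebesgue f" "integral\<^sup>L lebesgue f = integral\<^sup>L lborel f"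
    by (simp_all add: integrable_completion integral_completion)
qed

section \<open>Integration by parts against test functions\<close>

lemma integral_lborel_translate:
  fixes f :: "'a::euclidean_space \<Rightarrow> 'b::euclidean_space"
  assumes "continuous_on UNIV f"
  shows "integral\<^sup>L lborel (\<lambda>x. f (c + x)) = integral\<^sup>L lborel f"
proof -
  have "integral\<^sup>L lborel f = integral\<^sup>L (distr lborel borel ((+) c)) f"
    by (simp add: lborel_distr_plus)
  also have "\<dots> = integral\<^sup>L lborel (\<lambda>x. f (c + x))"
    using borel_measurable_continuous_onI[OF assms] by (intro integral_distr) auto
  finally show ?thesis by simp
qed

lemma test_function_lipschitz:
  assumes "test_function \<Omega> \<phi>" "\<And>x. norm (gradient \<phi> x) \<le> B"
  shows "\<bar>\<phi> x - \<phi> y\<bar> \<le> B * norm (x - y)"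
proof -
  have "norm (\<phi> x - \<phi> y) \<le> B * norm (x - y)"
  proof (rule differentiable_bound[OF convex_UNIV])
    show "(\<phi> has_derivative (\<lambda>h. gradient \<phi> z \<bullet> h)) (at z within UNIV)" for z
      using smooth_has_gradient[OF test_function_smooth[OF assms(1)]] by simp
    show "onorm (\<lambda>h. gradient \<phi> z \<bullet> h) \<le> B" for z
    proof (rule onorm_le)
      fix h
      show "norm (gradient \<phi> z \<bullet> h) \<le> B * norm h"
        using order_trans[OF Cauchy_Schwarz_ineq2 mult_right_mono[OF assms(2) norm_ge_zero], of z h] by simp
    qed
  qed auto
  then show ?thesis by simp
qed

lemma has_derivative_difference_quotient:
  assumes "(f has_derivative (\<lambda>h. v \<bullet> h)) (at x)"
  shows "(\<lambda>n. (f (x + inverse (real (Suc n)) *\<^sub>R b) - f x) * real (Suc n)) \<longlonglongrightarrow> v \<bullet> b"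
proof -
  have "((\<lambda>t. x + t *\<^sub>R b) has_derivative (\<lambda>t. t *\<^sub>R b)) (at 0)"
    by (auto intro!: derivative_eq_intros)
  from has_derivative_compose[OF this, of f "\<lambda>h. v \<bullet> h"] assms
  have "((\<lambda>t. f (x + t *\<^sub>R b)) has_real_derivative v \<bullet> b) (at 0)"
    by (simp add: has_field_derivative_def mult_commute_abs)
  then have "((\<lambda>t. (f (x + t *\<^sub>R b) - f x) / t) \<longlongrightarrow> v \<bullet> b) (at 0)"
    by (simp add: has_field_derivative_iff)
  moreover have "filterlim (\<lambda>n. inverse (real (Suc n))) (at 0) sequentially"
    using LIMSEQ_inverse_real_of_nat by (auto simp: filterlim_at)
  ultimately have "(\<lambda>n. (f (x + inverse (real (Suc n)) *\<^sub>R b) - f x) / inverse (real (Suc n))) \<longlonglongrightarrow> v \<bullet> b"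
    by (rule filterlim_compose)
  then show ?thesis by (simp add: divide_inverse)
qed

text \<open>A partial derivative is the limit of difference quotients, whose integrals vanish
  because Lebesgue measure is invariant under translations. Dominated convergence passes to the
  limit, the bound on the gradient serving as Lipschitz constant in the majorant.\<close>

lemma integral_partial_test_function:
  fixes \<phi> :: "'a::euclidean_space \<Rightarrow> real"
  assumes \<phi>: "test_function \<Omega> \<phi>" and b: "b \<in> Basis"
  shows "integral\<^sup>L lborel (\<lambda>x. gradient \<phi> x \<bullet> b) = 0"
proof -
  obtain K where K: "compact K" "\<And>x. x \<notin> K \<Longrightarrow> \<phi> x = 0"
    by (rule test_function_support[OF \<phi>]) blast
  obtain B where B: "\<And>x. norm (gradient \<phi> x) \<le> B"
    by (rule test_function_bounded[OF \<phi>]) blast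
  obtain r where r: "\<And>x. x \<in> K \<Longrightarrow> norm x \<le> r"
    using compact_imp_bounded[OF K(1)] by (auto simp: bounded_iff)
  have c\<phi>: "continuous_on UNIV \<phi>"
    using test_function_continuous[OF \<phi>] by blast
  define d where "d n x = (\<phi> (x + inverse (real (Suc n)) *\<^sub>R b) - \<phi> x) * real (Suc n)" for n x
  have [continuous_intros]: "continuous_on UNIV (\<lambda>x. \<phi> (x + a))" for a
    by (rule continuous_on_compose2[OF c\<phi>]) (auto intro!: continuous_intros)
  have cd: "continuous_on UNIV (d n)" for n
    unfolding d_def by (intro continuous_intros c\<phi>)
  have "(\<lambda>n. integral\<^sup>L lborel (d n)) \<longlonglongrightarrow> integral\<^sup>L lborel (\<lambda>x. gradient \<phi> x \<bullet> b)"
  \<comment> \<open>The shifts have length at most 1, so one ball of radius \<open>r + 1\<close>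
    contains the supports of all difference quotients.\<close>
  proof (rule integral_dominated_convergence[where w="\<lambda>x. indicator (cball 0 (r + 1)) x * B"])
    show "(\<lambda>x. gradient \<phi> x \<bullet> b) \<in> borel_measurable lborel"
      using test_function_continuous[OF \<phi>, of UNIV]
      by (auto intro!: borel_measurable_continuous_onI continuous_intros)
    show "d n \<in> borel_measurable lborel" for n
      using borel_measurable_continuous_onI[OF cd] by simp
    show "integrable lborel (\<lambda>x. indicator (cball 0 (r + 1)) x * B)"
      using borel_integrable_compact[of "cball 0 (r+1)" "\<lambda>_. B"] by simp
    show "AE x in lborel. (\<lambda>n. d n x) \<longlonglongrightarrow> gradient \<phi> x \<bullet> b"
      unfolding d_def
      by (intro AE_I2 has_derivative_difference_quotient smooth_has_gradient test_function_smooth[OF \<phi>])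
    show "AE x in lborel. norm (d n x) \<le> indicator (cball 0 (r + 1)) x * B" for n
    proof (rule AE_I2)
      fix x
      have n1: "norm (inverse (real (Suc n)) *\<^sub>R b) \<le> 1"
        using b by (simp add: field_simps)
      show "norm (d n x) \<le> indicator (cball 0 (r + 1)) x * B"
      proof (cases "x \<in> cball 0 (r + 1)")
        case True
        have "norm (d n x) \<le> B * norm (inverse (real (Suc n)) *\<^sub>R b) * real (Suc n)"
          unfolding d_def using test_function_lipschitz[OF \<phi> B, of "x + inverse (real (Suc n)) *\<^sub>R b" x]
          by (auto simp: abs_mult intro!: mult_right_mono)
        also have "\<dots> = B" using b by simp
        finally show ?thesis using True by simp
      next
        case False
        have "x \<notin> K" using r[of x] False by (auto simp: norm_minus_commute)
        moreover have "x + inverse (real (Suc n)) *\<^sub>R b \<notin> K"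
        proof
          assume "x + inverse (real (Suc n)) *\<^sub>R b \<in> K"
          then have "norm (x + inverse (real (Suc n)) *\<^sub>R b) \<le> r" by (rule r)
          with n1 have "norm x \<le> r + 1"
            using norm_diff_ineq[of x "inverse (real (Suc n)) *\<^sub>R b"] by linarith
          with False show False by simp
        qed
        ultimately have "d n x = 0" using K(2) by (simp add: d_def)
        with False show ?thesis by simp
      qed
    qed
  qed
  moreover have "integral\<^sup>L lborel (d n) = 0" for n
  proof -
    have *: "continuous_on UNIV (\<lambda>x. \<phi> (c + x))" for c
      by (rule continuous_on_compose2[OF c\<phi>]) (auto intro!: continuous_intros)
    have "integrable lborel (\<lambda>x. \<phi> (c + x))" for c
    proof (rule integrable_compact_support(1)[OF *])
      show "compact ((\<lambda>x. x - c) ` K)"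
        by (intro compact_continuous_image continuous_intros K)
      show "\<phi> (c + x) = 0" if "x \<notin> (\<lambda>x. x - c) ` K" for x
        using that by (intro K(2)) (metis add_diff_cancel_left' imageI)
    qed
    from this this[of 0] integral_lborel_translate[OF c\<phi>]
    moreover have "d n = (\<lambda>x. (\<phi> (inverse (real (Suc n)) *\<^sub>R b + x) - \<phi> x) * real (Suc n))"
      by (simp add: d_def[abs_def] add.commute)
    ultimately show ?thesis by (simp del: of_nat_Suc)
  qed
  ultimately have "(\<lambda>n. 0) \<longlonglongrightarrow> integral\<^sup>L lborel (\<lambda>x. gradient \<phi> x \<bullet> b)" by simp
  then show ?thesis using LIMSEQ_unique tendsto_const by metis
qed

text \<open>The product of \<open>f\<close> and \<open>\<phi>\<close> is again a test function, so
  its partial derivative has integral 0.\<close>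

lemma integral_by_parts_test_function:
  fixes \<phi> :: "'a::euclidean_space \<Rightarrow> real"
  assumes f: "smooth f" and \<phi>: "test_function \<Omega> \<phi>" and b: "b \<in> Basis"
  shows "integral\<^sup>L lebesgue (\<lambda>x. f x * (gradient \<phi> x \<bullet> b)) = - integral\<^sup>L lebesgue (\<lambda>x. (gradient f x \<bullet> b) * \<phi> x)"
proof -
  obtain K where K: "compact K" "\<And>x. x \<notin> K \<Longrightarrow> \<phi> x = 0" "\<And>x. x \<notin> K \<Longrightarrow> gradient \<phi> x = 0"
    by (rule test_function_support[OF \<phi>]) blast
  note s = test_function_smooth[OF \<phi>]
  note c = smooth_continuous[OF s] smooth_continuous[OF f] smooth_gradient_continuous[OF s]
    smooth_gradient_continuous[OF f]
  have "integrable lborel (\<lambda>x. f x * (gradient \<phi> x \<bullet> b))"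
    "integral\<^sup>L lebesgue (\<lambda>x. f x * (gradient \<phi> x \<bullet> b)) = integral\<^sup>L lborel (\<lambda>x. f x * (gradient \<phi> x \<bullet> b))"
    by (rule integrable_compact_support[OF _ K(1)]; auto intro!: continuous_intros c simp: K)+
  moreover have "integrable lborel (\<lambda>x. (gradient f x \<bullet> b) * \<phi> x)"
    "integral\<^sup>L lebesgue (\<lambda>x. (gradient f x \<bullet> b) * \<phi> x) = integral\<^sup>L lborel (\<lambda>x. (gradient f x \<bullet> b) * \<phi> x)"
    by (rule integrable_compact_support[OF _ K(1)]; auto intro!: continuous_intros c simp: K)+
  moreover have "integral\<^sup>L lborel (\<lambda>x. f x * (gradient \<phi> x \<bullet> b) + (gradient f x \<bullet> b) * \<phi> x) = 0"
  proof -
    have "(\<lambda>x. f x * (gradient \<phi> x \<bullet> b) + (gradient f x \<bullet> b) * \<phi> x) = (\<lambda>x. gradient (\<lambda>x. f x * \<phi> x) x \<bullet> b)"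
      by (rule ext) (simp add: gradient_mult[OF f s] inner_add_left)
    then show ?thesis
      using integral_partial_test_function[OF test_function_mult_left[OF f \<phi>] b] by simp
  qed
  ultimately show ?thesis by simp
qed

lemma locally_integrable_continuous:
  fixes f :: "'a::euclidean_space \<Rightarrow> 'b::euclidean_space"
  assumes "continuous_on \<Omega> f"
  shows "locally_integrable \<Omega> f"
  unfolding locally_integrable_def
proof (intro allI impI)
  fix K assume K: "compact K \<and> K \<subseteq> \<Omega>"
  have *: "integrable lborel (\<lambda>x. indicator K x *\<^sub>R f x)"
    using K assms by (intro borel_integrable_compact) (auto intro: continuous_on_subset)
  moreover from * have "(\<lambda>x. indicator K x *\<^sub>R f x) \<in> borel_measurable lborel"
    by (rule borel_measurable_integrable)
  ultimately have "integrable lebesgue (\<lambda>x. indicator K x *\<^sub>R f x)"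
    by (simp add: integrable_completion)
  then show "integrable (lebesgue_on K) f"
    using K by (subst integrable_lebesgue_on_iff) (auto intro: compact_sets_lebesgue)
qed

lemma integral_lebesgue_on_zero_outside:
  fixes f :: "'a::euclidean_space \<Rightarrow> 'b::{banach, second_countable_topology}"
  assumes "S \<in> sets lebesgue" "\<And>x. x \<notin> S \<Longrightarrow> f x = 0"
  shows "integral\<^sup>L (lebesgue_on S) f = integral\<^sup>L lebesgue f"
  using assms by (subst integral_lebesgue_on_eq) (auto intro!: Bochner_Integration.integral_cong simp: indicator_def)

lemma smooth_has_weak_gradient:
  assumes "open \<Omega>" "smooth f"
  shows "has_weak_gradient \<Omega> f (gradient f)"
  unfolding has_weak_gradient_def
proof (intro conjI allI impI ballI)
  show "locally_integrable \<Omega> f" "locally_integrable \<Omega> (gradient f)"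
    using assms by (auto intro: locally_integrable_continuous smooth_continuous smooth_gradient_continuous)
  fix \<phi> :: "'a \<Rightarrow> real" and b :: 'a assume \<phi>: "test_function \<Omega> \<phi>" and b: "b \<in> Basis"
  note o = open_sets_lebesgue[OF assms(1)]
  have "integral\<^sup>L (lebesgue_on \<Omega>) (\<lambda>x. f x * frechet_derivative \<phi> (at x) b)
      = integral\<^sup>L lebesgue (\<lambda>x. f x * (gradient \<phi> x \<bullet> b))"
    using b by (subst integral_lebesgue_on_zero_outside[OF o])
      (auto simp: test_function_outside[OF \<phi>] simp flip: gradient_inner_Basis)
  also have "\<dots> = - integral\<^sup>L lebesgue (\<lambda>x. (gradient f x \<bullet> b) * \<phi> x)"
    by (rule integral_by_parts_test_function[OF assms(2) \<phi> b])
  also have "integral\<^sup>L lebesgue (\<lambda>x. (gradient f x \<bullet> b) * \<phi> x) =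
      integral\<^sup>L (lebesgue_on \<Omega>) (\<lambda>x. (gradient f x \<bullet> b) * \<phi> x)"
    by (subst integral_lebesgue_on_zero_outside[OF o]) (auto simp: test_function_outside[OF \<phi>])
  finally show "integral\<^sup>L (lebesgue_on \<Omega>) (\<lambda>x. f x * frechet_derivative \<phi> (at x) b) =
        - integral\<^sup>L (lebesgue_on \<Omega>) (\<lambda>x. (gradient f x \<bullet> b) * \<phi> x)" .
qed

lemma integrable_test_function_scaleR:
  fixes g :: "'a::euclidean_space \<Rightarrow> 'b::euclidean_space"
  assumes \<phi>: "test_function \<Omega> \<phi>" and g: "locally_integrable \<Omega> g"
  shows "integrable lebesgue (\<lambda>x. \<phi> x *\<^sub>R g x)"
proof -
  obtain K where K: "compact K" "K \<subseteq> \<Omega>" "\<And>x. x \<notin> K \<Longrightarrow> \<phi> x = 0"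
    by (rule test_function_support[OF \<phi>]) blast
  obtain B where B: "\<And>x. \<bar>\<phi> x\<bar> \<le> B" "B > 0"
    by (rule test_function_bounded[OF \<phi>]) blast
  have gK: "integrable lebesgue (\<lambda>x. indicator K x *\<^sub>R g x)"
    using g K compact_sets_lebesgue[OF K(1)]
    by (intro integrable_lebesgue_on_iff[THEN iffD1]) (auto simp: locally_integrable_def)
  have "integrable lebesgue (\<lambda>x. \<phi> x *\<^sub>R (indicator K x *\<^sub>R g x))"
  proof (rule Bochner_Integration.integrable_bound[OF integrable_mult_right[OF integrable_norm[OF gK], of B]])
    have "\<phi> \<in> borel_measurable lebesgue"
      using \<phi> by (intro borel_measurable_continuous_lebesgue) (simp add: test_function_continuous)
    then show "(\<lambda>x. \<phi> x *\<^sub>R (indicator K x *\<^sub>R g x)) \<in> borel_measurable lebesgue"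
      by (rule borel_measurable_scaleR[OF _ borel_measurable_integrable[OF gK]])
    show "AE x in lebesgue. norm (\<phi> x *\<^sub>R (indicator K x *\<^sub>R g x)) \<le> norm (B * norm (indicator K x *\<^sub>R g x))"
    proof (rule AE_I2)
      fix x
      have "\<bar>\<phi> x\<bar> * norm (indicator K x *\<^sub>R g x) \<le> B * norm (indicator K x *\<^sub>R g x)"
        by (rule mult_right_mono[OF B(1) norm_ge_zero])
      with B(2) show "norm (\<phi> x *\<^sub>R (indicator K x *\<^sub>R g x)) \<le> norm (B * norm (indicator K x *\<^sub>R g x))"
        by (simp only: norm_scaleR real_norm_def abs_mult abs_norm_cancel abs_of_pos)
    qed
  qed
  moreover have "(\<lambda>x. \<phi> x *\<^sub>R (indicator K x *\<^sub>R g x)) = (\<lambda>x. \<phi> x *\<^sub>R g x)"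
    using K(3) by (intro ext) (auto simp: indicator_def)
  ultimately show ?thesis by metis
qed

section \<open>The fundamental lemma of the calculus of variations\<close>

lemma sigma_finite_measure_lebesgue: "sigma_finite_measure (lebesgue :: 'a::euclidean_space measure)"
proof
  show "\<exists>A. countable A \<and> A \<subseteq> sets lebesgue \<and> \<Union>A = space lebesgue \<and> (\<forall>a\<in>A. emeasure lebesgue (a :: 'a set) \<noteq> \<infinity>)"
  proof (intro exI conjI ballI)
    show "\<Union>(range (\<lambda>n. cball (0 :: 'a) (real n))) = space lebesgue"
      by (auto simp: real_arch_simple)
    show "emeasure lebesgue a \<noteq> \<infinity>" if "a \<in> range (\<lambda>n. cball (0 :: 'a) (real n))" for a
      using that emeasure_compact_finite[of a] by auto
  qed auto
qed

text \<open>Testing with ever steeper bumps shows that \<open>g\<close> has integral zero over every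
  box whose closure lies in \<Omega>. Boxes are stable under intersection and generate the Borel
  sets, so the integral over every Borel part of \<open>box a b\<close> vanishes. Lebesgue sets
  differ from Borel sets by null sets only, and an integrable function with vanishing integrals over
  all measurable sets is zero almost everywhere.\<close>

lemma AE_zero_on_box:
  fixes g :: "'a::euclidean_space \<Rightarrow> 'b::euclidean_space"
  assumes g: "locally_integrable \<Omega> g"
    and zero: "\<And>\<phi>. test_function \<Omega> \<phi> \<Longrightarrow> integral\<^sup>L lebesgue (\<lambda>x. \<phi> x *\<^sub>R g x) = 0"
    and ab: "cbox a b \<subseteq> \<Omega>"
  shows "AE x in lebesgue. x \<in> box a b \<longrightarrow> g x = 0"
proof -
  define f where "f x = indicator (box a b) x *\<^sub>R g x" for x
  have int: "integrable lebesgue (\<lambda>x. indicator (box c d) x *\<^sub>R g x)" if "cbox c d \<subseteq> \<Omega>" for c d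
  proof -
    have "integrable lebesgue (\<lambda>x. indicator (cbox c d) x *\<^sub>R g x)"
      using g that by (intro integrable_lebesgue_on_iff[THEN iffD1]) (auto simp: locally_integrable_def)
    then have "integrable lebesgue (\<lambda>x. indicator (box c d) x *\<^sub>R (indicator (cbox c d) x *\<^sub>R g x))"
      by (rule integrable_mult_indicator[rotated]) simp
    moreover have "(\<lambda>x. indicator (box c d) x *\<^sub>R (indicator (cbox c d) x *\<^sub>R g x)) = (\<lambda>x. indicator (box c d) x *\<^sub>R g x)"
      using box_subset_cbox[of c d] by (intro ext) (auto simp: indicator_def)
    ultimately show ?thesis by simp
  qed
  have int0: "integral\<^sup>L lebesgue (\<lambda>x. indicator (box c d) x *\<^sub>R g x) = 0" if cd: "cbox c d \<subseteq> \<Omega>" for c d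
  proof -
    have b: "test_function \<Omega> (box_bump (real (Suc n)) c d)" for n
      using cd by (intro test_function_box_bump) auto
    have "(\<lambda>n. integral\<^sup>L lebesgue (\<lambda>x. box_bump (real (Suc n)) c d x *\<^sub>R g x)) \<longlonglongrightarrow>
       integral\<^sup>L lebesgue (\<lambda>x. indicator (box c d) x *\<^sub>R g x)"
    proof (rule integral_dominated_convergence[where w="\<lambda>x. norm (indicator (box c d) x *\<^sub>R g x)"])
      show "AE x in lebesgue. norm (box_bump (real (Suc n)) c d x *\<^sub>R g x) \<le> norm (indicator (box c d) x *\<^sub>R g x)" for n
      proof (rule AE_I2)
        fix x show "norm (box_bump (real (Suc n)) c d x *\<^sub>R g x) \<le> norm (indicator (box c d) x *\<^sub>R g x)"
          using box_bump_bounds[of "real (Suc n)" c d x] box_bump_outside[of "real (Suc n)" x c d]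
          by (cases "x \<in> box c d") (auto intro: mult_left_le_one_le)
      qed
      show "AE x in lebesgue. (\<lambda>n. box_bump (real (Suc n)) c d x *\<^sub>R g x) \<longlonglongrightarrow> indicator (box c d) x *\<^sub>R g x"
        by (intro AE_I2 tendsto_intros box_bump_tendsto_indicator)
      show "integrable lebesgue (\<lambda>x. norm (indicator (box c d) x *\<^sub>R g x))"
        by (rule integrable_norm[OF int[OF cd]])
    qed (use int[OF cd] integrable_test_function_scaleR[OF b g] in auto)
    then have "(\<lambda>n. 0) \<longlonglongrightarrow> integral\<^sup>L lebesgue (\<lambda>x. indicator (box c d) x *\<^sub>R g x)"
      unfolding zero[OF b] .
    then show ?thesis using LIMSEQ_unique tendsto_const by metis
  qed
  have f: "integrable lebesgue f"
    unfolding f_def by (rule int[OF ab])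
  have indI: "integrable lebesgue (\<lambda>x. indicator A x *\<^sub>R f x)" if "A \<in> sets lebesgue" for A
    using that f by (rule integrable_mult_indicator)
  have borel0: "set_lebesgue_integral lebesgue A f = 0" if "A \<in> sets borel" for A
  proof -
    let ?G = "range (\<lambda>(a, b). box a b :: 'a set)"
    have bs: "sets borel = sigma_sets UNIV ?G"
      by (simp add: borel_eq_box)
    have meas: "A \<in> sigma_sets UNIV ?G \<Longrightarrow> A \<in> sets lebesgue" for A
      using bs by (metis sets_completionI_sets sets_lborel)
    have "Int_stable ?G" by (auto simp: Int_stable_def box_Int_box)
    moreover have "?G \<subseteq> Pow UNIV" by simp
    moreover have "A \<in> sigma_sets UNIV ?G" using that bs by simp
    ultimately show ?thesis
    proof (induction rule: sigma_sets_induct_disjoint)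
      case (basic A)
      then obtain c d where A: "A = box c d" by auto
      \<comment> \<open>These are the corners of the intersection of the two boxes, which stays
        inside \<open>cbox a b\<close> and hence inside \<Omega>.\<close>
      define l u where "l = (\<Sum>i\<in>Basis. max (a \<bullet> i) (c \<bullet> i) *\<^sub>R i)" and "u = (\<Sum>i\<in>Basis. min (b \<bullet> i) (d \<bullet> i) *\<^sub>R i)"
      have "cbox l u \<subseteq> cbox a b" by (auto simp: mem_box l_def u_def)
      with ab have "cbox l u \<subseteq> \<Omega>" by blast
      moreover have "box a b \<inter> box c d = box l u"
        by (auto simp: mem_box l_def u_def)
      ultimately show ?case
        using int0[of l u] by (simp add: A f_def set_lebesgue_integral_def flip: indicator_inter_arith)
           (simp add: Int_commute)
    next
      case empty
      then show ?case by (simp add: set_lebesgue_integral_def)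
    next
      case (compl A)
      have "integral\<^sup>L lebesgue f = 0" unfolding f_def by (rule int0[OF ab])
      moreover have "set_lebesgue_integral lebesgue (UNIV - A) f = integral\<^sup>L lebesgue (\<lambda>x. f x - indicator A x *\<^sub>R f x)"
        unfolding set_lebesgue_integral_def
        by (intro Bochner_Integration.integral_cong) (auto simp: indicator_def)
      ultimately show ?case
        using compl f indI[OF meas[OF compl(1)]] by (simp add: set_lebesgue_integral_def)
    next
      case (union A)
      then have mA: "A i \<in> sets lebesgue" for i using meas by blast
      have "set_lebesgue_integral lebesgue (\<Union>i. A i) f = (\<Sum>i. set_lebesgue_integral lebesgue (A i) f)"
      proof (rule lebesgue_integral_countable_add)
        show "set_integrable lebesgue (\<Union>i. A i) f"
          unfolding set_integrable_def using mA by (intro indI) auto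
      qed (use union(1) mA in \<open>auto simp: disjoint_family_on_def\<close>)
      with union show ?case by simp
    qed
  qed
  have "AE x in lebesgue. f x = 0"
  proof (rule sigma_finite_measure.density_zero[OF sigma_finite_measure_lebesgue f])
    fix A :: "'a set" assume "A \<in> sets lebesgue"
    then obtain S N N' where SN: "A = S \<union> N" "N \<subseteq> N'" "N' \<in> null_sets lborel" "S \<in> sets lborel"
      by (rule sets_completionE) blast
    have "N' \<in> null_sets lebesgue"
      using SN(3) by (simp add: null_sets_completionI)
    then have "AE x in lebesgue. x \<notin> N'" by (rule AE_not_in)
    then have ae: "AE x in lebesgue. indicator A x *\<^sub>R f x = indicator S x *\<^sub>R f x"
      by eventually_elim (use SN in \<open>auto simp: indicator_def\<close>)
    have "S \<in> sets lebesgue" using SN by (simp add: sets_completionI_sets)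
    with ae have "set_lebesgue_integral lebesgue A f = set_lebesgue_integral lebesgue S f"
      unfolding set_lebesgue_integral_def using indI \<open>A \<in> sets lebesgue\<close>
      by (intro integral_cong_AE) (auto intro: borel_measurable_integrable)
    then show "set_lebesgue_integral lebesgue A f = 0"
      using borel0 SN by simp
  qed
  then show ?thesis by eventually_elim (auto simp: f_def)
qed

text \<open>An open set is a countable union of closed boxes, and the boundary of a box is a null
  set, so the statement on open boxes suffices.\<close>

lemma AE_zero_of_test_functions:
  fixes g :: "'a::euclidean_space \<Rightarrow> 'b::euclidean_space"
  assumes "open \<Omega>" and g: "locally_integrable \<Omega> g"
    and zero: "\<And>\<phi>. test_function \<Omega> \<phi> \<Longrightarrow> integral\<^sup>L lebesgue (\<lambda>x. \<phi> x *\<^sub>R g x) = 0"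
  shows "AE x in lebesgue_on \<Omega>. g x = 0"
proof -
  obtain D where D: "countable D" "D \<subseteq> Pow \<Omega>" "\<And>X. X \<in> D \<Longrightarrow> \<exists>a b. X = cbox a b" "\<Union>D = \<Omega>"
    by (rule open_countable_Union_open_cbox[OF assms(1)]) blast
  have "AE x in lebesgue. x \<in> X \<longrightarrow> g x = 0" if XD: "X \<in> D" for X
  proof -
    obtain a b where X: "X = cbox a b" using D(3)[OF XD] by blast
    then have 1: "AE x in lebesgue. x \<in> box a b \<longrightarrow> g x = 0"
      using D(2) XD by (intro AE_zero_on_box[OF g zero]) auto
    have "cbox a b - box a b \<in> null_sets lebesgue"
      using negligible_frontier_interval negligible_iff_null_sets by blast
    then have "AE x in lebesgue. x \<notin> cbox a b - box a b" by (rule AE_not_in)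
    with 1 show ?thesis by eventually_elim (auto simp: X)
  qed
  then have "AE x in lebesgue. \<forall>X\<in>D. x \<in> X \<longrightarrow> g x = 0"
    by (intro AE_ball_countable[THEN iffD2, OF D(1)] ballI)
  then have "AE x in lebesgue. x \<in> \<Omega> \<longrightarrow> g x = 0"
    by eventually_elim (use D(4) in auto)
  then show ?thesis
    using open_sets_lebesgue[OF assms(1)] by (subst AE_restrict_space_iff) auto
qed

section \<open>Algebra and uniqueness of weak gradients\<close>

lemma locally_integrable_diff:
  "locally_integrable \<Omega> f \<Longrightarrow> locally_integrable \<Omega> g \<Longrightarrow> locally_integrable \<Omega> (\<lambda>x. f x - g x)"
  by (auto simp: locally_integrable_def)

lemma locally_integrable_scaleR:
  fixes f :: "'a::euclidean_space \<Rightarrow> 'b::euclidean_space"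
  shows "locally_integrable \<Omega> f \<Longrightarrow> locally_integrable \<Omega> (\<lambda>x. t *\<^sub>R f x)"
  by (auto simp: locally_integrable_def)

lemma integrable_scaleR_gradient:
  fixes u :: "'a::euclidean_space \<Rightarrow> real"
  assumes \<phi>: "test_function \<Omega> \<phi>" and u: "locally_integrable \<Omega> u"
  shows "integrable lebesgue (\<lambda>x. u x *\<^sub>R gradient \<phi> x)"
proof -
  have "integrable lebesgue (\<lambda>x. \<Sum>b\<in>Basis. ((gradient \<phi> x \<bullet> b) *\<^sub>R u x) *\<^sub>R b)"
    by (intro Bochner_Integration.integrable_sum integrable_scaleR_left
        integrable_test_function_scaleR[OF test_function_partial[OF \<phi>] u])
  moreover have "(\<lambda>x. \<Sum>b\<in>Basis. ((gradient \<phi> x \<bullet> b) *\<^sub>R u x) *\<^sub>R b) = (\<lambda>x. u x *\<^sub>R gradient \<phi> x)"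
  proof
    fix x
    have "(\<Sum>b\<in>Basis. ((gradient \<phi> x \<bullet> b) *\<^sub>R u x) *\<^sub>R b) = u x *\<^sub>R (\<Sum>b\<in>Basis. (gradient \<phi> x \<bullet> b) *\<^sub>R b)"
      by (simp add: scaleR_sum_right mult.commute)
    then show "(\<Sum>b\<in>Basis. ((gradient \<phi> x \<bullet> b) *\<^sub>R u x) *\<^sub>R b) = u x *\<^sub>R gradient \<phi> x"
      by (simp add: euclidean_representation)
  qed
  ultimately show ?thesis by simp
qed

text \<open>The componentwise identities over \<Omega> merge into one vector identity over the whole
  space, because test functions and their gradients vanish outside \<Omega>. This is the form in
  which weak gradients are added, restricted and passed to limits.\<close>

lemma has_weak_gradient_iff:
  fixes u :: "'a::euclidean_space \<Rightarrow> real"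
  assumes "open \<Omega>"
  shows "has_weak_gradient \<Omega> u g \<longleftrightarrow> locally_integrable \<Omega> u \<and> locally_integrable \<Omega> g \<and>
    (\<forall>\<phi>. test_function \<Omega> \<phi> \<longrightarrow>
      integral\<^sup>L lebesgue (\<lambda>x. u x *\<^sub>R gradient \<phi> x) = - integral\<^sup>L lebesgue (\<lambda>x. \<phi> x *\<^sub>R g x))"
proof -
  have "(\<forall>b\<in>Basis. integral\<^sup>L (lebesgue_on \<Omega>) (\<lambda>x. u x * frechet_derivative \<phi> (at x) b) =
        - integral\<^sup>L (lebesgue_on \<Omega>) (\<lambda>x. (g x \<bullet> b) * \<phi> x)) \<longleftrightarrow>
      integral\<^sup>L lebesgue (\<lambda>x. u x *\<^sub>R gradient \<phi> x) = - integral\<^sup>L lebesgue (\<lambda>x. \<phi> x *\<^sub>R g x)"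
    if li: "locally_integrable \<Omega> u" "locally_integrable \<Omega> g" and \<phi>: "test_function \<Omega> \<phi>" for \<phi>
  proof -
    note o = open_sets_lebesgue[OF assms(1)]
    have i2: "integrable lebesgue (\<lambda>x. \<phi> x *\<^sub>R g x)"
      by (rule integrable_test_function_scaleR[OF \<phi> li(2)])
    have i1: "integrable lebesgue (\<lambda>x. u x *\<^sub>R gradient \<phi> x)"
      by (rule integrable_scaleR_gradient[OF \<phi> li(1)])
    have "integral\<^sup>L (lebesgue_on \<Omega>) (\<lambda>x. u x * frechet_derivative \<phi> (at x) b) =
        integral\<^sup>L lebesgue (\<lambda>x. u x *\<^sub>R gradient \<phi> x) \<bullet> b" if "b \<in> Basis" for b
      using that by (subst integral_lebesgue_on_zero_outside[OF o])
        (auto simp: test_function_outside[OF \<phi>] integral_inner_left[OF i1, of b, symmetric] simp flip: gradient_inner_Basis)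
    moreover have "integral\<^sup>L (lebesgue_on \<Omega>) (\<lambda>x. (g x \<bullet> b) * \<phi> x) =
        integral\<^sup>L lebesgue (\<lambda>x. \<phi> x *\<^sub>R g x) \<bullet> b" for b
      by (subst integral_lebesgue_on_zero_outside[OF o])
        (auto simp: test_function_outside[OF \<phi>] integral_inner_left[OF i2, of b, symmetric] mult.commute)
    ultimately show ?thesis
      by (auto simp: euclidean_eq_iff[of "integral\<^sup>L lebesgue (\<lambda>x. u x *\<^sub>R gradient \<phi> x)"])
  qed
  then show ?thesis unfolding has_weak_gradient_def by blast
qed

lemma has_weak_gradient_diff:
  assumes "open \<Omega>" "has_weak_gradient \<Omega> u g" "has_weak_gradient \<Omega> v h"
  shows "has_weak_gradient \<Omega> (\<lambda>x. u x - v x) (\<lambda>x. g x - h x)"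
  unfolding has_weak_gradient_iff[OF assms(1)]
proof (intro conjI allI impI)
  have li: "locally_integrable \<Omega> u" "locally_integrable \<Omega> g" "locally_integrable \<Omega> v" "locally_integrable \<Omega> h"
    using assms by (auto simp: has_weak_gradient_def)
  then show "locally_integrable \<Omega> (\<lambda>x. u x - v x)" "locally_integrable \<Omega> (\<lambda>x. g x - h x)"
    by (auto intro: locally_integrable_diff)
  fix \<psi> assume \<psi>: "test_function \<Omega> \<psi>"
  show "integral\<^sup>L lebesgue (\<lambda>x. (u x - v x) *\<^sub>R gradient \<psi> x) = - integral\<^sup>L lebesgue (\<lambda>x. \<psi> x *\<^sub>R (g x - h x))"
    using assms \<psi> integrable_scaleR_gradient[OF \<psi> li(1)] integrable_scaleR_gradient[OF \<psi> li(3)]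
      integrable_test_function_scaleR[OF \<psi> li(2)] integrable_test_function_scaleR[OF \<psi> li(4)]
    by (simp add: has_weak_gradient_iff scaleR_diff_left scaleR_diff_right)
qed

lemma has_weak_gradient_scaleR:
  assumes "open \<Omega>" "has_weak_gradient \<Omega> u g"
  shows "has_weak_gradient \<Omega> (\<lambda>x. t * u x) (\<lambda>x. t *\<^sub>R g x)"
  unfolding has_weak_gradient_iff[OF assms(1)]
proof (intro conjI allI impI)
  have li: "locally_integrable \<Omega> u" "locally_integrable \<Omega> g"
    using assms by (auto simp: has_weak_gradient_def)
  then show "locally_integrable \<Omega> (\<lambda>x. t * u x)" "locally_integrable \<Omega> (\<lambda>x. t *\<^sub>R g x)"
    using locally_integrable_scaleR[of \<Omega> _ t] by force+
  fix \<psi> assume \<psi>: "test_function \<Omega> \<psi>"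
  have "integral\<^sup>L lebesgue (\<lambda>x. (t * u x) *\<^sub>R gradient \<psi> x) = t *\<^sub>R integral\<^sup>L lebesgue (\<lambda>x. u x *\<^sub>R gradient \<psi> x)"
    by (simp flip: scaleR_scaleR)
  moreover have "integral\<^sup>L lebesgue (\<lambda>x. \<psi> x *\<^sub>R (t *\<^sub>R g x)) = t *\<^sub>R integral\<^sup>L lebesgue (\<lambda>x. \<psi> x *\<^sub>R g x)"
  proof -
    have "(\<lambda>x. \<psi> x *\<^sub>R (t *\<^sub>R g x)) = (\<lambda>x. t *\<^sub>R (\<psi> x *\<^sub>R g x))" by (simp add: mult.commute)
    then show ?thesis by (simp only: integral_scaleR_right)
  qed
  ultimately show "integral\<^sup>L lebesgue (\<lambda>x. (t * u x) *\<^sub>R gradient \<psi> x) = - integral\<^sup>L lebesgue (\<lambda>x. \<psi> x *\<^sub>R (t *\<^sub>R g x))"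
    using assms \<psi> by (simp add: has_weak_gradient_iff)
qed

text \<open>Both candidates have the same integral against every test function, so the fundamental
  lemma applies to their difference. Hence the choice behind \<open>weak_gradient\<close> does not
  affect norms.\<close>

lemma has_weak_gradient_unique:
  assumes "open \<Omega>" "has_weak_gradient \<Omega> u g" "has_weak_gradient \<Omega> u h"
  shows "AE x in lebesgue_on \<Omega>. g x = h x"
proof -
  have li: "locally_integrable \<Omega> g" "locally_integrable \<Omega> h"
    using assms by (auto simp: has_weak_gradient_def)
  have "AE x in lebesgue_on \<Omega>. g x - h x = 0"
  proof (rule AE_zero_of_test_functions[OF assms(1) locally_integrable_diff[OF li]])
    fix \<phi> assume \<phi>: "test_function \<Omega> \<phi>"
    have "- integral\<^sup>L lebesgue (\<lambda>x. \<phi> x *\<^sub>R g x) = - integral\<^sup>L lebesgue (\<lambda>x. \<phi> x *\<^sub>R h x)"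
      using assms(2,3) \<phi> unfolding has_weak_gradient_iff[OF assms(1)] by metis
    then show "integral\<^sup>L lebesgue (\<lambda>x. \<phi> x *\<^sub>R (g x - h x)) = 0"
      using integrable_test_function_scaleR[OF \<phi> li(1)] integrable_test_function_scaleR[OF \<phi> li(2)]
      by (simp add: scaleR_diff_right)
  qed
  then show ?thesis by eventually_elim simp
qed

lemma has_weak_gradient_weak_gradient: "has_weak_gradient \<Omega> u g \<Longrightarrow> has_weak_gradient \<Omega> u (weak_gradient \<Omega> u)"
  unfolding weak_gradient_def by (rule someI[of "\<lambda>g. has_weak_gradient \<Omega> u g"])

lemma weak_gradient_AE_eq:
  "open \<Omega> \<Longrightarrow> has_weak_gradient \<Omega> u g \<Longrightarrow> AE x in lebesgue_on \<Omega>. weak_gradient \<Omega> u x = g x"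
  by (rule has_weak_gradient_unique) (auto intro: has_weak_gradient_weak_gradient)

section \<open>Mollification\<close>

lemma mollifier_exists:
  fixes \<epsilon> :: real
  assumes "0 < \<epsilon>"
  obtains \<eta> :: "'a::euclidean_space \<Rightarrow> real" where "test_function UNIV \<eta>" "\<And>x. 0 \<le> \<eta> x"
    "\<And>x. \<eta> x \<noteq> 0 \<Longrightarrow> norm x \<le> \<epsilon>" "integral\<^sup>L lborel \<eta> = 1"
proof -
  \<comment> \<open>The norm is at most the sum of the absolute values of the coordinates, so the
    cube of half side \<open>e\<close> lies in the ball of radius \<epsilon>.\<close>
  define e where "e = \<epsilon> / real DIM('a)"
  have e: "0 < e" using assms by (simp add: e_def)
  define \<beta> :: "'a \<Rightarrow> real" where "\<beta> = box_bump 1 (- e *\<^sub>R One) (e *\<^sub>R One)"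
  have \<beta>: "test_function UNIV \<beta>"
    unfolding \<beta>_def by (rule test_function_box_bump) auto
  obtain K where K: "compact K" "\<And>x. x \<notin> K \<Longrightarrow> \<beta> x = 0"
    by (rule test_function_support[OF \<beta>]) blast
  have int: "integrable lborel \<beta>"
    using \<beta> K by (intro integrable_compact_support(1)[of \<beta> K]) (auto simp: test_function_continuous)
  define I where "I = integral\<^sup>L lborel \<beta>"
  have nn: "0 \<le> \<beta> x" for x by (simp add: \<beta>_def box_bump_bounds)
  \<comment> \<open>A vanishing integral would make the open box, on which the bump is positive, a
    null set.\<close>
  have "I \<noteq> 0"
  proof
    assume "I = 0"
    then have "AE x in lborel. \<beta> x = 0"
      using int nn by (simp add: I_def integral_nonneg_eq_0_iff_AE)
    moreover have "{x. \<beta> x \<noteq> 0} = box (- e *\<^sub>R One) (e *\<^sub>R One)"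
      using box_bump_pos[of 1 _ "- e *\<^sub>R One" "e *\<^sub>R One"] box_bump_outside[of 1 _ "- e *\<^sub>R One" "e *\<^sub>R One"]
      unfolding \<beta>_def by force
    ultimately have "emeasure lborel (box (- e *\<^sub>R One) (e *\<^sub>R One) :: 'a set) = 0"
      by (subst (asm) AE_iff_measurable[OF _ refl]) auto
    moreover have "0 < (\<Prod>b\<in>Basis. (e *\<^sub>R One + e *\<^sub>R One :: 'a) \<bullet> b)"
      using e by (intro prod_pos) (auto simp: inner_add_left)
    ultimately show False
      using e by (auto simp: emeasure_lborel_box_eq inner_diff_left inner_add_left split: if_splits)
  qed
  then have I: "0 < I" using nn by (simp add: I_def less_le integral_nonneg_AE)
  show thesis
  proof (rule that[of "\<lambda>x. inverse I * \<beta> x"])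
    show "test_function UNIV (\<lambda>x. inverse I * \<beta> x)"
      by (intro test_function_mult_left smooth_const \<beta>)
    show "0 \<le> inverse I * \<beta> x" for x using I nn by simp
    show "integral\<^sup>L lborel (\<lambda>x. inverse I * \<beta> x) = 1"
      using I by (simp add: I_def)
    show "norm x \<le> \<epsilon>" if "inverse I * \<beta> x \<noteq> 0" for x
    proof -
      have "x \<in> box (- e *\<^sub>R One) (e *\<^sub>R One)"
        using that box_bump_outside[of 1 x "- e *\<^sub>R One" "e *\<^sub>R One"] by (auto simp: \<beta>_def)
      then have "(\<Sum>b\<in>Basis. \<bar>x \<bullet> b\<bar>) \<le> (\<Sum>b\<in>(Basis::'a set). e)"
        by (intro sum_mono) (auto simp: mem_box abs_le_iff intro: less_imp_le; smt (verit))
      then show ?thesis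
        using norm_le_l1[of x] by (simp add: e_def)
    qed
  qed
qed

definition convolve :: "('a::euclidean_space \<Rightarrow> real) \<Rightarrow> ('a \<Rightarrow> real) \<Rightarrow> 'a \<Rightarrow> real" where
  "convolve f \<eta> x = integral\<^sup>L lebesgue (\<lambda>y. f y * \<eta> (x - y))"

lemma integrable_scaleR_bounded:
  fixes f :: "'a::euclidean_space \<Rightarrow> real" and k :: "'a \<Rightarrow> 'b::euclidean_space"
  assumes f: "integrable lebesgue f" and k: "k \<in> borel_measurable lebesgue" "\<And>x. norm (k x) \<le> B"
  shows "integrable lebesgue (\<lambda>x. f x *\<^sub>R k x)"
proof (rule Bochner_Integration.integrable_bound[OF integrable_mult_right[OF integrable_norm[OF f], of B]])
  show "(\<lambda>x. f x *\<^sub>R k x) \<in> borel_measurable lebesgue"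
    using f k by (intro borel_measurable_scaleR) auto
  show "AE x in lebesgue. norm (f x *\<^sub>R k x) \<le> norm (B * norm (f x))"
  proof (rule AE_I2)
    fix x
    have "norm (f x *\<^sub>R k x) \<le> \<bar>B\<bar> * norm (f x)"
      using k(2)[of x] by (simp add: mult.commute[of "\<bar>f x\<bar>"] mult_right_mono)
    then show "norm (f x *\<^sub>R k x) \<le> norm (B * norm (f x))" by (simp add: abs_mult)
  qed
qed

lemma continuous_on_reflect:
  fixes k :: "'a::euclidean_space \<Rightarrow> 'b::euclidean_space"
  assumes "continuous_on UNIV k"
  shows "continuous_on UNIV (\<lambda>y. k (x - y))"
  by (rule continuous_on_compose2[OF assms]) (auto intro!: continuous_intros)

lemma integrable_convolve:
  fixes k :: "'a::euclidean_space \<Rightarrow> 'b::euclidean_space"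
  assumes f: "integrable lebesgue f" and k: "continuous_on UNIV k" "\<And>x. norm (k x) \<le> B"
  shows "integrable lebesgue (\<lambda>y. f y *\<^sub>R k (x - y))"
  by (rule integrable_scaleR_bounded[OF f, of _ B])
     (auto intro!: borel_measurable_continuous_lebesgue continuous_on_reflect k)

text \<open>Only the kernel is differentiated, so integrability of \<open>f\<close> is enough. The
  normalized Taylor remainder \<open>q\<close> of the kernel is bounded by \<open>2 * B\<close> and
  tends to 0 pointwise; dominated convergence along sequences does the rest.\<close>

lemma convolve_has_derivative:
  assumes f: "integrable lebesgue f" and \<eta>: "test_function UNIV \<eta>"
  shows "(convolve f \<eta> has_derivative (\<lambda>h. integral\<^sup>L lebesgue (\<lambda>y. f y *\<^sub>R gradient \<eta> (x - y)) \<bullet> h)) (at x)"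
proof -
  obtain B where B: "B > 0" "\<And>x. \<bar>\<eta> x\<bar> \<le> B" "\<And>x. norm (gradient \<eta> x) \<le> B"
    by (rule test_function_bounded[OF \<eta>]) blast
  have c: "continuous_on UNIV \<eta>" "continuous_on UNIV (gradient \<eta>)"
    using test_function_continuous[OF \<eta>] by auto
  note s = test_function_smooth[OF \<eta>]
  have i0: "integrable lebesgue (\<lambda>y. f y * \<eta> (z - y))" for z
    using integrable_convolve[OF f c(1), of B z] B by simp
  have i1: "integrable lebesgue (\<lambda>y. f y *\<^sub>R gradient \<eta> (x - y))"
    by (rule integrable_convolve[OF f c(2) B(3)])
  let ?D = "integral\<^sup>L lebesgue (\<lambda>y. f y *\<^sub>R gradient \<eta> (x - y))"
  define q where "q h y = (\<eta> (x + h - y) - \<eta> (x - y) - gradient \<eta> (x - y) \<bullet> h) / norm h" for h y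
  have eq: "norm (convolve f \<eta> (x + h) - convolve f \<eta> x - ?D \<bullet> h) / norm h
      = \<bar>integral\<^sup>L lebesgue (\<lambda>y. f y * q h y)\<bar>" for h
  proof -
    have "convolve f \<eta> (x + h) - convolve f \<eta> x - ?D \<bullet> h =
       integral\<^sup>L lebesgue (\<lambda>y. f y * \<eta> (x + h - y) - f y * \<eta> (x - y) - (f y *\<^sub>R gradient \<eta> (x - y)) \<bullet> h)"
      using i0[of x] i0[of "x + h"] i1 integrable_inner_left[OF i1, of h]
      by (simp add: convolve_def del: inner_scaleR_left)
    moreover have "integral\<^sup>L lebesgue (\<lambda>y. f y * q h y) = integral\<^sup>L lebesgue
        (\<lambda>y. (f y * \<eta> (x + h - y) - f y * \<eta> (x - y) - (f y *\<^sub>R gradient \<eta> (x - y)) \<bullet> h) / norm h)"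
      by (intro Bochner_Integration.integral_cong) (auto simp: q_def algebra_simps diff_divide_distrib)
    ultimately show ?thesis by simp
  qed
  have "((\<lambda>h. integral\<^sup>L lebesgue (\<lambda>y. f y * q h y)) \<longlongrightarrow> 0) (at 0)"
    unfolding tendsto_at_iff_sequentially comp_def
  proof (intro allI impI)
    fix h :: "nat \<Rightarrow> 'a" assume h: "\<forall>i. h i \<in> UNIV - {0}" "h \<longlonglongrightarrow> 0"
    have qb: "\<bar>q (h n) y\<bar> \<le> 2 * B" for n y
    proof -
      have "\<bar>\<eta> (x + h n - y) - \<eta> (x - y)\<bar> \<le> B * norm (h n)"
        using test_function_lipschitz[OF \<eta> B(3), of "x + h n - y" "x - y"] by simp
      moreover have "\<bar>gradient \<eta> (x - y) \<bullet> h n\<bar> \<le> B * norm (h n)"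
        by (rule order_trans[OF Cauchy_Schwarz_ineq2 mult_right_mono[OF B(3) norm_ge_zero]])
      ultimately show ?thesis
        using h(1) by (auto simp: q_def divide_le_eq)
    qed
    have mq: "(\<lambda>y. q (h n) y) \<in> borel_measurable lebesgue" for n
      unfolding q_def by (intro borel_measurable_continuous_lebesgue continuous_intros continuous_on_reflect c) (use h in auto)
    have "(\<lambda>n. integral\<^sup>L lebesgue (\<lambda>y. f y * q (h n) y)) \<longlonglongrightarrow> integral\<^sup>L lebesgue (\<lambda>y. f y * 0)"
    proof (rule integral_dominated_convergence[where w="\<lambda>y. 2 * B * \<bar>f y\<bar>"])
      show "integrable lebesgue (\<lambda>y. 2 * B * \<bar>f y\<bar>)"
        using f by simp
      show "AE y in lebesgue. norm (f y * q (h n) y) \<le> 2 * B * \<bar>f y\<bar>" for n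
        using qb by (intro AE_I2) (simp add: abs_mult mult.commute mult_left_mono)
      show "AE y in lebesgue. (\<lambda>n. f y * q (h n) y) \<longlonglongrightarrow> f y * 0"
      proof (intro AE_I2 tendsto_intros)
        fix y
        have "((\<lambda>h. norm (\<eta> ((x - y) + h) - \<eta> (x - y) - gradient \<eta> (x - y) \<bullet> h) / norm h) \<longlongrightarrow> 0) (at 0)"
          using smooth_has_gradient[OF s, of "x - y"] by (simp add: has_derivative_at)
        then have "(\<lambda>n. norm (\<eta> ((x - y) + h n) - \<eta> (x - y) - gradient \<eta> (x - y) \<bullet> h n) / norm (h n)) \<longlonglongrightarrow> 0"
          using h unfolding tendsto_at_iff_sequentially comp_def by blast
        then have "(\<lambda>n. \<bar>q (h n) y\<bar>) \<longlonglongrightarrow> 0"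
          by (simp add: q_def algebra_simps)
        then show "(\<lambda>n. q (h n) y) \<longlonglongrightarrow> 0" by (simp add: tendsto_rabs_zero_iff)
      qed
    qed (use f mq in \<open>auto intro!: borel_measurable_times\<close>)
    then show "(\<lambda>n. integral\<^sup>L lebesgue (\<lambda>y. f y * q (h n) y)) \<longlonglongrightarrow> 0" by simp
  qed
  then have "((\<lambda>h. \<bar>integral\<^sup>L lebesgue (\<lambda>y. f y * q h y)\<bar>) \<longlongrightarrow> 0) (at 0)"
    by (simp add: tendsto_rabs_zero_iff)
  then show ?thesis
    unfolding has_derivative_at eq by (simp add: bounded_linear_inner_right)
qed

lemma gradient_convolve:
  assumes "integrable lebesgue f" "test_function UNIV \<eta>"
  shows "gradient (convolve f \<eta>) x = integral\<^sup>L lebesgue (\<lambda>y. f y *\<^sub>R gradient \<eta> (x - y))"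
  by (rule gradient_eqI[OF convolve_has_derivative[OF assms]])

text \<open>The partial derivatives of \<open>convolve f \<eta>\<close> are convolutions of
  \<open>f\<close> with partial derivatives of \<open>\<eta>\<close>, which are test functions
  again, so the induction runs over all kernels at once.\<close>

lemma smooth_convolve:
  assumes f: "integrable lebesgue f" and "test_function UNIV \<eta>"
  shows "smooth (convolve f \<eta>)"
proof -
  have "Ck k UNIV (convolve f \<eta>)" if "test_function UNIV \<eta>" for k \<eta>
    using that
  proof (induction k arbitrary: \<eta>)
    case 0
    have "convolve f \<eta> differentiable at x" for x
      using convolve_has_derivative[OF f 0] by (auto simp: differentiable_def)
    then show ?case
      by (auto intro!: differentiable_imp_continuous_on simp: differentiable_on_def)
  next
    case (Suc k)
    obtain B where B: "\<And>x. norm (gradient \<eta> x) \<le> B"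
      by (rule test_function_bounded[OF Suc.prems]) blast
    have "continuous_on UNIV (gradient \<eta>)"
      using test_function_continuous[OF Suc.prems] by auto
    then have i1: "integrable lebesgue (\<lambda>y. f y *\<^sub>R gradient \<eta> (x - y))" for x
      by (rule integrable_convolve[OF f _ B])
    show ?case
    proof (rule Ck_SucI[OF convolve_has_derivative[OF f Suc.prems]])
      fix b :: 'a assume b: "b \<in> Basis"
      have "integral\<^sup>L lebesgue (\<lambda>y. f y *\<^sub>R gradient \<eta> (x - y)) \<bullet> b = convolve f (\<lambda>z. gradient \<eta> z \<bullet> b) x" for x
        unfolding convolve_def by (subst integral_inner_left[OF i1, symmetric]) simp
      then show "Ck k UNIV (\<lambda>x. integral\<^sup>L lebesgue (\<lambda>y. f y *\<^sub>R gradient \<eta> (x - y)) \<bullet> b)"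
        using Suc.IH[OF test_function_partial[OF Suc.prems b]] by presburger
    qed
  qed
  with assms show ?thesis by (simp add: smooth_def)
qed

lemma integral_lborel_reflect:
  fixes F :: "'a::euclidean_space \<Rightarrow> real"
  assumes "continuous_on UNIV F"
  shows "integral\<^sup>L lborel (\<lambda>z. F (c - z)) = integral\<^sup>L lborel F"
proof -
  have m: "F \<in> borel_measurable borel"
    using borel_measurable_continuous_onI[OF assms] .
  have "lborel = distr lborel borel (\<lambda>x. c - x)"
    using lborel_affine[of "-1" c] by (simp add: density_1)
  then have "integral\<^sup>L lborel F = integral\<^sup>L (distr lborel borel (\<lambda>x. c - x)) F"
    by simp
  also have "\<dots> = integral\<^sup>L lborel (\<lambda>z. F (c - z))"
    by (subst integral_distr) (auto simp: m)
  finally show ?thesis by simp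
qed

text \<open>After a reflection of the variable, the mollification averages the translates
  \<open>f (x - z)\<close> with a probability density carried by the ball of radius \<epsilon>.
  Averaging does not increase the Lipschitz constant and moves values by at most
  \<open>L * \<epsilon>\<close>.\<close>

lemma lipschitz_mollify:
  fixes f :: "'a::euclidean_space \<Rightarrow> real"
  assumes lip: "\<And>x y. \<bar>f x - f y\<bar> \<le> L * norm (x - y)"
    and K: "compact K" "\<And>x. x \<notin> K \<Longrightarrow> f x = 0" and "0 < \<epsilon>"
  obtains \<phi> where "smooth \<phi>" "\<And>x y. \<bar>\<phi> x - \<phi> y\<bar> \<le> L * norm (x - y)" "\<And>x. \<bar>\<phi> x - f x\<bar> \<le> L * \<epsilon>"
    "\<And>x. (\<And>y. y \<in> K \<Longrightarrow> \<epsilon> < norm (x - y)) \<Longrightarrow> \<phi> x = 0"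
proof -
  obtain \<eta> :: "'a \<Rightarrow> real" where \<eta>: "test_function UNIV \<eta>" "\<And>x. 0 \<le> \<eta> x"
    "\<And>x. \<eta> x \<noteq> 0 \<Longrightarrow> norm x \<le> \<epsilon>" "integral\<^sup>L lborel \<eta> = 1"
    using mollifier_exists[OF \<open>0 < \<epsilon>\<close>] by metis
  obtain M where M: "compact M" "\<And>x. x \<notin> M \<Longrightarrow> \<eta> x = 0"
    by (rule test_function_support[OF \<eta>(1)]) blast
  have c\<eta>: "continuous_on UNIV \<eta>"
    using test_function_continuous[OF \<eta>(1)] by auto
  have i\<eta>: "integrable lborel \<eta>"
    by (rule integrable_compact_support[OF c\<eta> M])
  have L: "0 \<le> L" by (rule lipschitz_const_nonneg[OF lip])
  have cf: "continuous_on UNIV f" by (rule lipschitz_imp_continuous[OF lip])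
  have if': "integrable lebesgue f"
    by (rule integrable_compact_support[OF cf K])
  define \<phi> where "\<phi> = convolve f \<eta>"
  have cF: "continuous_on UNIV (\<lambda>z. f (x - z) * \<eta> z)" for x
    by (intro continuous_intros continuous_on_reflect cf c\<eta>)
  have iF: "integrable lborel (\<lambda>z. f (x - z) * \<eta> z)" for x
    by (rule integrable_compact_support[OF cF M(1)]) (simp add: M)
  have \<phi>: "\<phi> x = integral\<^sup>L lborel (\<lambda>z. f (x - z) * \<eta> z)" for x
  proof -
    have "\<phi> x = integral\<^sup>L lborel (\<lambda>y. f y * \<eta> (x - y))"
      unfolding \<phi>_def convolve_def
      by (rule integrable_compact_support(3)[OF _ K(1)])
         (auto intro!: continuous_intros continuous_on_reflect cf c\<eta> simp: K)
    also have "\<dots> = integral\<^sup>L lborel (\<lambda>z. f (x - z) * \<eta> (x - (x - z)))"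
      by (rule integral_lborel_reflect[symmetric])
         (intro continuous_intros continuous_on_reflect cf c\<eta>)
    finally show ?thesis by simp
  qed
  have bound: "\<bar>integral\<^sup>L lborel (\<lambda>z. d z * \<eta> z)\<bar> \<le> C"
    if "integrable lborel (\<lambda>z. d z * \<eta> z)" "\<And>z. norm z \<le> \<epsilon> \<Longrightarrow> \<bar>d z\<bar> \<le> C" for d C
  proof -
    have "norm (integral\<^sup>L lborel (\<lambda>z. d z * \<eta> z)) \<le> integral\<^sup>L lborel (\<lambda>z. C * \<eta> z)"
    proof (rule Bochner_Integration.integral_norm_bound_integral[OF that(1)])
      show "norm (d z * \<eta> z) \<le> C * \<eta> z" for z
        using that(2)[of z] \<eta>(2,3)[of z] by (cases "\<eta> z = 0") (auto simp: abs_mult mult_right_mono)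
    qed (use i\<eta> in simp)
    then show ?thesis using \<eta>(4) i\<eta> by simp
  qed
  show thesis
  proof (rule that[of \<phi>])
    show "smooth \<phi>"
      unfolding \<phi>_def by (rule smooth_convolve[OF if' \<eta>(1)])
    show "\<bar>\<phi> x - \<phi> y\<bar> \<le> L * norm (x - y)" for x y
    proof -
      have "integrable lborel (\<lambda>z. (f (x - z) - f (y - z)) * \<eta> z)"
        using iF[of x] iF[of y] by (simp add: left_diff_distrib)
      then have "\<bar>integral\<^sup>L lborel (\<lambda>z. (f (x - z) - f (y - z)) * \<eta> z)\<bar> \<le> L * norm (x - y)"
        by (rule bound) (rule order_trans[OF lip], simp)
      then show ?thesis
        using iF[of x] iF[of y] by (simp add: left_diff_distrib \<phi>)
    qed
    show "\<bar>\<phi> x - f x\<bar> \<le> L * \<epsilon>" for x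
    proof -
      have *: "integrable lborel (\<lambda>z. (f (x - z) - f x) * \<eta> z)"
        using iF[of x] i\<eta> by (simp add: left_diff_distrib)
      have "\<bar>integral\<^sup>L lborel (\<lambda>z. (f (x - z) - f x) * \<eta> z)\<bar> \<le> L * \<epsilon>"
      proof (rule bound[OF *])
        fix z :: 'a assume "norm z \<le> \<epsilon>"
        with L have "L * norm z \<le> L * \<epsilon>" by (rule mult_left_mono[rotated])
        then show "\<bar>f (x - z) - f x\<bar> \<le> L * \<epsilon>" using lip[of "x - z" x] by simp
      qed
      moreover have "integral\<^sup>L lborel (\<lambda>z. (f (x - z) - f x) * \<eta> z) = \<phi> x - f x"
        using iF[of x] i\<eta> \<eta>(4) by (simp add: left_diff_distrib \<phi>)
      ultimately show ?thesis by simp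
    qed
    show "\<phi> x = 0" if "\<And>y. y \<in> K \<Longrightarrow> \<epsilon> < norm (x - y)" for x
    proof -
      have "f (x - z) * \<eta> z = 0" for z
        using that[of "x - z"] \<eta>(3)[of z] K(2)[of "x - z"] by force
      then have "(\<lambda>z. f (x - z) * \<eta> z) = (\<lambda>z. 0)" by blast
      then show ?thesis unfolding \<phi> by simp
    qed
  qed
qed

section \<open>Weak gradients of Lipschitz functions\<close>

text \<open>The sum of the norms of the increments has finite integral, hence is finite almost
  everywhere; at such points the telescoping series converges absolutely.\<close>

lemma AE_convergent_of_summable_integral:
  fixes v :: "nat \<Rightarrow> 'a \<Rightarrow> 'b::euclidean_space"
  assumes v: "\<And>n. v n \<in> borel_measurable M"
    and b: "\<And>n. integrable M (\<lambda>x. norm (v (Suc n) x - v n x))"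
      "\<And>n. integral\<^sup>L M (\<lambda>x. norm (v (Suc n) x - v n x)) \<le> c n" "summable c"
  shows "AE x in M. convergent (\<lambda>n. v n x)"
proof -
  let ?w = "\<lambda>n x. norm (v (Suc n) x - v n x)"
  have [measurable]: "?w n \<in> borel_measurable M" for n
    using b(1) by auto
  have c: "0 \<le> c n" for n
    by (rule order_trans[OF _ b(2)]) simp
  have "(\<integral>\<^sup>+x. (\<Sum>n. ennreal (?w n x)) \<partial>M) = (\<Sum>n. \<integral>\<^sup>+x. ennreal (?w n x) \<partial>M)"
    by (intro nn_integral_suminf) measurable
  also have "\<dots> = (\<Sum>n. ennreal (integral\<^sup>L M (?w n)))"
    using b(1) by (simp add: nn_integral_eq_integral)
  also have "\<dots> \<le> (\<Sum>n. ennreal (c n))"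
    using b(2) by (intro suminf_le ennreal_leI) auto
  also have "\<dots> = ennreal (\<Sum>n. c n)"
    by (rule suminf_ennreal2[OF c b(3)])
  finally have "(\<integral>\<^sup>+x. (\<Sum>n. ennreal (?w n x)) \<partial>M) \<noteq> \<infinity>"
    by (auto simp: top_unique)
  then have "AE x in M. (\<Sum>n. ennreal (?w n x)) \<noteq> \<infinity>"
    by (intro nn_integral_PInf_AE) measurable
  then show ?thesis
  proof eventually_elim
    case (elim x)
    have "summable (\<lambda>n. ?w n x)"
      by (rule summable_suminf_not_top) (use elim in auto)
    then have "summable (\<lambda>n. v (Suc n) x - v n x)"
      by (rule summable_norm_cancel)
    then have "convergent (\<lambda>n. \<Sum>i<n. v (Suc i) x - v i x)"
      by (simp add: summable_iff_convergent)
    then have "convergent (\<lambda>n. v n x - v 0 x)"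
      by (simp only: sum_lessThan_telescope[of "\<lambda>n. v n x"])
    from convergent_add[OF this convergent_const[of "v 0 x"]] show ?case by simp
  qed
qed

lemma locally_integrable_bounded:
  fixes g :: "'a::euclidean_space \<Rightarrow> 'b::euclidean_space"
  assumes "\<Omega> \<in> sets lebesgue" "g \<in> borel_measurable (lebesgue_on \<Omega>)" "AE x in lebesgue_on \<Omega>. norm (g x) \<le> L"
  shows "locally_integrable \<Omega> g"
  unfolding locally_integrable_def
proof (intro allI impI)
  fix K assume K: "compact K \<and> K \<subseteq> \<Omega>"
  have sK: "K \<in> sets lebesgue" using K compact_sets_lebesgue by blast
  have m: "(\<lambda>x. indicator \<Omega> x *\<^sub>R g x) \<in> borel_measurable lebesgue"
    using assms(1,2) by (subst (asm) borel_measurable_restrict_space_iff) auto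
  have eq: "indicator K x *\<^sub>R g x = indicator K x *\<^sub>R (indicator \<Omega> x *\<^sub>R g x)" for x
    using K by (auto simp: indicator_def)
  have "integrable lebesgue (\<lambda>x. indicator K x *\<^sub>R g x)"
  proof (rule Bochner_Integration.integrable_bound[of _ "\<lambda>x. indicator K x *\<^sub>R L"])
    have "emeasure lebesgue K < \<infinity>"
      using K emeasure_compact_finite[of K] sK by (simp add: borel_compact)
    then show "integrable lebesgue (\<lambda>x. indicator K x *\<^sub>R L)"
      using sK by simp
    show "(\<lambda>x. indicator K x *\<^sub>R g x) \<in> borel_measurable lebesgue"
      unfolding eq using sK by (intro borel_measurable_scaleR[OF _ m]) auto
    have "AE x in lebesgue. x \<in> \<Omega> \<longrightarrow> norm (g x) \<le> L"
      using assms by (subst (asm) AE_restrict_space_iff) auto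
    then show "AE x in lebesgue. norm (indicator K x *\<^sub>R g x) \<le> norm (indicator K x *\<^sub>R L)"
      by eventually_elim (use K in \<open>auto simp: indicator_def\<close>)
  qed
  then show "integrable (lebesgue_on K) g"
    by (subst integrable_lebesgue_on_iff[OF sK])
qed

text \<open>
  Among the smooth \<open>L\<close>-Lipschitz functions close to \<open>f\<close>, near-minimizers of the Dirichlet energy
  have, by the parallelogram identity, gradients that converge in \<open>L\<^sup>2\<close> and hence almost everywhere.
\<close>

lemma lipschitz_has_weak_gradient:
  fixes f :: "'a::euclidean_space \<Rightarrow> real"
  assumes lip: "\<And>x y. \<bar>f x - f y\<bar> \<le> L * norm (x - y)"
    and K: "compact K" "\<And>x. x \<notin> K \<Longrightarrow> f x = 0"
  obtains g where "has_weak_gradient UNIV f g" "g \<in> borel_measurable lebesgue" "AE x in lebesgue. norm (g x) \<le> L"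
proof -
  have L: "0 \<le> L" by (rule lipschitz_const_nonneg[OF lip])
  obtain r where r: "\<And>x. x \<in> K \<Longrightarrow> norm x \<le> r"
    using compact_imp_bounded[OF K(1)] by (auto simp: bounded_iff)
  \<comment> \<open>Enlarging the support by 1 leaves room for mollification at radius
    \<open>min e 1\<close>.\<close>
  define K1 where "K1 = cball (0::'a) (r + 1)"
  have K1: "compact K1" by (simp add: K1_def)
  have mK1: "emeasure lborel K1 < \<infinity>" by (rule emeasure_compact_finite[OF K1])
  have iK1: "integrable lborel (indicator K1 :: 'a \<Rightarrow> real)"
    using mK1 K1 by (simp add: borel_compact)
  \<comment> \<open>This class is convex, which admits the midpoint \<open>\<mu>\<close> below, and
    it shrinks as \<open>e\<close> decreases.\<close>
  define A where "A e = {\<psi>. smooth \<psi> \<and> (\<forall>x y. \<bar>\<psi> x - \<psi> y\<bar> \<le> L * norm (x - y)) \<and>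
    (\<forall>x. x \<notin> K1 \<longrightarrow> \<psi> x = 0) \<and> (\<forall>x. \<bar>\<psi> x - f x\<bar> \<le> L * e)}" for e
  have ne: "A e \<noteq> {}" if "0 < e" for e
  proof -
    have "0 < min e 1" using that by simp
    then obtain \<phi> where \<phi>: "smooth \<phi>" "\<And>x y. \<bar>\<phi> x - \<phi> y\<bar> \<le> L * norm (x - y)"
      "\<And>x. \<bar>\<phi> x - f x\<bar> \<le> L * min e 1"
      "\<And>x. (\<And>y. y \<in> K \<Longrightarrow> min e 1 < norm (x - y)) \<Longrightarrow> \<phi> x = 0"
      using lipschitz_mollify[OF lip K] by metis
    have "\<phi> x = 0" if "x \<notin> K1" for x
    proof (rule \<phi>(4))
      fix y assume "y \<in> K"
      then show "min e 1 < norm (x - y)"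
        using that r[of y] norm_triangle_ineq2[of x y] by (auto simp: K1_def)
    qed
    moreover have "\<bar>\<phi> x - f x\<bar> \<le> L * e" for x
      using \<phi>(3)[of x] mult_left_mono[OF min.cobounded1[of e 1] L] by linarith
    ultimately have "\<phi> \<in> A e" using \<phi>(1,2) by (auto simp: A_def)
    then show ?thesis by blast
  qed
  have Amono: "A e \<subseteq> A e'" if "e \<le> e'" for e e'
  proof -
    have "L * e \<le> L * e'" using that L by (rule mult_left_mono)
    then show ?thesis unfolding A_def by (auto intro: order_trans)
  qed
  have Agrad: "norm (gradient \<psi> x) \<le> L" "x \<notin> K1 \<Longrightarrow> gradient \<psi> x = 0" "continuous_on UNIV (gradient \<psi>)"
    if \<psi>: "\<psi> \<in> A e" for \<psi> e x
  proof -
    show "norm (gradient \<psi> x) \<le> L"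
      by (rule lipschitz_norm_gradient_le) (use \<psi> in \<open>auto simp: A_def\<close>)
    show "continuous_on UNIV (gradient \<psi>)"
      by (rule smooth_gradient_continuous) (use \<psi> in \<open>auto simp: A_def\<close>)
    have "closure {x. \<psi> x \<noteq> 0} \<subseteq> K1"
      using \<psi> by (intro closure_minimal) (auto simp: A_def K1_def)
    then show "gradient \<psi> x = 0" if "x \<notin> K1"
      using that by (intro gradient_eq_0_outside) auto
  qed
  define E where "E \<psi> = integral\<^sup>L lborel (\<lambda>x. (norm (gradient \<psi> x))\<^sup>2)" for \<psi> :: "'a \<Rightarrow> real"
  have iE: "integrable lborel (\<lambda>x. (norm (gradient \<psi> x))\<^sup>2)" if "\<psi> \<in> A e" for \<psi> e
    by (rule integrable_compact_support(1)[OF _ K1])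
       (use Agrad[OF that] in \<open>auto intro!: continuous_intros\<close>)
  define Bd where "Bd = L\<^sup>2 * measure lborel K1"
  have E: "0 \<le> E \<psi>" "\<psi> \<in> A e \<Longrightarrow> E \<psi> \<le> Bd" for \<psi> e
  proof -
    show "0 \<le> E \<psi>" by (simp add: E_def)
    assume \<psi>: "\<psi> \<in> A e"
    have "E \<psi> \<le> integral\<^sup>L lborel (\<lambda>x. indicator K1 x * L\<^sup>2)"
      unfolding E_def
    proof (rule integral_mono[OF iE[OF \<psi>]])
      show "integrable lborel (\<lambda>x. indicator K1 x * L\<^sup>2)" using iK1 by simp
      show "(norm (gradient \<psi> x))\<^sup>2 \<le> indicator K1 x * L\<^sup>2" for x
        using Agrad(1,2)[OF \<psi>, of x] by (cases "x \<in> K1") (auto intro: power_mono)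
    qed
    then show "E \<psi> \<le> Bd" by (simp add: Bd_def mult.commute)
  qed
  define d where "d e = Inf (E ` A e)" for e
  have bb: "bdd_below (E ` S)" for S
    using E(1) by (intro bdd_belowI[of _ 0]) auto
  have dle: "d e \<le> E \<psi>" if "\<psi> \<in> A e" for \<psi> e
    unfolding d_def by (rule cInf_lower[OF _ bb]) (use that in auto)
  have dB: "d e \<le> Bd" if "0 < e" for e
    using ne[OF that] dle E(2) by (meson ex_in_conv order_trans)
  have danti: "d e' \<le> d e" if "0 < e" "e \<le> e'" for e e'
    unfolding d_def by (rule cInf_superset_mono) (use ne[OF that(1)] bb Amono[OF that(2)] in auto)
  \<comment> \<open>The infimum \<open>d e\<close> grows as \<open>e\<close> decreases and stays
    below \<open>Bd\<close>, so \<open>D\<close> is its limit for \<open>e\<close> tending to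
    0.\<close>
  define D where "D = Sup (d ` {0<..})"
  have bda: "bdd_above (d ` {0<..})"
    using dB by (auto intro!: bdd_aboveI)
  have dD: "d e \<le> D" if "0 < e" for e
    unfolding D_def by (rule cSup_upper[OF _ bda]) (use that in auto)
  \<comment> \<open>The mean square increments will be bounded by multiples of these numbers; it is
    their square roots, the powers of 1/2, that have to be summable.\<close>
  define \<delta> :: "nat \<Rightarrow> real" where "\<delta> n = (1/4) ^ n" for n
  have \<delta>: "0 < \<delta> n" "\<delta> (Suc n) \<le> \<delta> n" for n by (auto simp: \<delta>_def)
  have "\<exists>\<psi> e. 0 < e \<and> e \<le> inverse (real (Suc n)) \<and> \<psi> \<in> A e \<and> D - \<delta> n \<le> d e \<and> E \<psi> \<le> D + \<delta> n" for n
  proof -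
    have "D - \<delta> n < Sup (d ` {0<..})" using \<delta>(1)[of n] by (simp add: D_def)
    then obtain e0 where e0: "0 < e0" "D - \<delta> n < d e0"
      using less_cSup_iff[OF _ bda] by force
    define e where "e = min e0 (inverse (real (Suc n)))"
    have e: "0 < e" "e \<le> e0" "e \<le> inverse (real (Suc n))" using e0 by (auto simp: e_def)
    have "Inf (E ` A e) < d e + \<delta> n" using \<delta>(1)[of n] by (simp add: d_def)
    then obtain \<psi> where "\<psi> \<in> A e" "E \<psi> < d e + \<delta> n"
      using cInf_lessD[of "E ` A e"] ne[OF e(1)] by blast
    then show ?thesis
      using e e0 danti[OF e(1,2)] dD[OF e(1)] by (intro exI[of _ \<psi>] exI[of _ e]) auto
  qed
  then obtain \<psi> e where \<psi>: "\<And>n. 0 < e n" "\<And>n. e n \<le> inverse (real (Suc n))" "\<And>n. \<psi> n \<in> A (e n)"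
    "\<And>n. D - \<delta> n \<le> d (e n)" "\<And>n. E (\<psi> n) \<le> D + \<delta> n"
    by metis
  define v where "v n = gradient (\<psi> n)" for n
  have sm: "smooth (\<psi> n)" for n using \<psi>(3)[of n] by (simp add: A_def)
  have cv: "continuous_on UNIV (v n)" for n
    unfolding v_def by (rule Agrad(3)[OF \<psi>(3)])
  have v0: "v n x = 0" if "x \<notin> K1" for n x
    unfolding v_def by (rule Agrad(2)[OF \<psi>(3) that])
  have vL: "norm (v n x) \<le> L" for n x
    unfolding v_def by (rule Agrad(1)[OF \<psi>(3)])
  \<comment> \<open>In the parallelogram identity the two energies are at most
    \<open>D + \<delta> n\<close> and the midpoint has energy at least
    \<open>D - \<delta> n\<close>, which leaves \<open>2 + 2 + 4\<close> times
    \<open>\<delta> n\<close>.\<close>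
  have step: "integral\<^sup>L lborel (\<lambda>x. (norm (v (Suc n) x - v n x))\<^sup>2) \<le> 8 * \<delta> n" for n
  proof -
    define \<mu> where "\<mu> x = 1/2 * (\<psi> n x + \<psi> (Suc n) x)" for x
    let ?e = "max (e n) (e (Suc n))"
    have in_e: "\<psi> n \<in> A ?e" "\<psi> (Suc n) \<in> A ?e"
      using \<psi>(3) Amono by (meson max.cobounded1 max.cobounded2 subsetD)+
    have g\<mu>: "gradient \<mu> x = (1/2) *\<^sub>R (v n x + v (Suc n) x)" for x
      unfolding \<mu>_def v_def by (subst gradient_cmult) (auto simp: gradient_add sm intro: smooth_add)
    have \<mu>: "\<mu> \<in> A ?e"
      unfolding A_def
    proof (intro CollectI conjI allI impI)
      show "smooth \<mu>" unfolding \<mu>_def by (intro smooth_mult smooth_const smooth_add sm)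
      show "\<bar>\<mu> x - \<mu> y\<bar> \<le> L * norm (x - y)" for x y
      proof -
        have "\<bar>\<psi> n x - \<psi> n y\<bar> \<le> L * norm (x - y)" "\<bar>\<psi> (Suc n) x - \<psi> (Suc n) y\<bar> \<le> L * norm (x - y)"
          using \<psi>(3) by (auto simp: A_def)
        moreover have "\<bar>1/2 * (a + b) - 1/2 * (c + d)\<bar> \<le> M" if "\<bar>a - c\<bar> \<le> M" "\<bar>b - d\<bar> \<le> M" for a b c d M :: real
          using that unfolding abs_le_iff by (simp add: field_simps)
        ultimately show ?thesis unfolding \<mu>_def by blast
      qed
      show "\<mu> x = 0" if "x \<notin> K1" for x
        using \<psi>(3) that by (auto simp: A_def \<mu>_def)
      show "\<bar>\<mu> x - f x\<bar> \<le> L * ?e" for x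
      proof -
        have "\<bar>\<psi> n x - f x\<bar> \<le> L * ?e" "\<bar>\<psi> (Suc n) x - f x\<bar> \<le> L * ?e"
          using in_e unfolding A_def by blast+
        moreover have "\<bar>1/2 * (a + b) - c\<bar> \<le> M" if "\<bar>a - c\<bar> \<le> M" "\<bar>b - c\<bar> \<le> M" for a b c M :: real
          using that unfolding abs_le_iff by (simp add: field_simps)
        ultimately show ?thesis unfolding \<mu>_def by blast
      qed
    qed
    have "(norm (v (Suc n) x - v n x))\<^sup>2 = 2 * (norm (gradient (\<psi> n) x))\<^sup>2 + 2 * (norm (gradient (\<psi> (Suc n)) x))\<^sup>2
        - 4 * (norm (gradient \<mu> x))\<^sup>2" for x
      unfolding g\<mu> by (simp add: v_def power2_norm_eq_inner inner_diff inner_add inner_commute algebra_simps)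
    then have "integral\<^sup>L lborel (\<lambda>x. (norm (v (Suc n) x - v n x))\<^sup>2) = 2 * E (\<psi> n) + 2 * E (\<psi> (Suc n)) - 4 * E \<mu>"
      using iE[OF \<psi>(3)[of n]] iE[OF \<psi>(3)[of "Suc n"]] iE[OF \<mu>] by (simp add: E_def)
    moreover have "D - \<delta> n \<le> d ?e"
      using \<psi>(4)[of n] \<psi>(4)[of "Suc n"] \<delta>(2)[of n] by (cases "e n \<le> e (Suc n)") (auto simp: max_def)
    ultimately show ?thesis
      using dle[OF \<mu>] \<psi>(5)[of n] \<psi>(5)[of "Suc n"] \<delta>(2)[of n] by linarith
  qed
  have int_w: "integrable lborel (\<lambda>x. norm (v (Suc n) x - v n x))" for n
    by (rule integrable_compact_support(1)[OF _ K1]) (auto intro!: continuous_intros cv simp: v0)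
  have int_w2: "integrable lborel (\<lambda>x. (norm (v (Suc n) x - v n x))\<^sup>2)" for n
    by (rule integrable_compact_support(1)[OF _ K1]) (auto intro!: continuous_intros cv simp: v0)
  \<comment> \<open>A number \<open>w\<close> satisfies \<open>w \<le> s + w\<^sup>2 / s\<close>.
    With \<open>s = (1/2) ^ n\<close> the first term is integrated over \<open>K1\<close> only, and
    the second contributes \<open>8 * \<delta> n / s = 8 * s\<close>.\<close>
  have bound_w: "integral\<^sup>L lborel (\<lambda>x. norm (v (Suc n) x - v n x)) \<le> (1/2) ^ n * (measure lborel K1 + 8)" for n
  proof -
    define s :: real where "s = (1/2) ^ n"
    have s: "0 < s" "\<delta> n = s * s" by (auto simp: s_def \<delta>_def simp flip: power_mult_distrib)
    have "integral\<^sup>L lborel (\<lambda>x. norm (v (Suc n) x - v n x)) \<le>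
      integral\<^sup>L lborel (\<lambda>x. s * indicator K1 x + inverse s * (norm (v (Suc n) x - v n x))\<^sup>2)"
    proof (rule integral_mono[OF int_w])
      show "integrable lborel (\<lambda>x. s * indicator K1 x + inverse s * (norm (v (Suc n) x - v n x))\<^sup>2)"
        using iK1 int_w2 by simp
      show "norm (v (Suc n) x - v n x) \<le> s * indicator K1 x + inverse s * (norm (v (Suc n) x - v n x))\<^sup>2" for x
      proof (cases "x \<in> K1")
        case True
        let ?w = "norm (v (Suc n) x - v n x)"
        have "?w \<le> s + inverse s * ?w\<^sup>2"
        proof (cases "?w \<le> s")
          case True
          then show ?thesis using s by (simp add: add_increasing2)
        next
          case False
          then have "?w * s \<le> ?w * ?w" by (intro mult_left_mono) auto
          then have "?w \<le> inverse s * ?w\<^sup>2" using s by (simp add: field_simps power2_eq_square)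
          then show ?thesis using s by linarith
        qed
        with True show ?thesis by simp
      qed (use v0 in auto)
    qed
    also have "\<dots> = s * measure lborel K1 + inverse s * integral\<^sup>L lborel (\<lambda>x. (norm (v (Suc n) x - v n x))\<^sup>2)"
      using iK1 int_w2[of n] by simp
    also have "\<dots> \<le> s * measure lborel K1 + inverse s * (8 * \<delta> n)"
      using s step[of n] by (intro add_left_mono mult_left_mono) auto
    also have "\<dots> = s * (measure lborel K1 + 8)"
      using s by (simp add: field_simps)
    finally show ?thesis by (simp add: s_def)
  qed
  have mv: "v n \<in> borel_measurable lborel" for n
    using borel_measurable_continuous_onI[OF cv] by simp
  define g where "g x = lim (\<lambda>n. v n x)" for x
  have "AE x in lborel. convergent (\<lambda>n. v n x)"
    by (rule AE_convergent_of_summable_integral[where v=v, OF mv int_w bound_w])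
       (intro summable_mult2 summable_geometric, simp)
  then have "AE x in lborel. (\<lambda>n. v n x) \<longlonglongrightarrow> g x"
    by eventually_elim (simp add: g_def convergent_LIMSEQ_iff)
  then have conv: "AE x in lebesgue. (\<lambda>n. v n x) \<longlonglongrightarrow> g x"
    by (rule AE_completion)
  have "g \<in> borel_measurable lborel"
    unfolding g_def by (rule borel_measurable_lim_metric[OF mv])
  then have mg: "g \<in> borel_measurable lebesgue" by (rule measurable_completion)
  have gL: "AE x in lebesgue. norm (g x) \<le> L"
    using conv by eventually_elim (auto intro: LIMSEQ_le_const2[OF tendsto_norm] vL)
  show thesis
  proof (rule that[OF _ mg gL])
    have li: "locally_integrable UNIV g"
    proof (rule locally_integrable_bounded)
      show "g \<in> borel_measurable (lebesgue_on UNIV)" using mg by (rule measurable_restrict_space1)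
      show "AE x in lebesgue_on UNIV. norm (g x) \<le> L"
        using gL by (subst AE_restrict_space_iff) simp_all
    qed simp
    show "has_weak_gradient UNIV f g"
      unfolding has_weak_gradient_iff[OF open_UNIV]
    proof (intro conjI allI impI li)
      have cf: "continuous_on UNIV f" by (rule lipschitz_imp_continuous[OF lip])
      then show "locally_integrable UNIV f" by (rule locally_integrable_continuous)
      fix \<phi> :: "'a \<Rightarrow> real" assume \<phi>: "test_function UNIV \<phi>"
      obtain M where M: "compact M" "\<And>x. x \<notin> M \<Longrightarrow> \<phi> x = 0" "\<And>x. x \<notin> M \<Longrightarrow> gradient \<phi> x = 0"
        by (rule test_function_support[OF \<phi>]) blast
      have c: "continuous_on UNIV \<phi>" "continuous_on UNIV (gradient \<phi>)"
        using test_function_continuous[OF \<phi>] by auto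
      have close: "\<bar>\<psi> n x - f x\<bar> \<le> L * inverse (real (Suc n))" for n x
      proof -
        have "\<bar>\<psi> n x - f x\<bar> \<le> L * e n" using \<psi>(3)[of n] by (auto simp: A_def)
        also have "\<dots> \<le> L * inverse (real (Suc n))" by (rule mult_left_mono[OF \<psi>(2) L])
        finally show ?thesis .
      qed
      have lim1: "(\<lambda>n. integral\<^sup>L lebesgue (\<lambda>x. \<psi> n x *\<^sub>R gradient \<phi> x)) \<longlonglongrightarrow> integral\<^sup>L lebesgue (\<lambda>x. f x *\<^sub>R gradient \<phi> x)"
      proof (rule integral_dominated_convergence[where w="\<lambda>x. (\<bar>f x\<bar> + L) * norm (gradient \<phi> x)"])
        show "(\<lambda>x. f x *\<^sub>R gradient \<phi> x) \<in> borel_measurable lebesgue"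
          by (intro borel_measurable_continuous_lebesgue continuous_intros cf c)
        show "(\<lambda>x. \<psi> n x *\<^sub>R gradient \<phi> x) \<in> borel_measurable lebesgue" for n
          by (intro borel_measurable_continuous_lebesgue continuous_intros smooth_continuous sm c)
        show "integrable lebesgue (\<lambda>x. (\<bar>f x\<bar> + L) * norm (gradient \<phi> x))"
          by (rule integrable_compact_support(2)[OF _ M(1)]) (auto intro!: continuous_intros cf c simp: M)
        show "AE x in lebesgue. (\<lambda>n. \<psi> n x *\<^sub>R gradient \<phi> x) \<longlonglongrightarrow> f x *\<^sub>R gradient \<phi> x"
        proof (intro AE_I2 tendsto_intros)
          fix x
          have "(\<lambda>n. L * inverse (real (Suc n))) \<longlonglongrightarrow> 0"
            by (rule tendsto_mult_right_zero[OF LIMSEQ_inverse_real_of_nat])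
          then have "(\<lambda>n. \<psi> n x - f x) \<longlonglongrightarrow> 0"
            by (rule Lim_null_comparison[rotated]) (unfold real_norm_def, intro always_eventually allI close)
          then show "(\<lambda>n. \<psi> n x) \<longlonglongrightarrow> f x" by (rule LIM_zero_cancel)
        qed
        show "AE x in lebesgue. norm (\<psi> n x *\<^sub>R gradient \<phi> x) \<le> (\<bar>f x\<bar> + L) * norm (gradient \<phi> x)" for n
        proof (rule AE_I2)
          fix x
          have "L * inverse (real (Suc n)) \<le> L * 1"
            by (intro mult_left_mono L) (simp add: field_simps)
          with close[of n x] have "\<bar>\<psi> n x\<bar> \<le> \<bar>f x\<bar> + L" by linarith
          then show "norm (\<psi> n x *\<^sub>R gradient \<phi> x) \<le> (\<bar>f x\<bar> + L) * norm (gradient \<phi> x)"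
            by (simp add: mult_right_mono)
        qed
      qed
      have lim2: "(\<lambda>n. integral\<^sup>L lebesgue (\<lambda>x. \<phi> x *\<^sub>R v n x)) \<longlonglongrightarrow> integral\<^sup>L lebesgue (\<lambda>x. \<phi> x *\<^sub>R g x)"
      proof (rule integral_dominated_convergence[where w="\<lambda>x. L * \<bar>\<phi> x\<bar>"])
        show "(\<lambda>x. \<phi> x *\<^sub>R g x) \<in> borel_measurable lebesgue"
          by (intro borel_measurable_scaleR mg borel_measurable_continuous_lebesgue c)
        show "(\<lambda>x. \<phi> x *\<^sub>R v n x) \<in> borel_measurable lebesgue" for n
          by (intro borel_measurable_continuous_lebesgue continuous_intros cv c)
        show "integrable lebesgue (\<lambda>x. L * \<bar>\<phi> x\<bar>)"
          by (rule integrable_compact_support(2)[OF _ M(1)]) (auto intro!: continuous_intros c simp: M)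
        show "AE x in lebesgue. (\<lambda>n. \<phi> x *\<^sub>R v n x) \<longlonglongrightarrow> \<phi> x *\<^sub>R g x"
          using conv by eventually_elim (intro tendsto_intros)
        show "AE x in lebesgue. norm (\<phi> x *\<^sub>R v n x) \<le> L * \<bar>\<phi> x\<bar>" for n
          using vL by (intro AE_I2) (simp add: mult.commute[of L] mult_left_mono)
      qed
      have eq: "integral\<^sup>L lebesgue (\<lambda>x. \<psi> n x *\<^sub>R gradient \<phi> x) = - integral\<^sup>L lebesgue (\<lambda>x. \<phi> x *\<^sub>R v n x)" for n
        using smooth_has_weak_gradient[OF open_UNIV sm, of n] \<phi>
        unfolding has_weak_gradient_iff[OF open_UNIV] v_def by blast
      show "integral\<^sup>L lebesgue (\<lambda>x. f x *\<^sub>R gradient \<phi> x) = - integral\<^sup>L lebesgue (\<lambda>x. \<phi> x *\<^sub>R g x)"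
        by (rule LIMSEQ_unique[OF lim1[unfolded eq] tendsto_minus[OF lim2]])
    qed
  qed
qed

section \<open>Restriction and congruence of weak gradients\<close>

lemma locally_integrable_mono: "locally_integrable \<Omega>' u \<Longrightarrow> \<Omega> \<subseteq> \<Omega>' \<Longrightarrow> locally_integrable \<Omega> u"
  by (auto simp: locally_integrable_def)

lemma has_weak_gradient_mono:
  assumes "has_weak_gradient \<Omega>' u g" "open \<Omega>" "open \<Omega>'" "\<Omega> \<subseteq> \<Omega>'"
  shows "has_weak_gradient \<Omega> u g"
  using assms test_function_mono[OF _ assms(4)] locally_integrable_mono[OF _ assms(4), of u]
    locally_integrable_mono[OF _ assms(4), of g]
  by (auto simp: has_weak_gradient_iff)

lemma has_weak_gradient_cong:
  assumes "\<And>x. x \<in> \<Omega> \<Longrightarrow> u x = v x"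
  shows "has_weak_gradient \<Omega> u = has_weak_gradient \<Omega> v"
proof -
  have "has_weak_gradient \<Omega> u g \<Longrightarrow> has_weak_gradient \<Omega> v g"
    if "\<And>x. x \<in> \<Omega> \<Longrightarrow> u x = v x" for u v g
  proof -
    have "integrable (lebesgue_on K) u \<longleftrightarrow> integrable (lebesgue_on K) v" if "K \<subseteq> \<Omega>" for K
      using that \<open>\<And>x. x \<in> \<Omega> \<Longrightarrow> u x = v x\<close>
      by (intro Bochner_Integration.integrable_cong) (auto simp: space_restrict_space)
    moreover have "integral\<^sup>L (lebesgue_on \<Omega>) (\<lambda>x. u x * h x) = integral\<^sup>L (lebesgue_on \<Omega>) (\<lambda>x. v x * h x)" for h
      using that by (intro Bochner_Integration.integral_cong) (auto simp: space_restrict_space)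
    ultimately show "has_weak_gradient \<Omega> u g \<Longrightarrow> has_weak_gradient \<Omega> v g"
      by (auto simp: has_weak_gradient_def locally_integrable_def)
  qed
  from this[of u v] this[of v u] assms show ?thesis by (intro ext) metis
qed

section \<open>Norms of Lebesgue spaces\<close>

lemma convex_combination_powr:
  assumes "0 \<le> a" "0 \<le> b" "0 < \<theta>" "\<theta> < 1" "1 \<le> (p::real)"
  shows "(\<theta> * a + (1 - \<theta>) * b) powr p \<le> \<theta> * a powr p + (1 - \<theta>) * b powr p"
proof -
  \<comment> \<open>When one of the two points is 0, the claim reduces to this inequality for the
    weight of the other.\<close>
  have small: "t powr p \<le> t" if "0 < t" "t < 1" for t :: real
    using powr_mono'[of 1 p t] that assms(5) by simp
  consider "a = 0" | "b = 0" | "0 < a" "0 < b" using assms by linarith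
  then show ?thesis
  proof cases
    case 1
    then show ?thesis
      using assms small[of "1 - \<theta>"] by (simp add: powr_mult mult_right_mono)
  next
    case 2
    then show ?thesis
      using assms small[of \<theta>] by (simp add: powr_mult mult_right_mono)
  next
    case 3
    then show ?thesis
      using convex_onD[OF powr_convex[OF assms(5)], of "1 - \<theta>" a b] assms by (simp add: algebra_simps)
  qed
qed

text \<open>Convexity of the exponential between \<open>ln t\<close> and 0. This form of Young's
  inequality is the pointwise content of Hoelder's inequality between two exponents.\<close>

lemma powr_le_linear:
  assumes "0 \<le> t" "0 < \<theta>" "\<theta> \<le> (1::real)"
  shows "t powr \<theta> \<le> \<theta> * t + (1 - \<theta>)"
proof (cases "t = 0")
  case False
  then have "exp (\<theta> * ln t + (1 - \<theta>) * 0) \<le> \<theta> * exp (ln t) + (1 - \<theta>) * exp 0"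
    using convex_onD[OF exp_convex, of "1 - \<theta>" "ln t" 0] assms by (simp add: algebra_simps)
  with False assms show ?thesis by (simp add: powr_def mult.commute)
qed (use assms in auto)

lemma Lnorm_nonneg: "0 \<le> Lnorm \<Omega> s f"
  by (simp add: Lnorm_def)

lemma Lnorm_powr:
  assumes "0 < s"
  shows "Lnorm \<Omega> s f powr s = integral\<^sup>L (lebesgue_on \<Omega>) (\<lambda>x. norm (f x) powr s)"
  using assms by (simp add: Lnorm_def powr_powr)

lemma Lnorm_le_iff:
  assumes "0 < s" "0 \<le> C"
  shows "Lnorm \<Omega> s f \<le> C \<longleftrightarrow> integral\<^sup>L (lebesgue_on \<Omega>) (\<lambda>x. norm (f x) powr s) \<le> C powr s"
  by (metis Lnorm_nonneg Lnorm_powr assms powr_less_mono2 powr_mono2 less_imp_le not_le)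

lemma Lnorm_cong_AE:
  assumes "f \<in> borel_measurable (lebesgue_on \<Omega>)" "g \<in> borel_measurable (lebesgue_on \<Omega>)"
    "AE x in lebesgue_on \<Omega>. f x = g x"
  shows "Lnorm \<Omega> s f = Lnorm \<Omega> s g"
proof -
  have "integral\<^sup>L (lebesgue_on \<Omega>) (\<lambda>x. norm (f x) powr s) = integral\<^sup>L (lebesgue_on \<Omega>) (\<lambda>x. norm (g x) powr s)"
    using assms by (intro integral_cong_AE) (auto elim!: eventually_mono intro!: powr_real_measurable borel_measurable_norm)
  then show ?thesis by (simp add: Lnorm_def)
qed

lemma Lspace_cong_AE:
  assumes "f \<in> Lspace \<Omega> s" "g \<in> borel_measurable (lebesgue_on \<Omega>)" "AE x in lebesgue_on \<Omega>. f x = g x"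
  shows "g \<in> Lspace \<Omega> s"
proof -
  have "integrable (lebesgue_on \<Omega>) (\<lambda>x. norm (f x) powr s) \<longleftrightarrow> integrable (lebesgue_on \<Omega>) (\<lambda>x. norm (g x) powr s)"
    using assms by (intro integrable_cong_AE)
      (auto simp: Lspace_def elim!: eventually_mono intro!: powr_real_measurable borel_measurable_norm)
  with assms show ?thesis by (auto simp: Lspace_def)
qed

lemma Lnorm_scaleR: "Lnorm \<Omega> s (\<lambda>x. t *\<^sub>R f x) = \<bar>t\<bar> * Lnorm \<Omega> s f" if "0 < s"
  using that by (simp add: Lnorm_def powr_mult powr_powr)

lemma Lspace_scaleR: "f \<in> Lspace \<Omega> s \<Longrightarrow> (\<lambda>x. t *\<^sub>R f x) \<in> Lspace \<Omega> s"
  by (auto simp: Lspace_def powr_mult intro!: borel_measurable_scaleR)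

text \<open>Convexity of the power function for the weights \<open>a / (a + b)\<close> and
  \<open>b / (a + b)\<close>. With \<open>a\<close> and \<open>b\<close> close to the norms of two
  functions, integration yields Minkowski's inequality.\<close>

lemma norm_add_powr_le:
  fixes u v :: "'b::euclidean_space"
  assumes "0 < a" "0 < b" "1 \<le> s"
  shows "norm (u + v) powr s \<le> (a + b) powr (s - 1) * (a powr (1 - s) * norm u powr s + b powr (1 - s) * norm v powr s)"
proof -
  define \<theta> where "\<theta> = a / (a + b)"
  have \<theta>: "0 < \<theta>" "\<theta> < 1" "1 - \<theta> = b / (a + b)" using assms by (auto simp: \<theta>_def field_simps)
  let ?U = "(a + b) / a * norm u" and ?V = "(a + b) / b * norm v"
  have "norm (u + v) powr s \<le> (norm u + norm v) powr s"
    using assms by (intro powr_mono2 norm_triangle_ineq) auto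
  also have "norm u + norm v = \<theta> * ?U + (1 - \<theta>) * ?V"
    using assms unfolding \<theta>(3) by (simp add: \<theta>_def)
  also have "\<dots> powr s \<le> \<theta> * ?U powr s + (1 - \<theta>) * ?V powr s"
    using assms \<theta> by (intro convex_combination_powr) auto
  also have "\<dots> = (a + b) powr (s - 1) * (a powr (1 - s) * norm u powr s + b powr (1 - s) * norm v powr s)"
  proof -
    have *: "c / k * (k / c * n) powr s = k powr (s - 1) * (c powr (1 - s) * n powr s)"
      if "0 < c" "0 \<le> n" "0 < k" for c n k
      using that by (simp add: powr_mult powr_divide powr_diff field_simps)
    show ?thesis
      unfolding \<theta>(3) using *[of a "norm u" "a + b"] *[of b "norm v" "a + b"] assms
      by (simp add: \<theta>_def distrib_left)
  qed
  finally show ?thesis .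
qed

lemma
  fixes f g :: "'a::euclidean_space \<Rightarrow> 'b::euclidean_space"
  assumes s: "1 \<le> s" and f: "f \<in> Lspace \<Omega> s" and g: "g \<in> Lspace \<Omega> s"
  shows Lspace_add: "(\<lambda>x. f x + g x) \<in> Lspace \<Omega> s"
    and Lnorm_triangle: "Lnorm \<Omega> s (\<lambda>x. f x + g x) \<le> Lnorm \<Omega> s f + Lnorm \<Omega> s g"
proof -
  let ?M = "lebesgue_on \<Omega>"
  have m: "f \<in> borel_measurable ?M" "g \<in> borel_measurable ?M"
    and i: "integrable ?M (\<lambda>x. norm (f x) powr s)" "integrable ?M (\<lambda>x. norm (g x) powr s)"
    using f g by (auto simp: Lspace_def)
  have m': "(\<lambda>x. f x + g x) \<in> borel_measurable ?M" using m by (rule borel_measurable_add)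
  let ?B = "\<lambda>a b x. (a + b) powr (s - 1) * (a powr (1 - s) * norm (f x) powr s + b powr (1 - s) * norm (g x) powr s)"
  have iB: "integrable ?M (?B a b)" for a b
    using i by (intro integrable_mult_right Bochner_Integration.integrable_add) auto
  have int: "integrable ?M (\<lambda>x. norm (f x + g x) powr s)"
  proof (rule Bochner_Integration.integrable_bound[OF iB[of 1 1]])
    show "(\<lambda>x. norm (f x + g x) powr s) \<in> borel_measurable ?M"
      using m' by (intro powr_real_measurable borel_measurable_norm) auto
    show "AE x in ?M. norm (norm (f x + g x) powr s) \<le> norm (?B 1 1 x)"
      using norm_add_powr_le[of 1 1 s] s by (intro AE_I2) (auto intro: order_trans[OF _ abs_ge_self])
  qed
  with m' show "(\<lambda>x. f x + g x) \<in> Lspace \<Omega> s" by (simp add: Lspace_def)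
  let ?A = "Lnorm \<Omega> s f" and ?G = "Lnorm \<Omega> s g"
  show "Lnorm \<Omega> s (\<lambda>x. f x + g x) \<le> ?A + ?G"
  proof (rule field_le_epsilon)
    fix e :: real assume e: "0 < e"
    \<comment> \<open>The weights must be positive even if a norm vanishes, hence the slack
      \<open>e/2\<close>.\<close>
    define a b where "a = ?A + e/2" and "b = ?G + e/2"
    have ab: "0 < a" "0 < b" "?A \<le> a" "?G \<le> b"
      using e Lnorm_nonneg[of \<Omega> s f] Lnorm_nonneg[of \<Omega> s g] by (auto simp: a_def b_def)
    have "integral\<^sup>L ?M (\<lambda>x. norm (f x + g x) powr s) \<le> integral\<^sup>L ?M (?B a b)"
      by (rule integral_mono[OF int iB]) (rule norm_add_powr_le[OF ab(1,2) s])
    also have "\<dots> = (a + b) powr (s - 1) * (a powr (1 - s) * ?A powr s + b powr (1 - s) * ?G powr s)"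
      using i s by (simp add: Lnorm_powr)
    also have "\<dots> \<le> (a + b) powr (s - 1) * (a powr (1 - s) * a powr s + b powr (1 - s) * b powr s)"
      using ab s by (intro mult_left_mono add_mono powr_mono2) (auto simp: Lnorm_nonneg)
    also have "\<dots> = (a + b) powr s"
      using ab by (simp add: powr_diff powr_add[symmetric] field_simps)
    finally have "Lnorm \<Omega> s (\<lambda>x. f x + g x) \<le> a + b"
      using ab s by (subst Lnorm_le_iff) auto
    then show "Lnorm \<Omega> s (\<lambda>x. f x + g x) \<le> ?A + ?G + e"
      by (simp add: a_def b_def)
  qed
qed

text \<open>Integrating Young's inequality at a free scale \<open>k\<close> and choosing
  \<open>k\<close> afterwards gives Hoelder's inequality on a set of finite measure.\<close>

lemma
  fixes g :: "'a::euclidean_space \<Rightarrow> 'b::euclidean_space"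
  assumes \<Omega>: "\<Omega> \<in> lmeasurable" "0 < measure lebesgue \<Omega>" and ms: "0 < m" "m \<le> s" and g: "g \<in> Lspace \<Omega> s"
  shows Lspace_mono_exponent: "g \<in> Lspace \<Omega> m"
    and Lnorm_mono_exponent: "Lnorm \<Omega> m g \<le> measure lebesgue \<Omega> powr (1 / m - 1 / s) * Lnorm \<Omega> s g"
proof -
  let ?M = "lebesgue_on \<Omega>" and ?V = "measure lebesgue \<Omega>"
  have mg: "g \<in> borel_measurable ?M" and ig: "integrable ?M (\<lambda>x. norm (g x) powr s)"
    using g by (auto simp: Lspace_def)
  have fin: "emeasure ?M (space ?M) < \<infinity>"
    using \<Omega> by (auto simp: space_restrict_space emeasure_restrict_space fmeasurable_def)
  have V: "measure ?M (space ?M) = ?V"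
    using \<Omega> by (auto simp: space_restrict_space measure_restrict_space fmeasurable_def)
  define \<theta> where "\<theta> = m / s"
  have \<theta>: "0 < \<theta>" "\<theta> \<le> 1" "\<theta> * s = m" using ms by (auto simp: \<theta>_def)
  have pt: "norm (g x) powr m \<le> \<theta> * k powr (m - s) * norm (g x) powr s + (1 - \<theta>) * k powr m"
    if k: "0 < k" for k x
  proof -
    have "((norm (g x) / k) powr s) powr \<theta> \<le> \<theta> * (norm (g x) / k) powr s + (1 - \<theta>)"
      using \<theta> by (intro powr_le_linear) auto
    then have "norm (g x) powr m / k powr m \<le> \<theta> * (norm (g x) powr s / k powr s) + (1 - \<theta>)"
      using \<theta> k by (simp add: powr_powr mult.commute powr_divide)
    then have "norm (g x) powr m \<le> (\<theta> * (norm (g x) powr s / k powr s) + (1 - \<theta>)) * k powr m"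
      using k by (simp add: divide_le_eq)
    also have "\<dots> = \<theta> * k powr (m - s) * norm (g x) powr s + (1 - \<theta>) * k powr m"
      using k by (simp add: powr_diff field_simps)
    finally show ?thesis .
  qed
  have ib: "integrable ?M (\<lambda>x. \<theta> * k powr (m - s) * norm (g x) powr s + (1 - \<theta>) * k powr m)" for k
    using ig fin by (intro Bochner_Integration.integrable_add integrable_mult_right) (auto intro!: finite_measure.integrable_const finite_measureI)
  have im: "integrable ?M (\<lambda>x. norm (g x) powr m)"
  proof (rule Bochner_Integration.integrable_bound[OF ib[of 1]])
    show "(\<lambda>x. norm (g x) powr m) \<in> borel_measurable ?M"
      using mg by (intro powr_real_measurable borel_measurable_norm) auto
    show "AE x in ?M. norm (norm (g x) powr m) \<le> norm (\<theta> * 1 powr (m - s) * norm (g x) powr s + (1 - \<theta>) * 1 powr m)"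
      using pt[of 1] by (intro AE_I2) (auto intro: order_trans[OF _ abs_ge_self])
  qed
  with mg show "g \<in> Lspace \<Omega> m" by (simp add: Lspace_def)
  show "Lnorm \<Omega> m g \<le> ?V powr (1 / m - 1 / s) * Lnorm \<Omega> s g"
  proof (cases "Lnorm \<Omega> s g = 0")
    case True
    have "integral\<^sup>L ?M (\<lambda>x. norm (g x) powr s) = 0"
      using Lnorm_powr[of s \<Omega> g] True ms by simp
    then have "AE x in ?M. norm (g x) powr s = 0"
      using ig by (simp add: integral_nonneg_eq_0_iff_AE)
    then have "AE x in ?M. norm (g x) powr m = 0"
      by eventually_elim simp
    then have "integral\<^sup>L ?M (\<lambda>x. norm (g x) powr m) = 0"
      by (rule integral_eq_zero_AE)
    then show ?thesis using True ms by (simp add: Lnorm_def)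
  next
    case False
    define L where "L = Lnorm \<Omega> s g"
    \<comment> \<open>This scale is the mean of order \<open>s\<close>: it satisfies
      \<open>k powr s * ?V = L powr s\<close>, so that the two terms of the bound combine to
      \<open>k powr m * ?V\<close>.\<close>
    define k where "k = ?V powr (- 1 / s) * L"
    have L: "0 < L" using False Lnorm_nonneg[of \<Omega> s g] by (simp add: L_def less_le)
    have k: "0 < k" using L \<Omega> by (simp add: k_def)
    have ks: "k powr s = L powr s / ?V"
      using \<Omega> ms L by (simp add: k_def powr_mult powr_divide powr_powr powr_minus_divide)
    have "integral\<^sup>L ?M (\<lambda>x. norm (g x) powr m) \<le>
        integral\<^sup>L ?M (\<lambda>x. \<theta> * k powr (m - s) * norm (g x) powr s + (1 - \<theta>) * k powr m)"
      by (rule integral_mono[OF im ib]) (rule pt[OF k])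
    also have "\<dots> = \<theta> * k powr (m - s) * L powr s + (1 - \<theta>) * k powr m * ?V"
      using ig fin ms V by (simp add: L_def Lnorm_powr finite_measure.integrable_const finite_measureI)
    also have "\<dots> = k powr m * ?V"
    proof -
      have "k powr (m - s) * L powr s = k powr m * ?V"
        using ks k \<Omega> L by (simp add: powr_diff field_simps)
      then show ?thesis by (simp add: mult.assoc algebra_simps)
    qed
    also have "\<dots> = (k * ?V powr (1 / m)) powr m"
      using k \<Omega> ms by (simp add: powr_mult powr_powr)
    finally have "Lnorm \<Omega> m g \<le> k * ?V powr (1 / m)"
      using k ms by (subst Lnorm_le_iff) auto
    then show ?thesis
      using \<Omega> by (simp add: k_def L_def powr_diff powr_minus_divide mult.commute)
  qed
qed

section \<open>Morrey's inequality\<close>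

lemma integral_lborel_affine:
  fixes k :: "'a::euclidean_space \<Rightarrow> real"
  assumes "continuous_on UNIV k" "0 < t"
  shows "integral\<^sup>L lborel (\<lambda>z. k (c + t *\<^sub>R z)) = integral\<^sup>L lborel k / t ^ DIM('a)"
proof -
  have m: "k \<in> borel_measurable borel"
    using borel_measurable_continuous_onI[OF assms(1)] .
  have "integral\<^sup>L lborel k = integral\<^sup>L (density (distr lborel borel (\<lambda>x. c + t *\<^sub>R x)) (\<lambda>_. ennreal (t ^ DIM('a)))) k"
    using lborel_affine[of t c] assms(2) by (simp add: ennreal_power)
  also have "\<dots> = integral\<^sup>L (distr lborel borel (\<lambda>x. c + t *\<^sub>R x)) (\<lambda>x. t ^ DIM('a) *\<^sub>R k x)"
    using assms(2) m by (intro integral_density) auto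
  also have "\<dots> = integral\<^sup>L lborel (\<lambda>z. t ^ DIM('a) *\<^sub>R k (c + t *\<^sub>R z))"
    using m by (intro integral_distr) auto
  finally show ?thesis using assms(2) by simp
qed

text \<open>Hoelder's inequality on the cube, after which the domain of integration is enlarged,
  because the integral over the whole space is the one that scales exactly under dilations.\<close>

lemma integral_norm_cbox_le:
  fixes h :: "'a::euclidean_space \<Rightarrow> 'a"
  assumes h: "continuous_on UNIV h" and p: "1 \<le> p" and V: "0 < measure lborel (cbox a b)"
    and int: "integrable lborel (\<lambda>z. norm (h z) powr p)"
  shows "integral (cbox a b) (\<lambda>z. norm (h z)) \<le>
    measure lborel (cbox a b) powr (1 - 1 / p) * integral\<^sup>L lborel (\<lambda>z. norm (h z) powr p) powr (1 / p)"
proof -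
  let ?Q = "cbox a b"
  have cp: "continuous_on UNIV (\<lambda>z. norm (h z) powr p)"
    using p by (intro continuous_on_powr' continuous_intros h) auto
  have iQ: "integrable (lebesgue_on ?Q) k" if "continuous_on UNIV k" for k :: "'a \<Rightarrow> real"
    using locally_integrable_continuous[OF that] by (auto simp: locally_integrable_def)
  have hS: "h \<in> Lspace ?Q p"
    unfolding Lspace_def
    using iQ[OF cp] borel_measurable_continuous_lebesgue[OF h] by (auto intro: measurable_restrict_space1)
  have "integral ?Q (\<lambda>z. norm (h z)) = integral\<^sup>L (lebesgue_on ?Q) (\<lambda>z. norm (h z))"
    using iQ[of "\<lambda>z. norm (h z)"] h by (intro lebesgue_integral_eq_integral[symmetric]) (auto intro!: continuous_intros)
  also have "\<dots> = Lnorm ?Q 1 h"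
    by (simp add: Lnorm_def)
  also have "\<dots> \<le> measure lborel ?Q powr (1 / 1 - 1 / p) * Lnorm ?Q p h"
    using Lnorm_mono_exponent[of ?Q 1 p h] V p hS by simp
  also have "\<dots> \<le> measure lborel ?Q powr (1 - 1 / p) * integral\<^sup>L lborel (\<lambda>z. norm (h z) powr p) powr (1 / p)"
  proof -
    have mb: "(\<lambda>z. norm (h z) powr p) \<in> borel_measurable lborel"
      using borel_measurable_continuous_onI[OF cp] by simp
    have il: "integrable lebesgue (\<lambda>z. norm (h z) powr p)"
      using int mb by (simp add: integrable_completion)
    have "integral\<^sup>L (lebesgue_on ?Q) (\<lambda>z. norm (h z) powr p) = integral\<^sup>L lebesgue (\<lambda>z. indicator ?Q z *\<^sub>R norm (h z) powr p)"
      by (rule integral_lebesgue_on_eq) simp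
    also have "\<dots> \<le> integral\<^sup>L lebesgue (\<lambda>z. norm (h z) powr p)"
      by (intro integral_mono integrable_mult_indicator il) (auto simp: indicator_def)
    also have "\<dots> = integral\<^sup>L lborel (\<lambda>z. norm (h z) powr p)"
      by (rule integral_completion[OF mb])
    finally show ?thesis
      using p unfolding Lnorm_def by (intro mult_mono powr_mono2) (auto intro!: integral_nonneg_AE)
  qed
  finally show ?thesis .
qed

lemma content_cube:
  fixes w :: "'a::euclidean_space"
  assumes "0 \<le> r"
  shows "measure lborel (cbox (w - r *\<^sub>R One) (w + r *\<^sub>R One)) = (2 * r) ^ DIM('a)"
  using assms by (subst content_cbox) (auto simp: inner_diff_left inner_add_left)

lemma norm_le_cube:
  fixes w z :: "'a::euclidean_space"
  assumes "z \<in> cbox (w - r *\<^sub>R One) (w + r *\<^sub>R One)"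
  shows "norm (z - w) \<le> r * DIM('a)"
proof -
  have "(\<Sum>b\<in>Basis. \<bar>(z - w) \<bullet> b\<bar>) \<le> (\<Sum>b\<in>(Basis::'a set). r)"
    using assms by (intro sum_mono) (auto simp: mem_box inner_diff_left inner_add_left abs_le_iff; smt (verit))
  then show ?thesis
    using norm_le_l1[of "z - w"] by (simp add: mult.commute)
qed

text \<open>Up to the factor \<open>V\<close>, the function \<open>F\<close> averages
  \<open>\<phi>\<close> over the cube contracted towards \<open>x\<close> by the factor
  \<open>t\<close>; it runs from \<open>V * \<phi> x\<close> at 0 to the integral over
  \<open>Q\<close> at 1. Its derivative is at most \<open>C * t powr (- a)\<close>, which is
  integrable at 0 because \<open>p\<close> exceeds the dimension, and integration gives the factor
  \<open>1 / (1 - a)\<close>. The point \<open>x\<close> may lie outside the cube.\<close>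

lemma morrey_cube:
  fixes \<phi> :: "'a::euclidean_space \<Rightarrow> real" and w x :: 'a and r :: real
  assumes \<phi>: "test_function UNIV \<phi>" and p: "real DIM('a) < p" and r: "0 < r"
  defines "Q \<equiv> cbox (w - r *\<^sub>R One) (w + r *\<^sub>R One)"
  shows "\<bar>integral Q \<phi> / measure lborel Q - \<phi> x\<bar> \<le> (norm (x - w) + r * DIM('a)) * ((2 * r) powr (- DIM('a) / p)) / (1 - DIM('a) / p)
     * integral\<^sup>L lborel (\<lambda>z. norm (gradient \<phi> z) powr p) powr (1 / p)"
proof -
  let ?N = "real DIM('a)"
  define V where "V = measure lborel Q"
  define P where "P = integral\<^sup>L lborel (\<lambda>z. norm (gradient \<phi> z) powr p)"
  define D where "D = norm (x - w) + r * ?N"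
  define C where "C = D * V powr (1 - 1 / p) * P powr (1 / p)"
  define a where "a = ?N / p"
  have N: "1 \<le> ?N" using DIM_positive[where 'a='a] by linarith
  have p1: "1 \<le> p" "0 < p" using N p by linarith+
  have a: "0 < a" "a < 1" using N p p1 by (auto simp: a_def)
  have V: "V = (2 * r) ^ DIM('a)" "0 < V"
    using r content_cube[of r w] by (auto simp: V_def Q_def)
  obtain K where K: "compact K" "\<And>x. x \<notin> K \<Longrightarrow> gradient \<phi> x = 0"
    by (rule test_function_support[OF \<phi>]) blast
  have c: "continuous_on UNIV \<phi>" "continuous_on UNIV (gradient \<phi>)"
    using test_function_continuous[OF \<phi>] by auto
  have D: "norm (z - x) \<le> D" if "z \<in> Q" for z
    using norm_le_cube[of z w r] that norm_triangle_ineq4[of "z - w" "x - w"] by (simp add: D_def Q_def)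
  have D0: "0 \<le> D" using r by (simp add: D_def)
  have P0: "0 \<le> P" by (simp add: P_def)
  have C0: "0 \<le> C" using D0 by (simp add: C_def)
  define F where "F t = integral Q (\<lambda>z. \<phi> (x + t *\<^sub>R (z - x)))" for t
  define F' where "F' t = integral Q (\<lambda>z. gradient \<phi> (x + t *\<^sub>R (z - x)) \<bullet> (z - x))" for t
  have deriv: "(F has_vector_derivative F' t) (at t)" for t
    unfolding F_def F'_def Q_def
  proof (rule leibniz_rule_vector_derivative[where U=UNIV])
    show "((\<lambda>t. \<phi> (x + t *\<^sub>R (z - x))) has_vector_derivative gradient \<phi> (x + t *\<^sub>R (z - x)) \<bullet> (z - x)) (at t)" for t z
    proof -
      have "((\<lambda>t. x + t *\<^sub>R (z - x)) has_derivative (\<lambda>t. t *\<^sub>R (z - x))) (at t)"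
        by (auto intro!: derivative_eq_intros)
      from has_derivative_compose[OF this smooth_has_gradient[OF test_function_smooth[OF \<phi>]]]
      show ?thesis by (simp add: has_vector_derivative_def)
    qed
    show "(\<lambda>z. \<phi> (x + t *\<^sub>R (z - x))) integrable_on cbox (w - r *\<^sub>R One) (w + r *\<^sub>R One)" for t
      by (intro integrable_continuous continuous_on_compose2[OF c(1)] continuous_intros) auto
    have "continuous_on (UNIV \<times> cbox (w - r *\<^sub>R One) (w + r *\<^sub>R One))
       (\<lambda>tz. gradient \<phi> (x + fst tz *\<^sub>R (snd tz - x)) \<bullet> (snd tz - x))"
      by (intro continuous_intros continuous_on_compose2[OF c(2)]) auto
    then show "continuous_on (UNIV \<times> cbox (w - r *\<^sub>R One) (w + r *\<^sub>R One))
       (\<lambda>(t, z). gradient \<phi> (x + t *\<^sub>R (z - x)) \<bullet> (z - x))"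
      by (simp add: case_prod_unfold)
  qed auto
  have cg: "continuous_on UNIV (\<lambda>z. gradient \<phi> (x + t *\<^sub>R (z - x)))" for t
    by (intro continuous_on_compose2[OF c(2)] continuous_intros) auto
  \<comment> \<open>The affine substitution divides the integral of the \<open>p\<close>-th power by
    \<open>t ^ DIM('a)\<close>, whose \<open>p\<close>-th root is \<open>t powr a\<close>.\<close>
  have bound: "norm (F' t) \<le> C * t powr (- a)" if t: "0 < t" for t
  proof -
    let ?h = "\<lambda>z. gradient \<phi> (x + t *\<^sub>R (z - x))"
    have "norm (F' t) \<le> integral Q (\<lambda>z. D * norm (?h z))"
      unfolding F'_def Q_def
    proof (rule integral_norm_bound_integral)
      show "(\<lambda>z. ?h z \<bullet> (z - x)) integrable_on cbox (w - r *\<^sub>R One) (w + r *\<^sub>R One)"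
        "(\<lambda>z. D * norm (?h z)) integrable_on cbox (w - r *\<^sub>R One) (w + r *\<^sub>R One)"
        by (intro integrable_continuous continuous_intros continuous_on_subset[OF cg] subset_UNIV)+
      show "norm (?h z \<bullet> (z - x)) \<le> D * norm (?h z)" if "z \<in> cbox (w - r *\<^sub>R One) (w + r *\<^sub>R One)" for z
      proof -
        have "\<bar>?h z \<bullet> (z - x)\<bar> \<le> norm (?h z) * norm (z - x)" by (rule Cauchy_Schwarz_ineq2)
        also have "\<dots> \<le> norm (?h z) * D"
          using D[of z] that by (intro mult_left_mono) (auto simp: Q_def)
        finally show ?thesis by (simp add: mult.commute)
      qed
    qed
    also have "\<dots> = D * integral Q (\<lambda>z. norm (?h z))" by simp
    also have "\<dots> \<le> D * (V powr (1 - 1 / p) * (P / t ^ DIM('a)) powr (1 / p))"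
    proof (rule mult_left_mono[OF _ D0])
      have ck: "continuous_on UNIV (\<lambda>z. norm (gradient \<phi> z) powr p)"
        using p1 by (intro continuous_on_powr' continuous_intros c) auto
      have eq: "?h z = gradient \<phi> ((1 - t) *\<^sub>R x + t *\<^sub>R z)" for z
        by (simp add: algebra_simps)
      have I: "integral\<^sup>L lborel (\<lambda>z. norm (?h z) powr p) = P / t ^ DIM('a)"
        unfolding P_def eq using integral_lborel_affine[OF ck t, of "(1 - t) *\<^sub>R x"] by simp
      have int: "integrable lborel (\<lambda>z. norm (?h z) powr p)"
      proof (rule integrable_compact_support(1))
        show "continuous_on UNIV (\<lambda>z. norm (?h z) powr p)"
          using p1 by (intro continuous_on_powr' continuous_intros cg) auto
        show "compact ((\<lambda>y. x + (1 / t) *\<^sub>R (y - x)) ` K)"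
          by (intro compact_continuous_image continuous_intros K)
        show "norm (?h z) powr p = 0" if "z \<notin> (\<lambda>y. x + (1 / t) *\<^sub>R (y - x)) ` K" for z
        proof -
          have "x + t *\<^sub>R (z - x) \<notin> K"
          proof
            assume "x + t *\<^sub>R (z - x) \<in> K"
            then have "x + (1 / t) *\<^sub>R ((x + t *\<^sub>R (z - x)) - x) \<in> (\<lambda>y. x + (1 / t) *\<^sub>R (y - x)) ` K"
              by (rule imageI)
            with that t show False by simp
          qed
          then show ?thesis using K(2) by simp
        qed
      qed
      show "integral Q (\<lambda>z. norm (?h z)) \<le> V powr (1 - 1 / p) * (P / t ^ DIM('a)) powr (1 / p)"
        using integral_norm_cbox_le[OF cg p1(1), of "w - r *\<^sub>R One" "w + r *\<^sub>R One" t, OF _ int] V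
        by (simp only: I V_def Q_def)
    qed
    also have "(P / t ^ DIM('a)) powr (1 / p) = P powr (1 / p) * t powr (- a)"
      using t P0 by (simp add: powr_divide powr_powr a_def powr_minus_divide flip: powr_realpow)
    finally show ?thesis by (simp add: C_def mult.assoc)
  qed
  have "norm (F 1 - F 0) \<le> C / (1 - a) * 1 powr (1 - a) - C / (1 - a) * 0 powr (1 - a)"
  \<comment> \<open>The comparison function is the primitive of the bound on \<open>F'\<close>; it
    is continuous at 0 although the bound is singular there.\<close>
  proof (rule differentiable_bound_general[where \<phi>="\<lambda>t. C / (1 - a) * t powr (1 - a)" and f'=F'])
    show "continuous_on {0..1} F"
      using deriv by (meson continuous_at_imp_continuous_on has_vector_derivative_continuous)
    show "continuous_on {0..1} (\<lambda>t. C / (1 - a) * t powr (1 - a))"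
      using a by (intro continuous_intros continuous_on_powr') auto
    show "((\<lambda>t. C / (1 - a) * t powr (1 - a)) has_vector_derivative C * t powr (- a)) (at t)"
      if "0 < t" for t
    proof -
      have "((\<lambda>t. C / (1 - a) * t powr (1 - a)) has_real_derivative C / (1 - a) * ((1 - a) * t powr (1 - a - 1))) (at t)"
        by (intro DERIV_cmult has_real_derivative_powr that)
      then show ?thesis
        using a by (simp add: has_real_derivative_iff_has_vector_derivative)
    qed
  qed (use deriv bound in auto)
  then have "\<bar>F 1 - F 0\<bar> \<le> C / (1 - a)" using a by simp
  moreover have "F 1 = integral Q \<phi>" by (simp add: F_def)
  moreover have "F 0 = V * \<phi> x" by (simp add: F_def V_def Q_def)
  ultimately have "\<bar>integral Q \<phi> - V * \<phi> x\<bar> / V \<le> C / (1 - a) / V"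
    using V by (intro divide_right_mono) auto
  moreover have "\<bar>integral Q \<phi> - V * \<phi> x\<bar> / V = \<bar>integral Q \<phi> / V - \<phi> x\<bar>"
  proof -
    have "integral Q \<phi> / V - \<phi> x = (integral Q \<phi> - V * \<phi> x) / V"
      using V(2) by (simp add: diff_divide_distrib)
    then show ?thesis using V(2) by (simp add: abs_divide)
  qed
  moreover have "C / (1 - a) / V = D * ((2 * r) powr (- ?N / p)) / (1 - ?N / p) * P powr (1 / p)"
  proof -
    have "V powr (1 - 1 / p) / V = V powr (- 1 / p)"
      using V by (simp add: powr_diff powr_minus_divide)
    also have "\<dots> = (2 * r) powr (- ?N / p)"
    proof -
      have "V = (2 * r) powr ?N" using r V(1) powr_realpow[of "2 * r" "DIM('a)"] by simp
      then show ?thesis by (simp only: powr_powr) simp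
    qed
    finally have "V powr (1 - 1 / p) / V = (2 * r) powr (- ?N / p)" .
    moreover have "C / V = D * (V powr (1 - 1 / p) / V) * P powr (1 / p)"
      by (simp add: C_def)
    ultimately have "C / V = D * (2 * r) powr (- ?N / p) * P powr (1 / p)"
      by (simp only:)
    then show ?thesis by (simp add: a_def) (simp add: divide_simps mult.commute)
  qed
  ultimately show ?thesis by (simp add: D_def P_def V_def)
qed

text \<open>
  The factor in Morrey's inequality when two points at distance \<open>d\<close> are compared through the
  mean over a cube of half side \<open>d / p\<close> around one of them. This side makes the factor tend to \<open>d\<close>
  as \<open>p\<close> grows.
\<close>

definition morrey_const :: "real \<Rightarrow> real \<Rightarrow> real \<Rightarrow> real" where
  "morrey_const N p d = d * (1 + 2 * N / p) * (2 * d / p) powr (- N / p) / (1 - N / p)"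

lemma morrey_const_0 [simp]: "morrey_const N p 0 = 0"
  by (simp add: morrey_const_def)

lemma morrey_const_nonneg: "0 \<le> d \<Longrightarrow> 0 < N \<Longrightarrow> N < p \<Longrightarrow> 0 \<le> morrey_const N p d"
  by (simp add: morrey_const_def)

text \<open>For \<open>d > 0\<close> the constant is a positive power of \<open>d\<close> times a
  factor free of \<open>d\<close>; monotonicity and continuity in \<open>d\<close> are read off from
  this form.\<close>

lemma morrey_const_alt:
  assumes "0 < d" "0 < N" "N < p"
  shows "morrey_const N p d = d powr (1 - N / p) * ((1 + 2 * N / p) * (2 / p) powr (- N / p) / (1 - N / p))"
proof -
  have "(2 * d / p) powr (- N / p) = d powr (- N / p) * (2 / p) powr (- N / p)"
    using powr_mult[of d "2 / p" "- N / p"] assms by (simp add: mult.commute)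
  moreover have "d powr (1 - N / p) = d * d powr (- N / p)"
    using assms powr_add[of d 1 "- N / p"] by simp
  ultimately show ?thesis by (simp add: morrey_const_def)
qed

lemma morrey_const_mono:
  assumes "0 \<le> d" "d \<le> e" "0 < N" "N < p"
  shows "morrey_const N p d \<le> morrey_const N p e"
proof (cases "d = 0")
  case True
  with assms show ?thesis by (simp add: morrey_const_nonneg)
next
  case False
  with assms have "0 < d" "0 < e" by auto
  with assms show ?thesis
    unfolding morrey_const_alt[OF \<open>0 < d\<close> assms(3,4)] morrey_const_alt[OF \<open>0 < e\<close> assms(3,4)]
    by (intro mult_right_mono powr_mono2) auto
qed

lemma morrey_const_tendsto:
  assumes "0 < d" "0 < N"
  shows "((\<lambda>p. morrey_const N p d) \<longlongrightarrow> d) at_top"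
  unfolding morrey_const_def using assms by real_asymp

lemma morrey_const_tendsto_const:
  assumes "d \<longlonglongrightarrow> l" "\<And>n. 0 \<le> d n" "0 < N" "N < p"
  shows "(\<lambda>n. morrey_const N p (d n)) \<longlonglongrightarrow> morrey_const N p l"
proof -
  have l: "0 \<le> l" by (rule LIMSEQ_le_const[OF assms(1)]) (use assms(2) in auto)
  define C where "C = (1 + 2 * N / p) * (2 / p) powr (- N / p) / (1 - N / p)"
  have e: "0 < 1 - N / p" using assms by simp
  have eq: "morrey_const N p t = t powr (1 - N / p) * C" if "0 \<le> t" for t
    using that assms e by (cases "t = 0") (auto simp: morrey_const_alt C_def)
  have "(\<lambda>n. d n powr (1 - N / p) * C) \<longlonglongrightarrow> l powr (1 - N / p) * C"
    using e assms(2) by (intro tendsto_mult tendsto_powr' tendsto_const assms(1)) auto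
  then show ?thesis using l assms(2) by (simp add: eq)
qed

text \<open>Both values are compared with the mean over the cube around \<open>y\<close>. The
  lengths in the two estimates, \<open>d + r * ?N\<close> and \<open>r * ?N\<close>, add up to
  \<open>d * (1 + 2 * ?N / p)\<close> for \<open>r = d / p\<close>.\<close>

lemma morrey_test_function:
  fixes \<phi> :: "'a::euclidean_space \<Rightarrow> real"
  assumes \<phi>: "test_function UNIV \<phi>" and p: "real DIM('a) < p"
  shows "\<bar>\<phi> x - \<phi> y\<bar> \<le> morrey_const DIM('a) p (norm (x - y))
     * integral\<^sup>L lborel (\<lambda>z. norm (gradient \<phi> z) powr p) powr (1 / p)"
proof (cases "x = y")
  case False
  let ?N = "real DIM('a)"
  define d where "d = norm (x - y)"
  define r where "r = d / p"
  have "1 \<le> ?N" using DIM_positive[where 'a='a] by linarith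
  with p have p0: "0 < p" by linarith
  have d: "0 < d" "0 < r" using False p0 by (auto simp: d_def r_def)
  define Q where "Q = cbox (y - r *\<^sub>R One) (y + r *\<^sub>R One)"
  define A where "A = integral Q \<phi> / measure lborel Q"
  define k where "k = ((2 * r) powr (- ?N / p)) / (1 - ?N / p)
     * integral\<^sup>L lborel (\<lambda>z. norm (gradient \<phi> z) powr p) powr (1 / p)"
  have "\<bar>A - \<phi> x\<bar> \<le> (d + r * ?N) * k" "\<bar>A - \<phi> y\<bar> \<le> (r * ?N) * k"
    using morrey_cube[OF \<phi> p d(2), of y x] morrey_cube[OF \<phi> p d(2), of y y]
    by (auto simp: A_def Q_def d_def k_def)
  then have "\<bar>\<phi> x - \<phi> y\<bar> \<le> (d + r * ?N) * k + (r * ?N) * k" by linarith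
  also have "\<dots> = d * (1 + 2 * ?N / p) * k"
    using p0 by (simp add: r_def field_simps)
  finally show ?thesis
    by (simp add: morrey_const_def k_def r_def d_def)
qed simp

section \<open>Functions with bounded weak gradient along a segment\<close>

lemma smooth_reflect:
  fixes f :: "'a::euclidean_space \<Rightarrow> real"
  assumes "smooth f"
  shows "smooth (\<lambda>y. f (z - y))" and "gradient (\<lambda>y. f (z - y)) y = - gradient f (z - y)"
proof -
  have D: "((\<lambda>y. f (z - y)) has_derivative (\<lambda>h. - gradient f (z - y) \<bullet> h)) (at y)" if "smooth f" for f y
  proof -
    have "((\<lambda>y. z - y) has_derivative (\<lambda>h. - h)) (at y)"
      by (auto intro!: derivative_eq_intros)
    from has_derivative_compose[OF this smooth_has_gradient[OF that]] show ?thesis by simp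
  qed
  show "gradient (\<lambda>y. f (z - y)) y = - gradient f (z - y)"
    by (rule gradient_eqI[OF D[OF assms]])
  have "Ck k UNIV (\<lambda>y. f (z - y))" if "smooth f" for k f
    using that
  proof (induction k arbitrary: f)
    case 0
    then show ?case
      using continuous_on_reflect[OF smooth_continuous] by simp
  next
    case (Suc k)
    show ?case
    proof (rule Ck_SucI[OF D[OF Suc.prems]])
      fix b :: 'a assume "b \<in> Basis"
      then have "Ck k UNIV (\<lambda>y. (-1) * (gradient f (z - y) \<bullet> b))"
        by (intro Ck_mult Ck_const Suc.IH[of "\<lambda>y. gradient f y \<bullet> b"] smooth_partial Suc.prems)
      then show "Ck k UNIV (\<lambda>y. - gradient f (z - y) \<bullet> b)" by simp
    qed
  qed
  with assms show "smooth (\<lambda>y. f (z - y))" by (simp add: smooth_def)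
qed

text \<open>At points of the segment the gradient of a mollification of \<open>u\<close> is an
  average of \<open>g\<close>, hence bounded by \<open>G\<close>. The mean value inequality on the
  segment gives the estimate for the mollification, which is close to \<open>u\<close> at the two
  end points.\<close>

lemma weak_gradient_lipschitz_on_segment:
  fixes u :: "'a::euclidean_space \<Rightarrow> real"
  assumes "open \<Omega>" and cu: "continuous_on \<Omega> u" and g: "has_weak_gradient \<Omega> u g"
    and gG: "AE x in lebesgue_on \<Omega>. norm (g x) \<le> G" and G0: "0 \<le> G" and seg: "closed_segment x y \<subseteq> \<Omega>"
  shows "\<bar>u x - u y\<bar> \<le> G * norm (x - y)"
proof -
  obtain e where e: "0 < e" "(\<Union>z\<in>closed_segment x y. cball z e) \<subseteq> \<Omega>"
    using compact_subset_open_imp_cball_epsilon_subset[OF compact_segment assms(1) seg] by metis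
  define K where "K = (\<Union>z\<in>closed_segment x y. cball z e)"
  have K: "compact K" "K \<subseteq> \<Omega>"
    using e compact_minkowski_sum_cball[OF compact_segment] by (auto simp: K_def)
  have seg_K: "z \<in> closed_segment x y \<Longrightarrow> cball z e \<subseteq> K" for z by (auto simp: K_def)
  \<comment> \<open>Mollification needs an integrable function on the whole space. The cut-off is
    invisible from the segment, since \<open>K\<close> contains the balls of radius \<open>e\<close>
    around its points.\<close>
  define f where "f z = indicator K z * u z" for z
  have f: "integrable lebesgue f"
    using integrable_lebesgue_on_iff[OF compact_sets_lebesgue[OF K(1)], of u] g K
    by (auto simp: f_def[abs_def] has_weak_gradient_def locally_integrable_def)
  show ?thesis
  proof (rule field_le_epsilon)
    fix \<delta> :: real assume \<delta>: "0 < \<delta>"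
    have "\<exists>d>0. \<forall>y'\<in>\<Omega>. dist y' z < d \<longrightarrow> dist (u y') (u z) < \<delta> / 2" if "z \<in> \<Omega>" for z
      using cu \<delta> that unfolding continuous_on_iff by (meson half_gt_zero)
    then obtain d1 d2 where d: "0 < d1" "0 < d2"
      "\<And>z. z \<in> \<Omega> \<Longrightarrow> dist z x < d1 \<Longrightarrow> \<bar>u z - u x\<bar> < \<delta> / 2"
      "\<And>z. z \<in> \<Omega> \<Longrightarrow> dist z y < d2 \<Longrightarrow> \<bar>u z - u y\<bar> < \<delta> / 2"
      using seg by (metis dist_real_def ends_in_segment subsetD)
    define \<epsilon> where "\<epsilon> = min e (min (d1 / 2) (d2 / 2))"
    have \<epsilon>: "0 < \<epsilon>" "\<epsilon> \<le> e" "\<epsilon> < d1" "\<epsilon> < d2" using e d by (auto simp: \<epsilon>_def)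
    obtain \<eta> :: "'a \<Rightarrow> real" where \<eta>: "test_function UNIV \<eta>" "\<And>x. 0 \<le> \<eta> x"
      "\<And>x. \<eta> x \<noteq> 0 \<Longrightarrow> norm x \<le> \<epsilon>" "integral\<^sup>L lborel \<eta> = 1"
      using mollifier_exists[OF \<epsilon>(1)] by metis
    note s = test_function_smooth[OF \<eta>(1)]
    have c\<eta>: "continuous_on UNIV \<eta>"
      using test_function_continuous[OF \<eta>(1)] by auto
    define F where "F = convolve f \<eta>"
    have t: "test_function \<Omega> (\<lambda>y. \<eta> (z - y))" if "z \<in> closed_segment x y" for z
    proof (rule test_functionI[of _ "cball z \<epsilon>"])
      show "cball z \<epsilon> \<subseteq> \<Omega>" using seg_K[OF that] K \<epsilon>(2) subset_cball[of \<epsilon> e z] by blast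
      show "\<eta> (z - y) = 0" if "y \<notin> cball z \<epsilon>" for y
        using that \<eta>(3)[of "z - y"] by (auto simp: dist_norm)
    qed (auto intro: smooth_reflect(1)[OF s])
    have zero_out: "\<eta> (z - w) = 0" "gradient \<eta> (z - w) = 0" if "z \<in> closed_segment x y" "w \<notin> K" for z w
    proof -
      have t': "test_function (ball z (\<epsilon> + r)) (\<lambda>y. \<eta> (z - y))" if "0 < r" for r
      proof (rule test_functionI[of _ "cball z \<epsilon>"])
        show "\<eta> (z - y) = 0" if "y \<notin> cball z \<epsilon>" for y
          using that \<eta>(3)[of "z - y"] by (auto simp: dist_norm)
      qed (use that in \<open>auto intro: smooth_reflect(1)[OF s]\<close>)
      have "\<not> dist z w \<le> e" using that by (auto simp: K_def)
      then have "0 < dist z w - \<epsilon>" using \<epsilon>(2) by simp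
      from test_function_outside[OF t'[OF this], of w] smooth_reflect(2)[OF s, of z w]
      show "\<eta> (z - w) = 0" "gradient \<eta> (z - w) = 0" by auto
    qed
    have int1: "integral\<^sup>L lebesgue (\<lambda>y. \<eta> (z - y)) = 1" for z
    proof -
      have "(\<lambda>y. \<eta> (z - y)) \<in> borel_measurable lborel"
        using borel_measurable_continuous_onI[OF continuous_on_reflect[OF c\<eta>]] by simp
      then show ?thesis
        using integral_lborel_reflect[OF c\<eta>, of z] \<eta>(4) by (simp add: integral_completion)
    qed
    \<comment> \<open>The integral of a function that is not integrable is 0 by convention, so the
      value 1 certifies integrability.\<close>
    then have i\<eta>: "integrable lebesgue (\<lambda>y. \<eta> (z - y))" for z
      by (metis not_integrable_integral_eq zero_neq_one)
    have gradF: "norm (gradient F z) \<le> G" if z: "z \<in> closed_segment x y" for z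
    proof -
      have "gradient F z = integral\<^sup>L lebesgue (\<lambda>y. f y *\<^sub>R gradient \<eta> (z - y))"
        unfolding F_def by (rule gradient_convolve[OF f \<eta>(1)])
      \<comment> \<open>The reflection of the kernel produces one minus sign here; the definition of
        the weak gradient cancels it in the next step.\<close>
      also have "\<dots> = - integral\<^sup>L lebesgue (\<lambda>y. u y *\<^sub>R gradient (\<lambda>y. \<eta> (z - y)) y)"
      proof -
        have "(\<lambda>y. f y *\<^sub>R gradient \<eta> (z - y)) = (\<lambda>y. - (u y *\<^sub>R gradient (\<lambda>y. \<eta> (z - y)) y))"
          using zero_out(2)[OF z] by (intro ext) (auto simp: f_def indicator_def smooth_reflect(2)[OF s])
        then show ?thesis by simp
      qed
      also have "\<dots> = integral\<^sup>L lebesgue (\<lambda>y. \<eta> (z - y) *\<^sub>R g y)"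
        using g t[OF z] unfolding has_weak_gradient_iff[OF assms(1)] by simp
      finally have eq: "gradient F z = integral\<^sup>L lebesgue (\<lambda>y. \<eta> (z - y) *\<^sub>R g y)" .
      have ig: "integrable lebesgue (\<lambda>y. \<eta> (z - y) *\<^sub>R g y)"
        by (rule integrable_test_function_scaleR[OF t[OF z]]) (use g in \<open>simp add: has_weak_gradient_def\<close>)
      have "AE y in lebesgue. y \<in> \<Omega> \<longrightarrow> norm (g y) \<le> G"
        using gG open_sets_lebesgue[OF assms(1)] by (subst (asm) AE_restrict_space_iff) auto
      then have ae: "AE y in lebesgue. norm (\<eta> (z - y) *\<^sub>R g y) \<le> \<eta> (z - y) * G"
      proof eventually_elim
        case (elim y)
        then show ?case
          using zero_out(1)[OF z, of y] K(2) \<eta>(2)[of "z - y"]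
          by (cases "y \<in> K") (auto intro: mult_left_mono)
      qed
      have "norm (gradient F z) \<le> integral\<^sup>L lebesgue (\<lambda>y. norm (\<eta> (z - y) *\<^sub>R g y))"
        unfolding eq by (rule integral_norm_bound)
      also have "\<dots> \<le> integral\<^sup>L lebesgue (\<lambda>y. \<eta> (z - y) * G)"
        by (rule integral_mono_AE[OF integrable_norm[OF ig] _ ae]) (simp add: i\<eta>)
      also have "\<dots> = G" using int1[of z] by simp
      finally show ?thesis .
    qed
    have main: "norm (F x - F y) \<le> G * norm (x - y)"
    proof (rule differentiable_bound[OF convex_closed_segment])
      fix z assume z: "z \<in> closed_segment x y"
      show "(F has_derivative (\<lambda>h. gradient F z \<bullet> h)) (at z within closed_segment x y)"
        using smooth_has_gradient[OF smooth_convolve[OF f \<eta>(1)]] has_derivative_at_withinI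
        unfolding F_def by blast
      show "onorm (\<lambda>h. gradient F z \<bullet> h) \<le> G"
      proof (rule onorm_le)
        fix h
        show "norm (gradient F z \<bullet> h) \<le> G * norm h"
          using order_trans[OF Cauchy_Schwarz_ineq2 mult_right_mono[OF gradF[OF z] norm_ge_zero], of h] by simp
      qed
    qed auto
    have near: "\<bar>F z - u z\<bar> \<le> \<delta> / 2"
      if z: "z \<in> closed_segment x y" and uz: "\<And>y. y \<in> \<Omega> \<Longrightarrow> dist y z \<le> \<epsilon> \<Longrightarrow> \<bar>u y - u z\<bar> < \<delta> / 2" for z
    proof -
      obtain B where B: "\<And>x. \<bar>\<eta> x\<bar> \<le> B" by (rule test_function_bounded[OF \<eta>(1)]) blast
      have i1: "integrable lebesgue (\<lambda>y. f y * \<eta> (z - y))"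
        using integrable_convolve[OF f c\<eta>, of B z] B by simp
      have "F z - u z = integral\<^sup>L lebesgue (\<lambda>y. f y * \<eta> (z - y)) - u z * integral\<^sup>L lebesgue (\<lambda>y. \<eta> (z - y))"
        by (simp add: F_def convolve_def int1)
      also have "\<dots> = integral\<^sup>L lebesgue (\<lambda>y. (f y - u z) * \<eta> (z - y))"
        using i1 i\<eta>[of z] by (simp add: left_diff_distrib)
      finally have eq: "F z - u z = integral\<^sup>L lebesgue (\<lambda>y. (f y - u z) * \<eta> (z - y))" .
      have "norm (integral\<^sup>L lebesgue (\<lambda>y. (f y - u z) * \<eta> (z - y))) \<le> integral\<^sup>L lebesgue (\<lambda>y. \<delta> / 2 * \<eta> (z - y))"
      proof (rule Bochner_Integration.integral_norm_bound_integral)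
        show "integrable lebesgue (\<lambda>y. (f y - u z) * \<eta> (z - y))"
          using i1 i\<eta>[of z] by (simp add: left_diff_distrib)
        show "integrable lebesgue (\<lambda>y. \<delta> / 2 * \<eta> (z - y))" using i\<eta>[of z] by simp
        show "norm ((f y - u z) * \<eta> (z - y)) \<le> \<delta> / 2 * \<eta> (z - y)" for y
        proof (cases "\<eta> (z - y) = 0")
          case False
          then have "norm (z - y) \<le> \<epsilon>" by (rule \<eta>(3))
          moreover from this have "y \<in> K" using seg_K[OF z] \<epsilon>(2) by (auto simp: dist_norm)
          ultimately have "\<bar>f y - u z\<bar> \<le> \<delta> / 2"
            using uz[of y] K(2) by (auto simp: f_def dist_norm norm_minus_commute)
          from mult_right_mono[OF this \<eta>(2)[of "z - y"]] show ?thesis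
            using \<eta>(2)[of "z - y"] by (simp add: abs_mult)
        qed simp
      qed
      then show ?thesis using eq int1[of z] by simp
    qed
    note main
    moreover have "\<bar>F x - u x\<bar> \<le> \<delta> / 2"
      by (rule near) (use d(3) \<epsilon>(3) in auto)
    moreover have "\<bar>F y - u y\<bar> \<le> \<delta> / 2"
      by (rule near) (use d(4) \<epsilon>(4) in auto)
    ultimately show "\<bar>u x - u y\<bar> \<le> G * norm (x - y) + \<delta>"
      unfolding real_norm_def abs_le_iff by linarith
  qed
qed

text \<open>Exhausting \<Omega> by finite unions of closed boxes makes \<open>f\<close> a pointwise
  limit of measurable functions. This supplies the measurability of \<open>weak_gradient\<close>,
  whose choice guarantees only local integrability and the integral identities.\<close>

lemma locally_integrable_imp_measurable:
  fixes f :: "'a::euclidean_space \<Rightarrow> 'b::euclidean_space"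
  assumes "open \<Omega>" "locally_integrable \<Omega> f"
  shows "f \<in> borel_measurable (lebesgue_on \<Omega>)"
proof (cases "\<Omega> = {}")
  case True
  then show ?thesis by (auto simp: measurable_def space_restrict_space)
next
  case False
  obtain D where D: "countable D" "D \<subseteq> Pow \<Omega>" "\<And>X. X \<in> D \<Longrightarrow> \<exists>a b. X = cbox a b" "\<Union>D = \<Omega>"
    by (rule open_countable_Union_open_cbox[OF assms(1)]) blast
  have Dne: "D \<noteq> {}" using D(4) False by auto
  define K where "K n = (\<Union>i\<le>n. from_nat_into D i)" for n :: nat
  have K: "compact (K n)" "K n \<subseteq> \<Omega>" for n
  proof -
    have "from_nat_into D i \<in> D" for i using from_nat_into[OF Dne] .
    then have "compact (from_nat_into D i) \<and> from_nat_into D i \<subseteq> \<Omega>" for i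
      using D(2,3) by (metis PowD compact_cbox subsetD)
    then show "compact (K n)" "K n \<subseteq> \<Omega>" by (auto simp: K_def)
  qed
  have "(\<lambda>x. indicator \<Omega> x *\<^sub>R f x) \<in> borel_measurable lebesgue"
  proof (rule borel_measurable_LIMSEQ_metric)
    fix n
    have "integrable lebesgue (\<lambda>x. indicator (K n) x *\<^sub>R f x)"
      using assms(2) K[of n] by (intro integrable_lebesgue_on_iff[THEN iffD1] compact_sets_lebesgue)
        (auto simp: locally_integrable_def)
    then show "(\<lambda>x. indicator (K n) x *\<^sub>R f x) \<in> borel_measurable lebesgue"
      by (rule borel_measurable_integrable)
    fix x
    show "(\<lambda>n. indicator (K n) x *\<^sub>R f x) \<longlonglongrightarrow> indicator \<Omega> x *\<^sub>R f x"
    proof (cases "x \<in> \<Omega>")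
      case True
      then obtain X where X: "X \<in> D" "x \<in> X" using D(4) by blast
      then obtain i where i: "from_nat_into D i = X" using from_nat_into_surj[OF D(1)] by blast
      have "eventually (\<lambda>n. indicator (K n) x *\<^sub>R f x = indicator \<Omega> x *\<^sub>R f x) sequentially"
        using eventually_ge_at_top[of i]
        by eventually_elim (use X i True in \<open>auto simp: K_def indicator_def\<close>)
      then show ?thesis by (rule tendsto_eventually)
    next
      case False
      then have "x \<notin> K n" for n using K(2)[of n] by auto
      with False show ?thesis by simp
    qed
  qed
  then show ?thesis
    using open_sets_lebesgue[OF assms(1)] by (subst borel_measurable_restrict_space_iff) auto
qed

section \<open>Sobolev functions on a bounded open set\<close>

locale bounded_open =
  fixes \<Omega> :: "'a::euclidean_space set"
  assumes open_dom: "open \<Omega>" and bounded_dom: "bounded \<Omega>" and nonempty_dom: "\<Omega> \<noteq> {}"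
begin

abbreviation vol :: real where "vol \<equiv> measure lebesgue \<Omega>"

lemma ndim_ge_1: "1 \<le> real DIM('a)"
  using DIM_positive[where 'a='a] by linarith

lemma lmeasurable_dom: "\<Omega> \<in> lmeasurable"
  using bounded_dom open_dom by (intro bounded_set_imp_lmeasurable) auto

lemma sets_dom: "\<Omega> \<in> sets lebesgue"
  using open_sets_lebesgue[OF open_dom] .

lemma vol_pos: "0 < vol"
proof -
  have "vol \<noteq> 0"
    using open_not_negligible[OF open_dom nonempty_dom] lmeasurable_dom
    by (simp add: negligible_iff_measure)
  then show ?thesis by (simp add: less_le)
qed

lemma emeasure_dom: "emeasure (lebesgue_on \<Omega>) (space (lebesgue_on \<Omega>)) \<noteq> 0"
  using vol_pos sets_dom by (simp add: space_restrict_space emeasure_restrict_space measure_def zero_less_iff_neq_zero) auto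

lemma AE_dom_iff: "(AE x in lebesgue_on \<Omega>. P x) \<longleftrightarrow> (AE x in lebesgue. x \<in> \<Omega> \<longrightarrow> P x)"
  using sets_dom by (subst AE_restrict_space_iff) auto

text \<open>Every nonempty open part of \<Omega> has positive measure, so a closed set of full
  measure contains \<Omega> and then its closure.\<close>

lemma closed_AE:
  assumes "closed C" "AE x in lebesgue_on \<Omega>. x \<in> C"
  shows "closure \<Omega> \<subseteq> C"
proof (rule closure_minimal[OF _ assms(1)], rule subsetI)
  fix x assume "x \<in> \<Omega>"
  then show "x \<in> C"
    by (rule mem_closed_if_AE_lebesgue_open[OF open_dom assms(1) assms(2)[unfolded AE_dom_iff]])
qed

lemma finite_measure_dom: "finite_measure (lebesgue_on \<Omega>)"
  by (rule finite_measure_lebesgue_on[OF lmeasurable_dom])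

lemma bounded_in_Lspace:
  fixes f :: "'a \<Rightarrow> 'b::euclidean_space"
  assumes "f \<in> borel_measurable (lebesgue_on \<Omega>)" "\<And>x. x \<in> \<Omega> \<Longrightarrow> norm (f x) \<le> B" "0 < s"
  shows "f \<in> Lspace \<Omega> s"
proof -
  have "integrable (lebesgue_on \<Omega>) (\<lambda>x. norm (f x) powr s)"
  proof (rule Bochner_Integration.integrable_bound[of _ "\<lambda>x. B powr s"])
    show "integrable (lebesgue_on \<Omega>) (\<lambda>x. B powr s)"
      using finite_measure.integrable_const[OF finite_measure_dom] .
    show "(\<lambda>x. norm (f x) powr s) \<in> borel_measurable (lebesgue_on \<Omega>)"
      using assms by (intro powr_real_measurable borel_measurable_norm) auto
    show "AE x in lebesgue_on \<Omega>. norm (norm (f x) powr s) \<le> norm (B powr s)"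
      using assms(2,3) by (intro AE_I2) (auto simp: space_restrict_space intro!: powr_mono2)
  qed
  with assms show ?thesis by (simp add: Lspace_def)
qed

text \<open>Norms of the chosen \<open>weak_gradient\<close> can be computed from any explicit weak
  gradient, since the two agree almost everywhere.\<close>

lemma weak_gradient_Lspace:
  assumes "has_weak_gradient \<Omega> u g" "g \<in> Lspace \<Omega> s"
  shows "weak_gradient \<Omega> u \<in> Lspace \<Omega> s" "Lnorm \<Omega> s (weak_gradient \<Omega> u) = Lnorm \<Omega> s g"
proof -
  note w = has_weak_gradient_weak_gradient[OF assms(1)]
  have m: "weak_gradient \<Omega> u \<in> borel_measurable (lebesgue_on \<Omega>)"
    using w by (intro locally_integrable_imp_measurable open_dom) (simp add: has_weak_gradient_def)
  have ae: "AE x in lebesgue_on \<Omega>. weak_gradient \<Omega> u x = g x"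
    by (rule weak_gradient_AE_eq[OF open_dom assms(1)])
  then have ae': "AE x in lebesgue_on \<Omega>. g x = weak_gradient \<Omega> u x" by eventually_elim simp
  show "weak_gradient \<Omega> u \<in> Lspace \<Omega> s" by (rule Lspace_cong_AE[OF assms(2) m ae'])
  show "Lnorm \<Omega> s (weak_gradient \<Omega> u) = Lnorm \<Omega> s g"
    using assms(2) by (intro Lnorm_cong_AE[OF m _ ae]) (auto simp: Lspace_def)
qed

lemma W1_weak_gradient:
  assumes "u \<in> W1 \<Omega> s"
  shows "has_weak_gradient \<Omega> u (weak_gradient \<Omega> u)" "weak_gradient \<Omega> u \<in> Lspace \<Omega> s"
  using assms has_weak_gradient_weak_gradient weak_gradient_Lspace(1) unfolding W1_def by blast+

lemma test_function_Lspace: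
  fixes \<phi> :: "'a \<Rightarrow> real"
  assumes \<phi>: "test_function \<Omega> \<phi>" and "0 < s"
  shows "\<phi> \<in> Lspace \<Omega> s" "gradient \<phi> \<in> Lspace \<Omega> s" "\<phi> \<in> W1 \<Omega> s"
proof -
  obtain B where B: "\<And>x. \<bar>\<phi> x\<bar> \<le> B" "\<And>x. norm (gradient \<phi> x) \<le> B"
    by (rule test_function_bounded[OF \<phi>]) blast
  have c: "continuous_on UNIV \<phi>" "continuous_on UNIV (gradient \<phi>)"
    using test_function_continuous[OF \<phi>] by auto
  show 1: "\<phi> \<in> Lspace \<Omega> s" "gradient \<phi> \<in> Lspace \<Omega> s"
    using B by (auto intro!: bounded_in_Lspace[of _ B] measurable_restrict_space1 borel_measurable_continuous_lebesgue c assms)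
  show "\<phi> \<in> W1 \<Omega> s"
    using 1 smooth_has_weak_gradient[OF open_dom test_function_smooth[OF \<phi>]] by (auto simp: W1_def)
qed

lemma test_function_W1_0:
  assumes \<phi>: "test_function \<Omega> \<phi>" and "0 < s"
  shows "\<phi> \<in> W1_0 \<Omega> s"
proof -
  have "has_weak_gradient \<Omega> (\<lambda>x. 0) (gradient (\<lambda>x. 0))"
    by (rule smooth_has_weak_gradient[OF open_dom smooth_const])
  moreover have "gradient (\<lambda>x::'a. 0) = (\<lambda>x. 0)"
    by (auto intro!: gradient_eqI)
  ultimately have "Lnorm \<Omega> s (weak_gradient \<Omega> (\<lambda>x. 0)) = Lnorm \<Omega> s (\<lambda>x. 0::'a)"
    using assms(2) by (intro weak_gradient_Lspace(2)) (auto simp: Lspace_def)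
  then have "W1_norm \<Omega> s (\<lambda>x. \<phi> x - \<phi> x) = 0"
    by (simp add: W1_norm_def Lnorm_def)
  then show ?thesis
    using test_function_Lspace(3)[OF \<phi> assms(2)] \<phi> by (auto simp: W1_0_def intro!: exI[of _ "\<lambda>n. \<phi>"])
qed

lemma test_function_X_space:
  assumes "test_function \<Omega> \<phi>" "0 < p"
  shows "\<phi> \<in> X_space \<Omega> p q"
  using assms test_function_W1_0[OF assms(1), of "max p q"]
  by (auto simp: X_space_def test_function_continuous)

lemma Lnorm_weak_gradient_test_function:
  assumes "test_function \<Omega> \<phi>" "0 < s"
  shows "Lnorm \<Omega> s (weak_gradient \<Omega> \<phi>) = Lnorm \<Omega> s (gradient \<phi>)"
  by (rule weak_gradient_Lspace(2)[OF smooth_has_weak_gradient[OF open_dom]])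
     (use assms in \<open>auto intro: test_function_smooth test_function_Lspace\<close>)

lemma Lnorm_test_function_eq:
  fixes \<phi> :: "'a \<Rightarrow> real"
  assumes \<phi>: "test_function \<Omega> \<phi>" and "0 < s"
  shows "Lnorm \<Omega> s (gradient \<phi>) = integral\<^sup>L lborel (\<lambda>z. norm (gradient \<phi> z) powr s) powr (1 / s)"
proof -
  obtain K where K: "compact K" "\<And>x. x \<notin> K \<Longrightarrow> gradient \<phi> x = 0"
    by (rule test_function_support[OF \<phi>]) blast
  have c: "continuous_on UNIV (\<lambda>z. norm (gradient \<phi> z) powr s)"
    using assms(2) test_function_continuous[OF \<phi>, of UNIV] by (intro continuous_on_powr' continuous_intros) auto
  have "integral\<^sup>L (lebesgue_on \<Omega>) (\<lambda>z. norm (gradient \<phi> z) powr s) = integral\<^sup>L lebesgue (\<lambda>z. norm (gradient \<phi> z) powr s)"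
    by (rule integral_lebesgue_on_zero_outside[OF sets_dom]) (simp add: test_function_outside[OF \<phi>])
  also have "\<dots> = integral\<^sup>L lborel (\<lambda>z. norm (gradient \<phi> z) powr s)"
    by (rule integrable_compact_support(3)[OF c K(1)]) (simp add: K(2))
  finally show ?thesis by (simp add: Lnorm_def)
qed

text \<open>The extension by 0 makes Morrey's inequality on the whole space applicable to every pair
  of points, including pairs whose segment leaves \<Omega>.\<close>

definition zero_ext :: "('a \<Rightarrow> real) \<Rightarrow> 'a \<Rightarrow> real" where
  "zero_ext u x = (if x \<in> \<Omega> then u x else 0)"

text \<open>The approximating test functions satisfy the inequality, and their gradient norms are at
  most \<open>G + c * d n\<close> with \<open>d\<close> tending to 0. A subsequence converges to
  \<open>u\<close> almost everywhere in \<Omega>, hence on a dense set, and the estimate survives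
  the limit there; continuity of \<open>u\<close> extends it to all points.\<close>

lemma W1_0_morrey:
  assumes u: "u \<in> W1_0 \<Omega> s" and cu: "continuous_on (closure \<Omega>) u" and m: "real DIM('a) < m" "m \<le> s"
  shows "\<bar>zero_ext u x - zero_ext u y\<bar> \<le> morrey_const (real DIM('a)) m (norm (x - y)) * Lnorm \<Omega> m (weak_gradient \<Omega> u)"
    and "x \<in> frontier \<Omega> \<Longrightarrow> u x = 0"
proof -
  let ?g = "weak_gradient \<Omega> u" and ?M = "lebesgue_on \<Omega>"
  have m0: "1 \<le> m" "0 < m" "0 < s" "0 < (real DIM('a))" using m ndim_ge_1 by linarith+
  obtain \<phi> where \<phi>: "\<And>n::nat. test_function \<Omega> (\<phi> n)" and lim: "(\<lambda>n. W1_norm \<Omega> s (\<lambda>x. u x - \<phi> n x)) \<longlonglongrightarrow> 0"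
    using u unfolding W1_0_def by blast
  have uW: "u \<in> W1 \<Omega> s" using u by (simp add: W1_0_def)
  note wg = W1_weak_gradient[OF uW]
  have \<phi>m: "test_function UNIV (\<phi> n)" for n using test_function_mono[OF \<phi>] by simp
  have w\<phi>: "has_weak_gradient \<Omega> (\<phi> n) (gradient (\<phi> n))" for n
    by (rule smooth_has_weak_gradient[OF open_dom test_function_smooth[OF \<phi>]])
  have diff_L: "(\<lambda>x. ?g x - gradient (\<phi> n) x) \<in> Lspace \<Omega> s" for n
    using Lspace_add[OF _ wg(2) Lspace_scaleR[OF test_function_Lspace(2)[OF \<phi> m0(3)], of "-1" n]] m0 m by simp
  have wdiff: "has_weak_gradient \<Omega> (\<lambda>x. u x - \<phi> n x) (\<lambda>x. ?g x - gradient (\<phi> n) x)" for n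
    by (rule has_weak_gradient_diff[OF open_dom wg(1) w\<phi>])
  define G where "G = Lnorm \<Omega> m ?g"
  define d where "d n = Lnorm \<Omega> s (\<lambda>x. ?g x - gradient (\<phi> n) x)" for n
  have W: "W1_norm \<Omega> s (\<lambda>x. u x - \<phi> n x) = Lnorm \<Omega> s (\<lambda>x. u x - \<phi> n x) + d n" for n
    using weak_gradient_Lspace(2)[OF wdiff diff_L, of n] by (simp add: W1_norm_def d_def)
  have d0: "d \<longlonglongrightarrow> 0"
    by (rule tendsto_sandwich[OF _ _ tendsto_const lim])
       (auto simp: W d_def Lnorm_nonneg intro!: always_eventually)
  have u0: "(\<lambda>n. Lnorm \<Omega> s (\<lambda>x. u x - \<phi> n x)) \<longlonglongrightarrow> 0"
    by (rule tendsto_sandwich[OF _ _ tendsto_const lim])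
       (auto simp: W d_def Lnorm_nonneg intro!: always_eventually)
  define c where "c = vol powr (1 / m - 1 / s)"
  have G\<phi>: "Lnorm \<Omega> m (gradient (\<phi> n)) \<le> G + c * d n" for n
  proof -
    have gm: "?g \<in> Lspace \<Omega> m" "(\<lambda>x. ?g x - gradient (\<phi> n) x) \<in> Lspace \<Omega> m"
      using Lspace_mono_exponent[OF lmeasurable_dom vol_pos m0(2) m(2)] wg(2) diff_L by auto
    have "Lnorm \<Omega> m (gradient (\<phi> n)) = Lnorm \<Omega> m (\<lambda>x. ?g x + (-1) *\<^sub>R (?g x - gradient (\<phi> n) x))"
      by simp
    also have "\<dots> \<le> G + Lnorm \<Omega> m (\<lambda>x. (-1) *\<^sub>R (?g x - gradient (\<phi> n) x))"
      unfolding G_def by (rule Lnorm_triangle[OF m0(1) gm(1) Lspace_scaleR[OF gm(2)]])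
    also have "\<dots> = G + Lnorm \<Omega> m (\<lambda>x. ?g x - gradient (\<phi> n) x)"
      by (simp only: Lnorm_scaleR[OF m0(2)] abs_minus_cancel abs_one mult_1)
    also have "\<dots> \<le> G + c * d n"
      using Lnorm_mono_exponent[OF lmeasurable_dom vol_pos m0(2) m(2) diff_L] by (simp add: c_def d_def)
    finally show ?thesis .
  qed
  have mor: "\<bar>\<phi> n x - \<phi> n y\<bar> \<le> morrey_const (real DIM('a)) m (norm (x - y)) * (G + c * d n)" for n x y
  proof -
    have "\<bar>\<phi> n x - \<phi> n y\<bar> \<le> morrey_const (real DIM('a)) m (norm (x - y)) * Lnorm \<Omega> m (gradient (\<phi> n))"
      using morrey_test_function[OF \<phi>m m(1), of n x y] Lnorm_test_function_eq[OF \<phi> m0(2)] by simp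
    also have "\<dots> \<le> morrey_const (real DIM('a)) m (norm (x - y)) * (G + c * d n)"
      by (intro mult_left_mono G\<phi> morrey_const_nonneg) (use m m0 in auto)
    finally show ?thesis .
  qed
  have mL: "(\<lambda>x. u x - \<phi> n x) \<in> Lspace \<Omega> s" for n
    using Lspace_add[of s u \<Omega> "\<lambda>x. (-1) *\<^sub>R \<phi> n x"] Lspace_scaleR[OF test_function_Lspace(1)[OF \<phi> m0(3)], of "-1" n] uW m0 m
    by (auto simp: W1_def)
  have "(\<lambda>n. integral\<^sup>L ?M (\<lambda>x. norm (norm (u x - \<phi> n x) powr s))) \<longlonglongrightarrow> 0"
  proof -
    have "(\<lambda>n. Lnorm \<Omega> s (\<lambda>x. u x - \<phi> n x) powr s) \<longlonglongrightarrow> 0 powr s"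
      using m0 by (intro tendsto_powr' u0 tendsto_const) (auto simp: Lnorm_nonneg)
    then show ?thesis using m0 by (simp add: Lnorm_powr)
  qed
  then obtain r where r: "strict_mono r" "AE x in ?M. (\<lambda>n. norm (u x - \<phi> (r n) x) powr s) \<longlonglongrightarrow> 0"
    using tendsto_L1_AE_subseq[of ?M "\<lambda>n x. norm (u x - \<phi> n x) powr s"] mL by (auto simp: Lspace_def)
  define E where "E = {x \<in> \<Omega>. (\<lambda>n. \<phi> (r n) x) \<longlonglongrightarrow> u x}"
  have "AE x in ?M. x \<in> \<Omega> \<longrightarrow> x \<in> E"
    using r(2)
  proof eventually_elim
    case (elim x)
    have "(\<lambda>n. (norm (u x - \<phi> (r n) x) powr s) powr (1 / s)) \<longlonglongrightarrow> 0 powr (1 / s)"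
      using m0 by (intro tendsto_powr' elim tendsto_const) auto
    then have "(\<lambda>n. norm (u x - \<phi> (r n) x)) \<longlonglongrightarrow> 0"
      using m0 by (simp add: powr_powr)
    then have "(\<lambda>n. u x - (u x - \<phi> (r n) x)) \<longlonglongrightarrow> u x - 0"
      by (intro tendsto_diff tendsto_const tendsto_norm_zero_cancel[of "\<lambda>n. u x - \<phi> (r n) x"])
    then show ?case by (simp add: E_def)
  qed
  then have "AE x in ?M. x \<in> closure E"
    unfolding AE_dom_iff by eventually_elim (use closure_subset in blast)
  then have dense: "closure \<Omega> \<subseteq> closure E"
    by (rule closed_AE[OF closed_closure])
  \<comment> \<open>Points outside \<Omega> belong to \<open>T\<close> because all test functions
    vanish there. This lets a boundary point be compared with points of \<open>E\<close>, which
    yields the boundary values 0.\<close>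
  define T where "T = E \<union> - \<Omega>"
  have limT: "(\<lambda>n. \<phi> (r n) x) \<longlonglongrightarrow> zero_ext u x" if "x \<in> T" for x
    using that test_function_outside(1)[OF \<phi>, of x] by (auto simp: T_def E_def zero_ext_def)
  have T: "\<bar>zero_ext u x - zero_ext u y\<bar> \<le> morrey_const (real DIM('a)) m (norm (x - y)) * G" if "x \<in> T" "y \<in> T" for x y
  proof (rule LIMSEQ_le)
    show "(\<lambda>n. \<bar>\<phi> (r n) x - \<phi> (r n) y\<bar>) \<longlonglongrightarrow> \<bar>zero_ext u x - zero_ext u y\<bar>"
      using that by (intro tendsto_intros limT)
    have "(\<lambda>n. morrey_const (real DIM('a)) m (norm (x - y)) * (G + c * d (r n))) \<longlonglongrightarrow> morrey_const (real DIM('a)) m (norm (x - y)) * (G + c * 0)"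
      using LIMSEQ_subseq_LIMSEQ[OF d0 r(1)] by (intro tendsto_intros) (simp add: comp_def)
    then show "(\<lambda>n. morrey_const (real DIM('a)) m (norm (x - y)) * (G + c * d (r n))) \<longlonglongrightarrow> morrey_const (real DIM('a)) m (norm (x - y)) * G"
      by simp
  qed (use mor in auto)
  have seqE: "\<exists>f. (\<forall>n. f n \<in> E) \<and> f \<longlonglongrightarrow> x \<and> (\<lambda>n. u (f n)) \<longlonglongrightarrow> u x" if x: "x \<in> closure \<Omega>" for x
  proof -
    obtain f where f: "\<And>n. f n \<in> E" "f \<longlonglongrightarrow> x"
      using x dense by (metis closure_sequential subsetD)
    moreover have "f n \<in> closure \<Omega>" for n using f(1)[of n] closure_subset[of \<Omega>] by (auto simp: E_def)
    ultimately have "(\<lambda>n. u (f n)) \<longlonglongrightarrow> u x"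
      using continuous_on_tendsto_compose[OF cu f(2) x] by simp
    with f show ?thesis by blast
  qed
  show fr: "u x = 0" if "x \<in> frontier \<Omega>" for x
  proof -
    have x: "x \<in> closure \<Omega>" "x \<notin> \<Omega>"
      using that open_dom by (auto simp: frontier_def interior_open)
    obtain f where f: "\<And>n. f n \<in> E" "f \<longlonglongrightarrow> x" "(\<lambda>n. u (f n)) \<longlonglongrightarrow> u x"
      using seqE[OF x(1)] by blast
    have lim0: "(\<lambda>n. morrey_const (real DIM('a)) m (norm (f n - x)) * G) \<longlonglongrightarrow> morrey_const (real DIM('a)) m 0 * G"
      using f(2) m m0 by (intro tendsto_intros morrey_const_tendsto_const) (auto intro: tendsto_norm_zero simp: LIM_zero)
    have "\<forall>n. norm (u (f n)) \<le> morrey_const (real DIM('a)) m (norm (f n - x)) * G"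
      using T[of "f _" x] f(1) x(2) by (auto simp: T_def zero_ext_def E_def)
    then have "(\<lambda>n. u (f n)) \<longlonglongrightarrow> 0"
      by (rule Lim_null_comparison[OF always_eventually lim0[unfolded morrey_const_0 mult_zero_left]])
    with f(3) show ?thesis using LIMSEQ_unique by blast
  qed
  have seqT: "\<exists>f. (\<forall>n. f n \<in> T) \<and> f \<longlonglongrightarrow> x \<and> (\<lambda>n. zero_ext u (f n)) \<longlonglongrightarrow> zero_ext u x" for x
  proof (cases "x \<in> \<Omega>")
    case True
    then obtain f where f: "\<And>n. f n \<in> E" "f \<longlonglongrightarrow> x" "(\<lambda>n. u (f n)) \<longlonglongrightarrow> u x"
      using seqE[of x] closure_subset by blast
    moreover have "zero_ext u (f n) = u (f n)" for n using f(1)[of n] by (simp add: E_def zero_ext_def)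
    ultimately show ?thesis using True by (intro exI[of _ f]) (auto simp: zero_ext_def T_def)
  next
    case False
    then show ?thesis by (intro exI[of _ "\<lambda>n. x"]) (auto simp: T_def)
  qed
  obtain f where f: "\<And>n. f n \<in> T" "f \<longlonglongrightarrow> x" "(\<lambda>n. zero_ext u (f n)) \<longlonglongrightarrow> zero_ext u x"
    using seqT by blast
  obtain h where h: "\<And>n. h n \<in> T" "h \<longlonglongrightarrow> y" "(\<lambda>n. zero_ext u (h n)) \<longlonglongrightarrow> zero_ext u y"
    using seqT by blast
  show "\<bar>zero_ext u x - zero_ext u y\<bar> \<le> morrey_const (real DIM('a)) m (norm (x - y)) * Lnorm \<Omega> m ?g"
    unfolding G_def[symmetric]
  proof (rule LIMSEQ_le)
    show "(\<lambda>n. \<bar>zero_ext u (f n) - zero_ext u (h n)\<bar>) \<longlonglongrightarrow> \<bar>zero_ext u x - zero_ext u y\<bar>"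
      by (intro tendsto_intros f h)
    show "(\<lambda>n. morrey_const (real DIM('a)) m (norm (f n - h n)) * G) \<longlonglongrightarrow> morrey_const (real DIM('a)) m (norm (x - y)) * G"
      using m m0 by (intro tendsto_intros morrey_const_tendsto_const f h) auto
  qed (use T f h in auto)
qed

subsection \<open>The distance to the boundary\<close>

lemma compact_closure_dom: "compact (closure \<Omega>)"
  using bounded_dom by (simp add: compact_closure)

lemma frontier_nonempty: "frontier \<Omega> \<noteq> {}"
  using nonempty_dom bounded_dom not_bounded_UNIV by (auto simp: frontier_eq_empty)

lemma frontier_not_in_dom: "x \<in> frontier \<Omega> \<Longrightarrow> x \<notin> \<Omega>"
  using open_dom by (auto simp: frontier_def interior_open)

lemma closure_cases: "x \<in> closure \<Omega> \<Longrightarrow> x \<in> \<Omega> \<or> x \<in> frontier \<Omega>"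
  using open_dom by (auto simp: frontier_def interior_open)

lemma bdist_nearest: obtains y where "y \<in> frontier \<Omega>" "bdist \<Omega> x = dist x y"
  using infdist_attains_inf[OF frontier_closed frontier_nonempty] unfolding bdist_def by blast

lemma bdist_le_dist: "y \<in> frontier \<Omega> \<Longrightarrow> bdist \<Omega> x \<le> dist x y"
  unfolding bdist_def by (rule infdist_le)

lemma bdist_nonneg: "0 \<le> bdist \<Omega> x"
  by (simp add: bdist_def infdist_nonneg)

lemma bdist_frontier: "x \<in> frontier \<Omega> \<Longrightarrow> bdist \<Omega> x = 0"
  by (simp add: bdist_def)

lemma bdist_pos: "x \<in> \<Omega> \<Longrightarrow> 0 < bdist \<Omega> x"
  using frontier_not_in_dom in_closed_iff_infdist_zero[OF frontier_closed frontier_nonempty] bdist_nonneg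
  by (metis bdist_def less_le)

lemma continuous_bdist: "continuous_on S (bdist \<Omega>)"
  unfolding bdist_def[abs_def] by (intro continuous_intros)

text \<open>A segment from \<Omega> to its complement meets the frontier, at a distance no larger
  than its length.\<close>

lemma in_dom_of_dist_less_bdist:
  assumes "x \<in> \<Omega>" "dist x z < bdist \<Omega> x"
  shows "z \<in> \<Omega>"
proof (rule ccontr)
  assume "z \<notin> \<Omega>"
  then have "closed_segment x z \<inter> frontier \<Omega> \<noteq> {}"
    using assms(1) by (intro connected_Int_frontier connected_segment) auto
  then obtain w where w: "w \<in> closed_segment x z" "w \<in> frontier \<Omega>" by blast
  then have "dist x w \<le> dist x z"
    using segment_bound(1)[OF w(1)] by (simp add: dist_norm norm_minus_commute)
  with bdist_le_dist[OF w(2), of x] assms(2) show False by linarith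
qed

lemma compl_nonempty: "- \<Omega> \<noteq> {}"
  by (metis bounded_dom not_bounded_UNIV Compl_empty_eq double_complement)

text \<open>The distance to a fixed set is 1-Lipschitz on the whole space; this identity carries the
  property over to the zero extension of \<open>bdist\<close>.\<close>

lemma zero_ext_bdist: "zero_ext (bdist \<Omega>) x = infdist x (- \<Omega>)"
proof (cases "x \<in> \<Omega>")
  case True
  obtain y where y: "y \<in> - \<Omega>" "infdist x (- \<Omega>) = dist x y"
    using infdist_attains_inf[of "- \<Omega>" x] open_dom compl_nonempty by (auto simp: closed_Compl)
  then have "bdist \<Omega> x \<le> infdist x (- \<Omega>)"
    using in_dom_of_dist_less_bdist[OF True, of y] by force
  moreover have "infdist x (- \<Omega>) \<le> bdist \<Omega> x"
    unfolding bdist_def using frontier_not_in_dom frontier_nonempty by (intro infdist_mono) auto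
  ultimately show ?thesis using True by (simp add: zero_ext_def)
qed (simp add: zero_ext_def)

definition inradius :: real where "inradius = (SUP x\<in>closure \<Omega>. bdist \<Omega> x)"

lemma bdist_le_inradius: "x \<in> closure \<Omega> \<Longrightarrow> bdist \<Omega> x \<le> inradius"
  unfolding inradius_def
  by (rule cSUP_upper, assumption)
     (intro bounded_imp_bdd_above compact_imp_bounded compact_continuous_image continuous_bdist compact_closure_dom)

lemma inradius_attained: obtains x where "x \<in> \<Omega>" "bdist \<Omega> x = inradius"
proof -
  have "closure \<Omega> \<noteq> {}" using nonempty_dom by simp
  then obtain x where x: "x \<in> closure \<Omega>" "\<And>y. y \<in> closure \<Omega> \<Longrightarrow> bdist \<Omega> y \<le> bdist \<Omega> x"
    using continuous_attains_sup[OF compact_closure_dom _ continuous_bdist] by metis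
  have eq: "bdist \<Omega> x = inradius"
  proof (rule antisym[OF bdist_le_inradius[OF x(1)]])
    show "inradius \<le> bdist \<Omega> x"
      unfolding inradius_def using nonempty_dom x(2) by (intro cSUP_least) auto
  qed
  obtain z where z: "z \<in> \<Omega>" using nonempty_dom by blast
  have "0 < bdist \<Omega> x"
    using bdist_pos[OF z] x(2)[of z] closure_subset z by force
  then have "x \<in> \<Omega>" using closure_cases[OF x(1)] bdist_frontier by force
  from that[OF this eq] show thesis .
qed

lemma inradius_pos: "0 < inradius"
  using inradius_attained bdist_pos by metis

subsection \<open>The space of essentially bounded functions\<close>

text \<open>Over a null set every bound would hold almost everywhere, even a negative one; the
  positive measure of \<Omega> excludes this.\<close>

lemma esssup_norm_nonneg:
  fixes f :: "'a \<Rightarrow> 'b::euclidean_space"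
  shows "0 \<le> esssup (lebesgue_on \<Omega>) (\<lambda>x. ereal (norm (f x)))"
proof (rule ccontr)
  assume neg: "\<not> 0 \<le> esssup (lebesgue_on \<Omega>) (\<lambda>x. ereal (norm (f x)))"
  have "AE x in lebesgue_on \<Omega>. ereal (norm (f x)) \<le> esssup (lebesgue_on \<Omega>) (\<lambda>x. ereal (norm (f x)))"
    by (rule esssup_AE)
  then have "AE x in lebesgue_on \<Omega>. False"
  proof eventually_elim
    case (elim x)
    have "(0::ereal) \<le> ereal (norm (f x))" by simp
    with elim neg show ?case using order_trans by blast
  qed
  then have "ae_filter (lebesgue_on \<Omega>) = bot"
    by (simp add: trivial_limit_def)
  then show False using emeasure_dom by (simp add: ae_filter_eq_bot_iff)
qed

lemma Linf_norm_nonneg: "0 \<le> Linf_norm \<Omega> f"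
  unfolding Linf_norm_def by (rule real_of_ereal_pos[OF esssup_norm_nonneg])

lemma Linf_norm_AE:
  assumes "f \<in> Linf_space \<Omega>"
  shows "AE x in lebesgue_on \<Omega>. norm (f x) \<le> Linf_norm \<Omega> f"
proof -
  let ?e = "esssup (lebesgue_on \<Omega>) (\<lambda>x. ereal (norm (f x)))"
  have "?e < \<infinity>" using assms by (simp add: Linf_space_def)
  then have e: "?e = ereal (Linf_norm \<Omega> f)"
    using esssup_norm_nonneg[of f] unfolding Linf_norm_def by (cases ?e) auto
  have "AE x in lebesgue_on \<Omega>. ereal (norm (f x)) \<le> ?e" by (rule esssup_AE)
  then show ?thesis unfolding e by simp
qed

lemma Linf_spaceI:
  assumes "f \<in> borel_measurable (lebesgue_on \<Omega>)" "AE x in lebesgue_on \<Omega>. norm (f x) \<le> M"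
  shows "f \<in> Linf_space \<Omega>" "Linf_norm \<Omega> f \<le> M"
proof -
  let ?e = "esssup (lebesgue_on \<Omega>) (\<lambda>x. ereal (norm (f x)))"
  have "?e \<le> ereal M"
    using assms by (intro esssup_I) (auto intro!: borel_measurable_ereal borel_measurable_norm)
  then show "f \<in> Linf_space \<Omega>" "Linf_norm \<Omega> f \<le> M"
    using assms(1) esssup_norm_nonneg[of f] by (cases ?e; auto simp: Linf_space_def Linf_norm_def)+
qed

lemma measurable_continuous_dom:
  fixes f :: "'a \<Rightarrow> 'b::euclidean_space"
  shows "continuous_on \<Omega> f \<Longrightarrow> f \<in> borel_measurable (lebesgue_on \<Omega>)"
  by (rule locally_integrable_imp_measurable[OF open_dom locally_integrable_continuous])

lemma Linf_norm_continuous: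
  fixes f :: "'a \<Rightarrow> real"
  assumes c: "continuous_on (closure \<Omega>) f"
  shows "f \<in> Linf_space \<Omega>" "x \<in> closure \<Omega> \<Longrightarrow> \<bar>f x\<bar> \<le> Linf_norm \<Omega> f"
    and "(\<And>x. x \<in> \<Omega> \<Longrightarrow> \<bar>f x\<bar> \<le> M) \<Longrightarrow> Linf_norm \<Omega> f \<le> M"
proof -
  have c': "continuous_on \<Omega> f" using c closure_subset by (rule continuous_on_subset)
  note m = measurable_continuous_dom[OF c']
  have le: "f \<in> Linf_space \<Omega>" "Linf_norm \<Omega> f \<le> M" if "\<And>x. x \<in> \<Omega> \<Longrightarrow> \<bar>f x\<bar> \<le> M" for M
    by (rule Linf_spaceI[OF m]; use that in \<open>auto simp: AE_dom_iff\<close>)+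
  then show "(\<And>x. x \<in> \<Omega> \<Longrightarrow> \<bar>f x\<bar> \<le> M) \<Longrightarrow> Linf_norm \<Omega> f \<le> M" by blast
  obtain B where "\<And>x. x \<in> closure \<Omega> \<Longrightarrow> norm (f x) \<le> B"
    using compact_imp_bounded[OF compact_continuous_image[OF c compact_closure_dom]] by (auto simp: bounded_iff)
  then show L: "f \<in> Linf_space \<Omega>" using le(1)[of B] closure_subset by auto
  have "\<bar>f x\<bar> \<le> Linf_norm \<Omega> f" if x: "x \<in> \<Omega>" for x
  proof (rule ccontr)
    assume "\<not> \<bar>f x\<bar> \<le> Linf_norm \<Omega> f"
    \<comment> \<open>The set where the essential bound fails is null and, by continuity, open,
      hence empty.\<close>
    define S where "S = {x \<in> \<Omega>. Linf_norm \<Omega> f < \<bar>f x\<bar>}"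
    have "open (\<Omega> \<inter> (\<lambda>x. \<bar>f x\<bar>) -` {Linf_norm \<Omega> f<..})"
      using c' by (intro continuous_open_preimage open_dom continuous_intros) auto
    also have "\<Omega> \<inter> (\<lambda>x. \<bar>f x\<bar>) -` {Linf_norm \<Omega> f<..} = S" by (auto simp: S_def)
    finally have "open S" .
    moreover have "AE x\<in>S in lebesgue. x \<in> {}"
      using Linf_norm_AE[OF L] unfolding AE_dom_iff by eventually_elim (auto simp: S_def)
    moreover have "x \<in> S" using x \<open>\<not> _\<close> by (simp add: S_def)
    ultimately show False using mem_closed_if_AE_lebesgue_open[of S "{}" x] by auto
  qed
  then show "x \<in> closure \<Omega> \<Longrightarrow> \<bar>f x\<bar> \<le> Linf_norm \<Omega> f"
    using continuous_on_closure_norm_le[OF c, of "Linf_norm \<Omega> f" x] by auto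
qed

lemma Linf_norm_max:
  assumes "continuous_on (closure \<Omega>) f" "\<And>y. y \<in> closure \<Omega> \<Longrightarrow> 0 \<le> f y" "x \<in> max_points \<Omega> f"
  shows "Linf_norm \<Omega> f = f x"
proof (rule antisym)
  have x: "x \<in> closure \<Omega>" "\<And>y. y \<in> closure \<Omega> \<Longrightarrow> f y \<le> f x" using assms(3) by (auto simp: max_points_def)
  show "Linf_norm \<Omega> f \<le> f x"
    using assms(2) x(2) closure_subset[of \<Omega>] by (intro Linf_norm_continuous(3)[OF assms(1)]) (auto simp: subset_iff)
  show "f x \<le> Linf_norm \<Omega> f"
    using Linf_norm_continuous(2)[OF assms(1) x(1)] by simp
qed

text \<open>The hypothesis concerns the zero extension, a compactly supported Lipschitz function on
  the whole space; its weak gradient is then restricted to \<Omega>.\<close>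

lemma W1_inf_of_lipschitz:
  fixes u :: "'a \<Rightarrow> real"
  assumes lip: "\<And>x y. \<bar>zero_ext u x - zero_ext u y\<bar> \<le> L * norm (x - y)"
  shows "u \<in> W1_inf \<Omega>" "Linf_norm \<Omega> (weak_gradient \<Omega> u) \<le> L"
proof -
  have z: "zero_ext u x = 0" if "x \<notin> closure \<Omega>" for x
    using that closure_subset by (auto simp: zero_ext_def)
  obtain g where g: "has_weak_gradient UNIV (zero_ext u) g" "g \<in> borel_measurable lebesgue" "AE x in lebesgue. norm (g x) \<le> L"
    using lipschitz_has_weak_gradient[OF lip compact_closure_dom z] by blast
  have gL: "AE x in lebesgue_on \<Omega>. norm (g x) \<le> L"
    unfolding AE_dom_iff using g(3) by eventually_elim simp
  have eq: "x \<in> \<Omega> \<Longrightarrow> zero_ext u x = u x" for x by (simp add: zero_ext_def)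
  have wg: "has_weak_gradient \<Omega> u g"
    using has_weak_gradient_mono[OF g(1) open_dom open_UNIV] has_weak_gradient_cong[of \<Omega> "zero_ext u" u, OF eq] by simp
  have gS: "g \<in> Linf_space \<Omega>"
    by (rule Linf_spaceI(1)[OF measurable_restrict_space1[OF g(2)] gL])
  have c: "continuous_on S (zero_ext u)" for S by (rule lipschitz_imp_continuous[OF lip])
  have "u \<in> Linf_space \<Omega>"
  proof -
    have "continuous_on \<Omega> u"
      using c[of \<Omega>] by (rule continuous_on_eq) (rule eq)
    moreover obtain B where "\<And>x. x \<in> closure \<Omega> \<Longrightarrow> norm (zero_ext u x) \<le> B"
      using compact_imp_bounded[OF compact_continuous_image[OF c compact_closure_dom]] by (auto simp: bounded_iff)
    then have "x \<in> \<Omega> \<Longrightarrow> norm (u x) \<le> B" for x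
      using eq[of x] closure_subset by (metis subsetD)
    ultimately show ?thesis
      by (intro Linf_spaceI(1)[OF measurable_continuous_dom, of _ B]) (auto simp: AE_dom_iff)
  qed
  with wg gS show "u \<in> W1_inf \<Omega>" by (auto simp: W1_inf_def)
  have m: "weak_gradient \<Omega> u \<in> borel_measurable (lebesgue_on \<Omega>)"
    using has_weak_gradient_weak_gradient[OF wg]
    by (intro locally_integrable_imp_measurable open_dom) (simp add: has_weak_gradient_def)
  have "AE x in lebesgue_on \<Omega>. norm (weak_gradient \<Omega> u x) \<le> L"
    using weak_gradient_AE_eq[OF open_dom wg] gL by eventually_elim simp
  then show "Linf_norm \<Omega> (weak_gradient \<Omega> u) \<le> L" by (rule Linf_spaceI(2)[OF m])
qed

text \<open>The segment from \<open>x\<close> to a nearest boundary point \<open>y\<close> stays in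
  \<Omega> except for its end point. The Lipschitz bound therefore holds on the slightly shorter
  segments to \<open>f n\<close>, and the boundary value 0 is reached in the limit.\<close>

lemma W1_inf_bound_bdist:
  assumes u: "u \<in> W1_inf \<Omega>" "u \<in> C_0 \<Omega>" and x: "x \<in> \<Omega>"
  shows "\<bar>u x\<bar> \<le> Linf_norm \<Omega> (weak_gradient \<Omega> u) * bdist \<Omega> x"
proof -
  define G where "G = Linf_norm \<Omega> (weak_gradient \<Omega> u)"
  obtain g where g: "has_weak_gradient \<Omega> u g" "g \<in> Linf_space \<Omega>"
    using u(1) by (auto simp: W1_inf_def)
  note wg = has_weak_gradient_weak_gradient[OF g(1)]
  have m: "weak_gradient \<Omega> u \<in> borel_measurable (lebesgue_on \<Omega>)"
    using wg by (intro locally_integrable_imp_measurable open_dom) (simp add: has_weak_gradient_def)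
  have "AE x in lebesgue_on \<Omega>. norm (weak_gradient \<Omega> u x) \<le> Linf_norm \<Omega> g"
    using weak_gradient_AE_eq[OF open_dom g(1)] Linf_norm_AE[OF g(2)] by eventually_elim simp
  then have "weak_gradient \<Omega> u \<in> Linf_space \<Omega>" by (rule Linf_spaceI(1)[OF m])
  then have gG: "AE x in lebesgue_on \<Omega>. norm (weak_gradient \<Omega> u x) \<le> G"
    unfolding G_def by (rule Linf_norm_AE)
  have G: "0 \<le> G" by (simp add: G_def Linf_norm_nonneg)
  have cu: "continuous_on (closure \<Omega>) u" and u0: "\<And>y. y \<in> frontier \<Omega> \<Longrightarrow> u y = 0"
    using u(2) by (auto simp: C_0_def)
  have cu': "continuous_on \<Omega> u" using cu closure_subset by (rule continuous_on_subset)
  obtain y where y: "y \<in> frontier \<Omega>" "bdist \<Omega> x = dist x y" by (rule bdist_nearest)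
  have ne: "0 < dist x y" using bdist_pos[OF x] y by simp
  define f where "f n = x + (1 - inverse (real (Suc n))) *\<^sub>R (y - x)" for n
  have t: "0 \<le> 1 - inverse (real (Suc n))" "1 - inverse (real (Suc n)) < 1" for n by (auto simp: field_simps)
  have fx: "dist x (f n) < dist x y" for n
  proof -
    have "dist x (f n) = (1 - inverse (real (Suc n))) * dist x y"
      using t(1)[of n] by (simp add: f_def dist_norm norm_minus_commute)
    also have "\<dots> < 1 * dist x y" by (rule mult_strict_right_mono[OF t(2) ne])
    finally show ?thesis by simp
  qed
  have f\<Omega>: "f n \<in> \<Omega>" for n
    by (rule in_dom_of_dist_less_bdist[OF x]) (use fx y in simp)
  have bound: "\<bar>u x - u (f n)\<bar> \<le> G * bdist \<Omega> x" for n
  proof -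
    have "closed_segment x (f n) \<subseteq> \<Omega>"
    proof
      fix w assume "w \<in> closed_segment x (f n)"
      then have "dist x w \<le> dist x (f n)"
        using segment_bound(1) by (metis dist_norm norm_minus_commute)
      then show "w \<in> \<Omega>"
        using fx[of n] y(2) by (intro in_dom_of_dist_less_bdist[OF x]) linarith
    qed
    then have "\<bar>u x - u (f n)\<bar> \<le> G * norm (x - f n)"
      by (rule weak_gradient_lipschitz_on_segment[OF open_dom cu' wg gG G])
    also have "\<dots> \<le> G * bdist \<Omega> x"
      using fx[of n] y(2) by (intro mult_left_mono G) (simp add: dist_norm)
    finally show ?thesis .
  qed
  have "f \<longlonglongrightarrow> x + (1 - 0) *\<^sub>R (y - x)"
    unfolding f_def by (intro tendsto_intros LIMSEQ_inverse_real_of_nat)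
  then have "(\<lambda>n. u (f n)) \<longlonglongrightarrow> u y"
    using y(1) f\<Omega> closure_subset
    by (intro continuous_on_tendsto_compose[OF cu]) (auto simp: frontier_def intro!: always_eventually)
  then have "(\<lambda>n. \<bar>u x - u (f n)\<bar>) \<longlonglongrightarrow> \<bar>u x - 0\<bar>"
    using u0[OF y(1)] by (intro tendsto_intros) simp
  then have "\<bar>u x - 0\<bar> \<le> G * bdist \<Omega> x"
    by (rule LIMSEQ_le_const2) (use bound in auto)
  then show ?thesis by (simp add: G_def)
qed

lemma bdist_C_0: "bdist \<Omega> \<in> C_0 \<Omega>"
  by (simp add: C_0_def continuous_bdist bdist_frontier)

lemma bdist_W1_inf: "bdist \<Omega> \<in> W1_inf \<Omega>" "Linf_norm \<Omega> (weak_gradient \<Omega> (bdist \<Omega>)) \<le> 1"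
  using W1_inf_of_lipschitz[of "bdist \<Omega>" 1] infdist_triangle_abs[of _ "- \<Omega>"]
  by (auto simp: zero_ext_bdist dist_norm)

lemma Linf_norm_bdist: "Linf_norm \<Omega> (bdist \<Omega>) = inradius"
proof -
  obtain x where x: "x \<in> \<Omega>" "bdist \<Omega> x = inradius" by (rule inradius_attained)
  have "x \<in> max_points \<Omega> (bdist \<Omega>)"
    using x closure_subset bdist_le_inradius by (auto simp: max_points_def)
  with x Linf_norm_max[OF continuous_bdist bdist_nonneg] show ?thesis by metis
qed

lemma Lambda_inf_quotient:
  assumes "u \<in> W1_inf \<Omega>" "u \<in> C_0 \<Omega>" "x \<in> \<Omega>" "u x \<noteq> 0"
  shows "0 < Linf_norm \<Omega> u"
    and "1 / inradius \<le> Linf_norm \<Omega> (weak_gradient \<Omega> u) / Linf_norm \<Omega> u"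
proof -
  have cu: "continuous_on (closure \<Omega>) u" using assms(2) by (auto simp: C_0_def)
  have "\<bar>u x\<bar> \<le> Linf_norm \<Omega> u"
    by (rule Linf_norm_continuous(2)[OF cu]) (use assms(3) closure_subset in auto)
  then show pos: "0 < Linf_norm \<Omega> u" using assms(4) by linarith
  have "Linf_norm \<Omega> u \<le> Linf_norm \<Omega> (weak_gradient \<Omega> u) * inradius"
  proof (rule Linf_norm_continuous(3)[OF cu])
    fix x assume x: "x \<in> \<Omega>"
    have "\<bar>u x\<bar> \<le> Linf_norm \<Omega> (weak_gradient \<Omega> u) * bdist \<Omega> x"
      by (rule W1_inf_bound_bdist[OF assms(1,2) x])
    also have "\<dots> \<le> Linf_norm \<Omega> (weak_gradient \<Omega> u) * inradius"
      using x closure_subset by (intro mult_left_mono bdist_le_inradius Linf_norm_nonneg) auto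
    finally show "\<bar>u x\<bar> \<le> Linf_norm \<Omega> (weak_gradient \<Omega> u) * inradius" .
  qed
  with pos inradius_pos show "1 / inradius \<le> Linf_norm \<Omega> (weak_gradient \<Omega> u) / Linf_norm \<Omega> u"
    by (simp add: field_simps)
qed

lemma Lambda_inf_eq: "Lambda_inf \<Omega> = 1 / inradius"
proof -
  let ?S = "{Linf_norm \<Omega> (weak_gradient \<Omega> u) / Linf_norm \<Omega> u | u.
                         u \<in> W1_inf \<Omega> \<inter> C_0 \<Omega> \<and> (\<exists>x\<in>\<Omega>. u x \<noteq> 0)}"
  obtain x where x: "x \<in> \<Omega>" "bdist \<Omega> x = inradius" by (rule inradius_attained)
  have mem: "Linf_norm \<Omega> (weak_gradient \<Omega> (bdist \<Omega>)) / inradius \<in> ?S"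
    using x inradius_pos bdist_C_0 bdist_W1_inf(1) Linf_norm_bdist by (intro CollectI exI[of _ "bdist \<Omega>"]) force
  have lower: "1 / inradius \<le> r" if "r \<in> ?S" for r
    using that Lambda_inf_quotient(2) by blast
  have "Inf ?S \<le> Linf_norm \<Omega> (weak_gradient \<Omega> (bdist \<Omega>)) / inradius"
    by (rule cInf_lower[OF mem]) (use lower in \<open>auto intro!: bdd_belowI\<close>)
  also have "\<dots> \<le> 1 / inradius"
    using bdist_W1_inf(2) inradius_pos by (intro divide_right_mono) auto
  finally have "Inf ?S \<le> 1 / inradius" .
  moreover have "1 / inradius \<le> Inf ?S"
    using mem lower by (intro cInf_greatest) auto
  ultimately show ?thesis unfolding Lambda_inf_def by (rule antisym)
qed

lemma Lambda_inf_pos: "0 < Lambda_inf \<Omega>"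
  using inradius_pos by (simp add: Lambda_inf_eq)

subsection \<open>Bounds for members of the solution space\<close>

lemma W1_0_sup_bound:
  assumes u: "u \<in> W1_0 \<Omega> s" "continuous_on (closure \<Omega>) u" and m: "real DIM('a) < m" "m \<le> s"
  shows "Linf_norm \<Omega> u \<le> morrey_const (real DIM('a)) m inradius * Lnorm \<Omega> m (weak_gradient \<Omega> u)"
proof (rule Linf_norm_continuous(3)[OF u(2)])
  fix x assume x: "x \<in> \<Omega>"
  obtain y where y: "y \<in> frontier \<Omega>" "bdist \<Omega> x = dist x y" by (rule bdist_nearest)
  have "\<bar>u x\<bar> = \<bar>zero_ext u x - zero_ext u y\<bar>"
    using x frontier_not_in_dom[OF y(1)] by (simp add: zero_ext_def)
  also have "\<dots> \<le> morrey_const (real DIM('a)) m (norm (x - y)) * Lnorm \<Omega> m (weak_gradient \<Omega> u)"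
    by (rule W1_0_morrey(1)[OF u m])
  also have "\<dots> \<le> morrey_const (real DIM('a)) m inradius * Lnorm \<Omega> m (weak_gradient \<Omega> u)"
    using bdist_le_inradius[of x] x closure_subset y(2) m(1)
    by (intro mult_right_mono morrey_const_mono Lnorm_nonneg) (auto simp: dist_norm)
  finally show "\<bar>u x\<bar> \<le> morrey_const (real DIM('a)) m inradius * Lnorm \<Omega> m (weak_gradient \<Omega> u)" .
qed

text \<open>The distance is lowered by \<open>e\<close> and cut off at 0, which makes its support
  compact, and then mollified at radius \<open>e / 2\<close>, which keeps the support inside
  \<Omega>. Both operations preserve the Lipschitz constant 1, and together they cost at most
  \<open>3 / 2 * e\<close> at a point of maximal distance, less than
  \<open>\<delta>\<close>.\<close>

lemma near_maximal_test_function: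
  assumes "0 < \<delta>"
  obtains \<phi> where "test_function \<Omega> \<phi>" "\<And>x. norm (gradient \<phi> x) \<le> 1" "inradius - \<delta> \<le> Linf_norm \<Omega> \<phi>"
proof -
  define e where "e = \<delta> / 2"
  have e: "0 < e" using assms by (simp add: e_def)
  define D where "D x = infdist x (- \<Omega>)" for x
  have D: "\<bar>D x - D y\<bar> \<le> norm (x - y)" for x y
    using infdist_triangle_abs[of x "- \<Omega>" y] by (simp add: D_def dist_norm)
  have cD: "continuous_on UNIV D" unfolding D_def by (intro continuous_intros)
  define f where "f x = max 0 (D x - e)" for x
  have K: "compact {x. k \<le> D x}" "{x. k \<le> D x} \<subseteq> \<Omega>" if "0 < k" for k
  proof -
    have sub: "x \<in> \<Omega>" if "k \<le> D x" for x
      using that \<open>0 < k\<close> by (cases "x \<in> \<Omega>") (auto simp: D_def)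
    then show "{x. k \<le> D x} \<subseteq> \<Omega>" by blast
    have "closed {x. k \<le> D x}"
      using cD by (intro closed_Collect_le continuous_intros) auto
    then show "compact {x. k \<le> D x}"
      using sub bounded_dom by (auto simp: compact_eq_bounded_closed intro: bounded_subset)
  qed
  have "\<bar>f x - f y\<bar> \<le> 1 * norm (x - y)" for x y
    using D[of x y] by (auto simp: f_def)
  moreover have "f x = 0" if "x \<notin> {x. e \<le> D x}" for x
    using that by (auto simp: f_def)
  ultimately obtain \<phi> where \<phi>: "smooth \<phi>" "\<And>x y. \<bar>\<phi> x - \<phi> y\<bar> \<le> 1 * norm (x - y)" "\<And>x. \<bar>\<phi> x - f x\<bar> \<le> 1 * (e / 2)"
    "\<And>x. (\<And>y. y \<in> {x. e \<le> D x} \<Longrightarrow> e / 2 < norm (x - y)) \<Longrightarrow> \<phi> x = 0"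
    using lipschitz_mollify[of f 1 "{x. e \<le> D x}" "e / 2"] K(1)[OF e] e by (metis half_gt_zero)
  have t: "test_function \<Omega> \<phi>"
  proof (rule test_functionI[OF \<phi>(1) K(1,2)[OF half_gt_zero[OF e]]])
    show "\<phi> x = 0" if "x \<notin> {x. e / 2 \<le> D x}" for x
    proof (rule \<phi>(4))
      fix y assume "y \<in> {x. e \<le> D x}"
      then show "e / 2 < norm (x - y)" using that D[of x y] by auto
    qed
  qed
  obtain x where x: "x \<in> \<Omega>" "bdist \<Omega> x = inradius" by (rule inradius_attained)
  have "D x = inradius" using x zero_ext_bdist[of x] by (simp add: D_def zero_ext_def)
  then have "inradius - e \<le> f x" by (simp add: f_def)
  then have "inradius - \<delta> \<le> \<phi> x"
    using \<phi>(3)[of x] assms unfolding abs_le_iff e_def by linarith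
  also have "\<dots> \<le> Linf_norm \<Omega> \<phi>"
    using Linf_norm_continuous(2)[of \<phi> x] smooth_continuous[OF \<phi>(1)] x closure_subset by force
  finally show thesis
    by (intro that[OF t]) (use lipschitz_norm_gradient_le[OF \<phi>(1,2)] in auto)
qed

lemma integral_gradient_le_vol:
  assumes "test_function \<Omega> \<phi>" "\<And>x. norm (gradient \<phi> x) \<le> 1" "0 < s"
  shows "Lnorm \<Omega> s (weak_gradient \<Omega> \<phi>) powr s \<le> vol"
proof -
  have "Lnorm \<Omega> s (weak_gradient \<Omega> \<phi>) powr s = integral\<^sup>L (lebesgue_on \<Omega>) (\<lambda>x. norm (gradient \<phi> x) powr s)"
    using assms by (simp add: Lnorm_weak_gradient_test_function Lnorm_powr)
  also have "\<dots> \<le> integral\<^sup>L (lebesgue_on \<Omega>) (\<lambda>x. 1)"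
  proof (rule integral_mono)
    show "integrable (lebesgue_on \<Omega>) (\<lambda>x. norm (gradient \<phi> x) powr s)"
      using test_function_Lspace(2)[OF assms(1,3)] by (simp add: Lspace_def)
    show "integrable (lebesgue_on \<Omega>) (\<lambda>x. 1::real)"
      using finite_measure.integrable_const[OF finite_measure_dom] .
    show "norm (gradient \<phi> x) powr s \<le> 1" for x
      using assms(2)[of x] assms(3) powr_mono2[of s "norm (gradient \<phi> x)" 1] by simp
  qed
  also have "\<dots> = vol"
    using sets_dom by (simp add: measure_restrict_space space_restrict_space)
  finally show ?thesis .
qed

end

section \<open>Energy estimates\<close>

lemma le_powr_inverse:
  assumes "0 \<le> b" "0 < s" "b powr s \<le> (X::real)"
  shows "b \<le> X powr (1 / s)"
proof -
  have "(b powr s) powr (1 / s) \<le> X powr (1 / s)"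
    using assms by (intro powr_mono2) auto
  then show ?thesis using assms by (simp add: powr_powr)
qed

lemma powr_inverse_le:
  assumes "0 \<le> b" "0 < s" "0 \<le> X" "(X::real) \<le> b powr s"
  shows "X powr (1 / s) \<le> b"
proof -
  have "X powr (1 / s) \<le> (b powr s) powr (1 / s)"
    using assms by (intro powr_mono2) auto
  then show ?thesis using assms by (simp add: powr_powr)
qed

lemma powr_diff_le_of_le_mult:
  assumes "0 < b" "b powr q \<le> X * b powr (p::real)"
  shows "b powr (q - p) \<le> X"
  using assms by (simp add: powr_diff divide_le_eq)

context bounded_open begin

section \<open>Scaling in the solution space\<close>

lemma scaled_gradient:
  assumes "has_weak_gradient \<Omega> u g" "g \<in> Lspace \<Omega> s" "0 < s"
  shows "Lnorm \<Omega> s (weak_gradient \<Omega> (\<lambda>x. t * u x)) = \<bar>t\<bar> * Lnorm \<Omega> s (weak_gradient \<Omega> u)"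
proof -
  have "Lnorm \<Omega> s (weak_gradient \<Omega> (\<lambda>x. t * u x)) = Lnorm \<Omega> s (\<lambda>x. t *\<^sub>R g x)"
    by (rule weak_gradient_Lspace(2)[OF has_weak_gradient_scaleR[OF open_dom assms(1)] Lspace_scaleR[OF assms(2)]])
  then show ?thesis
    using Lnorm_scaleR[OF assms(3)] weak_gradient_Lspace(2)[OF assms(1,2)] by simp
qed

lemma W1_scale:
  assumes u: "u \<in> W1 \<Omega> s" and "0 < s"
  shows "(\<lambda>x. t * u x) \<in> W1 \<Omega> s"
    and "W1_norm \<Omega> s (\<lambda>x. t * u x) = \<bar>t\<bar> * W1_norm \<Omega> s u"
proof -
  obtain g where g: "has_weak_gradient \<Omega> u g" "g \<in> Lspace \<Omega> s" and uL: "u \<in> Lspace \<Omega> s"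
    using u by (auto simp: W1_def)
  show "(\<lambda>x. t * u x) \<in> W1 \<Omega> s"
    using Lspace_scaleR[OF uL, of t] Lspace_scaleR[OF g(2), of t] has_weak_gradient_scaleR[OF open_dom g(1), of t]
    by (auto simp: W1_def)
  show "W1_norm \<Omega> s (\<lambda>x. t * u x) = \<bar>t\<bar> * W1_norm \<Omega> s u"
    using scaled_gradient[OF g assms(2)] Lnorm_scaleR[OF assms(2), of \<Omega> t u]
    by (simp add: W1_norm_def distrib_left)
qed

lemma W1_diff_test_function:
  assumes u: "u \<in> W1 \<Omega> s" and \<phi>: "test_function \<Omega> \<phi>" and s: "1 \<le> s"
  shows "(\<lambda>x. u x - \<phi> x) \<in> W1 \<Omega> s"
proof -
  obtain g where g: "has_weak_gradient \<Omega> u g" "g \<in> Lspace \<Omega> s" and uL: "u \<in> Lspace \<Omega> s"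
    using u by (auto simp: W1_def)
  have \<phi>L: "\<phi> \<in> Lspace \<Omega> s" "gradient \<phi> \<in> Lspace \<Omega> s"
    using test_function_Lspace[OF \<phi>] s by auto
  show ?thesis
    using Lspace_add[OF s uL Lspace_scaleR[OF \<phi>L(1), of "-1"]] Lspace_add[OF s g(2) Lspace_scaleR[OF \<phi>L(2), of "-1"]]
      has_weak_gradient_diff[OF open_dom g(1) smooth_has_weak_gradient[OF open_dom test_function_smooth[OF \<phi>]]]
    by (auto simp: W1_def)
qed

text \<open>Rays and scaled competitors have to remain in the space; the approximating test
  functions are scaled along.\<close>

lemma X_space_scale:
  assumes u: "u \<in> X_space \<Omega> p q" and p: "1 \<le> p"
  shows "(\<lambda>x. t * u x) \<in> X_space \<Omega> p q"
proof -
  let ?s = "max p q"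
  have s: "1 \<le> ?s" "0 < ?s" using p by auto
  have uW: "u \<in> W1 \<Omega> ?s" and c: "continuous_on (closure \<Omega>) u"
    using u by (auto simp: X_space_def W1_0_def)
  obtain \<phi> where \<phi>: "\<And>n::nat. test_function \<Omega> (\<phi> n)" and lim: "(\<lambda>n. W1_norm \<Omega> ?s (\<lambda>x. u x - \<phi> n x)) \<longlonglongrightarrow> 0"
    using u by (auto simp: X_space_def W1_0_def)
  have "(\<lambda>n. \<bar>t\<bar> * W1_norm \<Omega> ?s (\<lambda>x. u x - \<phi> n x)) \<longlonglongrightarrow> 0"
    using tendsto_mult_right_zero[OF lim] .
  moreover have "W1_norm \<Omega> ?s (\<lambda>x. t * u x - t * \<phi> n x) = \<bar>t\<bar> * W1_norm \<Omega> ?s (\<lambda>x. u x - \<phi> n x)" for n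
    using W1_scale(2)[OF W1_diff_test_function[OF uW \<phi> s(1)] s(2), of t n] by (simp add: right_diff_distrib)
  ultimately have "(\<lambda>n. W1_norm \<Omega> ?s (\<lambda>x. t * u x - t * \<phi> n x)) \<longlonglongrightarrow> 0" by simp
  moreover have "test_function \<Omega> (\<lambda>x. t * \<phi> n x)" for n
    by (rule test_function_mult_left[OF smooth_const \<phi>])
  ultimately have "(\<lambda>x. t * u x) \<in> W1_0 \<Omega> ?s"
    using W1_scale(1)[OF uW s(2)] unfolding W1_0_def by (intro CollectI conjI exI[of _ "\<lambda>n x. t * \<phi> n x"]) auto
  then show ?thesis
    using c by (auto simp: X_space_def intro!: continuous_intros)
qed

lemma X_space_W1_0: "v \<in> X_space \<Omega> p s \<Longrightarrow> v \<in> W1_0 \<Omega> (max p s) \<and> continuous_on (closure \<Omega>) v"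
  by (simp add: X_space_def)

lemma zero_ext_closure:
  assumes v: "\<And>x. x \<in> frontier \<Omega> \<Longrightarrow> v x = 0" and x: "x \<in> closure \<Omega>"
  shows "zero_ext v x = v x"
  using closure_cases[OF x] v by (auto simp: zero_ext_def)

lemma X_space_frontier:
  assumes "v \<in> X_space \<Omega> p s" "real DIM('a) < s" "x \<in> frontier \<Omega>"
  shows "v x = 0"
  using W1_0_morrey(2)[of v "max p s" "max p s" x] X_space_W1_0[OF assms(1)] assms(2,3) by auto

lemma X_space_gradient:
  assumes u: "u \<in> X_space \<Omega> p q" and s: "0 < s" "s \<le> max p q"
  shows "has_weak_gradient \<Omega> u (weak_gradient \<Omega> u)" "weak_gradient \<Omega> u \<in> Lspace \<Omega> s"
proof -
  have "u \<in> W1 \<Omega> (max p q)" using u by (auto simp: X_space_def W1_0_def)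
  note W1_weak_gradient[OF this]
  then show "has_weak_gradient \<Omega> u (weak_gradient \<Omega> u)" "weak_gradient \<Omega> u \<in> Lspace \<Omega> s"
    using Lspace_mono_exponent[OF lmeasurable_dom vol_pos s] by auto
qed

lemma X_space_Lnorm_scale:
  assumes u: "u \<in> X_space \<Omega> p q" and s: "0 < s" "s \<le> max p q" and t: "0 < t"
  shows "Lnorm \<Omega> s (weak_gradient \<Omega> (\<lambda>x. t * u x)) powr s = t powr s * Lnorm \<Omega> s (weak_gradient \<Omega> u) powr s"
  using scaled_gradient[OF X_space_gradient[OF u s] s(1), of t] t
  by (simp add: powr_mult Lnorm_nonneg)

lemma Linf_norm_scale:
  assumes c: "continuous_on (closure \<Omega>) u" and t: "0 < t"
  shows "Linf_norm \<Omega> (\<lambda>x. t * u x) = t * Linf_norm \<Omega> u"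
proof (rule antisym)
  have le: "Linf_norm \<Omega> (\<lambda>x. k * v x) \<le> k * Linf_norm \<Omega> v"
    if c: "continuous_on (closure \<Omega>) v" and k: "0 < k" for k v
  proof (rule Linf_norm_continuous(3))
    show "\<bar>k * v x\<bar> \<le> k * Linf_norm \<Omega> v" if "x \<in> \<Omega>" for x
      using Linf_norm_continuous(2)[OF c, of x] that closure_subset[of \<Omega>] k by (auto simp: abs_mult)
  qed (intro continuous_intros c)
  show "Linf_norm \<Omega> (\<lambda>x. t * u x) \<le> t * Linf_norm \<Omega> u" by (rule le[OF c t])
  have "Linf_norm \<Omega> (\<lambda>x. 1 / t * (t * u x)) \<le> 1 / t * Linf_norm \<Omega> (\<lambda>x. t * u x)"
    by (rule le) (use t c in \<open>auto intro!: continuous_intros\<close>)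
  then show "t * Linf_norm \<Omega> u \<le> Linf_norm \<Omega> (\<lambda>x. t * u x)"
    using t by (simp add: field_simps)
qed

section \<open>Competitors and energy bounds in the two regimes\<close>

abbreviation Kc :: "real \<Rightarrow> real" where "Kc p \<equiv> morrey_const (real DIM('a)) p inradius"

text \<open>
  The competitor depends on \<open>p\<close>: its maximum has to be so close to \<open>inradius\<close> that the \<open>p\<close>-th
  power of their ratio, multiplied by \<open>c\<close>, is still at least \<open>(c + 1) / 2\<close>.
\<close>

lemma competitor:
  assumes c: "1 < c" and p: "0 < p"
  obtains \<phi> where "test_function \<Omega> \<phi>" "\<And>x. norm (gradient \<phi> x) \<le> 1"
    "vol * ((c - 1) / 2) \<le> c * vol * Lambda_inf \<Omega> powr p * Linf_norm \<Omega> \<phi> powr p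
        - Lnorm \<Omega> p (weak_gradient \<Omega> \<phi>) powr p"
proof -
  \<comment> \<open>Chosen so that \<open>c * \<sigma> powr p = (c + 1) / 2\<close>, which exceeds 1
    by the gap \<open>(c - 1) / 2\<close>; the 1 is used up by the gradient integral, which is at
    most \<open>vol\<close>.\<close>
  define \<sigma> where "\<sigma> = ((c + 1) / (2 * c)) powr (1 / p)"
  have "(c + 1) / (2 * c) < 1" using c by simp
  then have \<sigma>: "0 < \<sigma>" "\<sigma> < 1"
    using c p powr_less_mono2[of "1 / p" "(c + 1) / (2 * c)" 1] by (auto simp: \<sigma>_def)
  have \<sigma>p: "\<sigma> powr p = (c + 1) / (2 * c)" using c p by (simp add: \<sigma>_def powr_powr)
  have "0 < inradius * (1 - \<sigma>)" using \<sigma> inradius_pos by simp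
  then obtain \<phi> where \<phi>: "test_function \<Omega> \<phi>" "\<And>x. norm (gradient \<phi> x) \<le> 1"
    "inradius - inradius * (1 - \<sigma>) \<le> Linf_norm \<Omega> \<phi>"
    using near_maximal_test_function by metis
  have "\<sigma> \<le> Lambda_inf \<Omega> * Linf_norm \<Omega> \<phi>"
    using \<phi>(3) inradius_pos by (simp add: Lambda_inf_eq field_simps)
  then have "\<sigma> powr p \<le> (Lambda_inf \<Omega> * Linf_norm \<Omega> \<phi>) powr p"
    using \<sigma> p by (intro powr_mono2) auto
  then have "(c + 1) / (2 * c) \<le> Lambda_inf \<Omega> powr p * Linf_norm \<Omega> \<phi> powr p"
    using Lambda_inf_pos Linf_norm_nonneg by (simp add: \<sigma>p powr_mult)
  then have "c * vol * ((c + 1) / (2 * c)) \<le> c * vol * (Lambda_inf \<Omega> powr p * Linf_norm \<Omega> \<phi> powr p)"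
    using c vol_pos by (intro mult_left_mono) auto
  moreover have "c * vol * ((c + 1) / (2 * c)) = vol * ((c - 1) / 2) + vol"
    using c by (simp add: field_simps)
  moreover have "Lnorm \<Omega> p (weak_gradient \<Omega> \<phi>) powr p \<le> vol"
    by (rule integral_gradient_le_vol[OF \<phi>(1,2) p])
  ultimately have "vol * ((c - 1) / 2) \<le> c * vol * Lambda_inf \<Omega> powr p * Linf_norm \<Omega> \<phi> powr p
        - Lnorm \<Omega> p (weak_gradient \<Omega> \<phi>) powr p"
    by (simp add: mult.assoc)
  with \<phi>(1,2) show thesis by (rule that)
qed

text \<open>The energy along the ray \<open>t * u\<close> is the explicit function \<open>h\<close>,
  which has an interior minimum at \<open>t = 1\<close>; the identity says that its derivative
  vanishes there.\<close>

lemma minimizer_Nehari_identity: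
  assumes pq: "1 \<le> p" "1 \<le> q" and u: "u \<in> X_space \<Omega> p q"
    and min: "\<And>v. v \<in> X_space \<Omega> p q \<Longrightarrow> J_energy \<Omega> p q lam u \<le> J_energy \<Omega> p q lam v"
  shows "Lnorm \<Omega> p (weak_gradient \<Omega> u) powr p + Lnorm \<Omega> q (weak_gradient \<Omega> u) powr q = lam * Linf_norm \<Omega> u powr p"
proof -
  define A where "A = Lnorm \<Omega> p (weak_gradient \<Omega> u) powr p"
  define B where "B = Lnorm \<Omega> q (weak_gradient \<Omega> u) powr q"
  define M where "M = Linf_norm \<Omega> u powr p"
  have c: "continuous_on (closure \<Omega>) u" using u by (simp add: X_space_def)
  define h where "h t = 1 / p * (t powr p * A) + 1 / q * (t powr q * B) - lam / p * (t powr p * M)" for t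
  have hJ: "h t = J_energy \<Omega> p q lam (\<lambda>x. t * u x)" if "0 < t" for t
    using that pq X_space_Lnorm_scale[OF u, of p t] X_space_Lnorm_scale[OF u, of q t] Linf_norm_scale[OF c that]
    by (simp add: h_def J_energy_def A_def B_def M_def powr_mult Linf_norm_nonneg)
  have "(h has_real_derivative A + B - lam * M) (at 1)"
    unfolding h_def using pq by (auto intro!: derivative_eq_intros simp: field_simps)
  moreover have "h 1 \<le> h t" if "\<bar>1 - t\<bar> < 1" for t
    using that min[OF X_space_scale[OF u pq(1)], of t] hJ[of t] hJ[of 1] by simp
  ultimately have "A + B - lam * M = 0"
    using DERIV_local_min[of h "A + B - lam * M" 1 1] by simp
  then show ?thesis by (simp add: A_def B_def M_def)
qed

text \<open>Solves the inequality between \<open>B\<close> and the maximum for \<open>M\<close>,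
  using that \<open>Lambda_inf \<Omega>\<close> is the reciprocal of the inradius.\<close>

lemma lower_bound_max:
  assumes p: "0 < p" and c: "0 < c" and u: "0 \<le> M" and B: "0 \<le> B" "B \<le> c * vol * Lambda_inf \<Omega> powr p * M powr p"
  shows "inradius * (B / (c * vol)) powr (1 / p) \<le> M"
proof -
  have "B / (c * vol) \<le> (M / inradius) powr p"
    using B(2) c vol_pos inradius_pos u by (simp add: Lambda_inf_eq powr_divide field_simps)
  then have "(B / (c * vol)) powr (1 / p) \<le> M / inradius"
    using B c vol_pos inradius_pos u p by (intro powr_inverse_le) auto
  then show ?thesis using inradius_pos by (simp add: field_simps)
qed

text \<open>The energy of \<open>u\<close> is \<open>B * (1 / q - 1 / p)\<close> with a negative
  second factor, so comparison with \<open>t * \<phi>\<close> bounds \<open>B\<close> from below,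
  and \<open>B \<le> lam * M powr p\<close> makes this a lower bound for the maximum. For the upper
  bound, Morrey's and Hoelder's inequalities on the right-hand side bound \<open>b powr q\<close> by
  a multiple of \<open>b powr p\<close>, where \<open>p < q\<close>.\<close>

lemma bounds_superlinear:
  assumes c: "1 < c" and pq: "real DIM('a) < p" "p < q"
    and u: "u \<in> X_space \<Omega> p q"
    and min: "\<And>v. v \<in> X_space \<Omega> p q \<Longrightarrow>
      J_energy \<Omega> p q (c * vol * Lambda_inf \<Omega> powr p) u \<le> J_energy \<Omega> p q (c * vol * Lambda_inf \<Omega> powr p) v"
  defines "\<kappa> \<equiv> (c - 1) / 2"
  shows "Lnorm \<Omega> q (weak_gradient \<Omega> u) \<le> (c * vol * (Kc p / inradius) powr p * vol powr (1 - p / q)) powr (1 / (q - p))"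
    and "inradius * (vol * \<kappa> powr (q / (q - p)) / (c * vol)) powr (1 / p) \<le> Linf_norm \<Omega> u"
proof -
  define lam where "lam = c * vol * Lambda_inf \<Omega> powr p"
  have pos: "0 < p" "0 < q" "1 \<le> p" "1 \<le> q" using pq ndim_ge_1 by linarith+
  have \<kappa>: "0 < \<kappa>" using c by (simp add: \<kappa>_def)
  have cu: "continuous_on (closure \<Omega>) u" and uW: "u \<in> W1_0 \<Omega> q"
    using u pq by (auto simp: X_space_def max_def)
  define A where "A = Lnorm \<Omega> p (weak_gradient \<Omega> u) powr p"
  define b where "b = Lnorm \<Omega> q (weak_gradient \<Omega> u)"
  define B where "B = b powr q"
  define M where "M = Linf_norm \<Omega> u"
  have nn: "0 \<le> A" "0 \<le> b" "0 \<le> B" "0 \<le> M" by (simp_all add: A_def b_def B_def M_def Lnorm_nonneg Linf_norm_nonneg)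
  have neh: "A + B = lam * M powr p"
    using minimizer_Nehari_identity[OF pos(3,4) u min] by (simp add: A_def B_def b_def M_def lam_def)
  have Ju: "J_energy \<Omega> p q lam u = B * (1 / q - 1 / p)"
  proof -
    have "J_energy \<Omega> p q lam u = 1 / p * A + 1 / q * B - 1 / p * (lam * M powr p)"
      by (simp add: J_energy_def A_def B_def b_def M_def)
    then show ?thesis unfolding neh[symmetric] by (simp add: algebra_simps add_divide_distrib diff_divide_distrib)
  qed
  obtain \<phi> where \<phi>: "test_function \<Omega> \<phi>" "\<And>x. norm (gradient \<phi> x) \<le> 1"
    "vol * \<kappa> \<le> lam * Linf_norm \<Omega> \<phi> powr p - Lnorm \<Omega> p (weak_gradient \<Omega> \<phi>) powr p"
    using competitor[OF c pos(1)] unfolding \<kappa>_def lam_def by metis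
  have \<phi>X: "\<phi> \<in> X_space \<Omega> p q" by (rule test_function_X_space[OF \<phi>(1) pos(1)])
  \<comment> \<open>This factor minimizes
    \<open>vol * (t powr q / q - \<kappa> * t powr p / p)\<close>, the upper bound for the energy of
    \<open>t * \<phi>\<close>.\<close>
  define t where "t = \<kappa> powr (1 / (q - p))"
  have t: "0 < t" using \<kappa> by (simp add: t_def)
  have tq: "t powr q = t powr p * \<kappa>"
  proof -
    have "t powr (q - p) = \<kappa>" using \<kappa> pq by (simp add: t_def powr_powr)
    then show ?thesis using t by (metis add.commute diff_add_cancel powr_add mult.commute)
  qed
  have "J_energy \<Omega> p q lam (\<lambda>x. t * \<phi> x) \<le> vol * \<kappa> * t powr p * (1 / q - 1 / p)"
  proof -
    have c\<phi>: "continuous_on (closure \<Omega>) \<phi>" using \<phi>X by (simp add: X_space_def)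
    have "J_energy \<Omega> p q lam (\<lambda>x. t * \<phi> x) =
       1 / q * (t powr q * Lnorm \<Omega> q (weak_gradient \<Omega> \<phi>) powr q)
        - 1 / p * t powr p * (lam * Linf_norm \<Omega> \<phi> powr p - Lnorm \<Omega> p (weak_gradient \<Omega> \<phi>) powr p)"
      using X_space_Lnorm_scale[OF \<phi>X, of p t] X_space_Lnorm_scale[OF \<phi>X, of q t] Linf_norm_scale[OF c\<phi> t] pos t
      by (simp add: J_energy_def powr_mult Linf_norm_nonneg field_simps)
    also have "\<dots> \<le> 1 / q * (t powr q * vol) - 1 / p * t powr p * (vol * \<kappa>)"
      using \<phi>(3) pos integral_gradient_le_vol[OF \<phi>(1,2) pos(2)]
      by (intro diff_mono mult_left_mono) auto
    also have "\<dots> = vol * \<kappa> * t powr p * (1 / q - 1 / p)"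
      by (simp add: tq field_simps)
    finally show ?thesis .
  qed
  moreover have "(\<lambda>x. t * \<phi> x) \<in> X_space \<Omega> p q" by (rule X_space_scale[OF \<phi>X pos(3)])
  ultimately have "B * (1 / q - 1 / p) \<le> vol * \<kappa> * t powr p * (1 / q - 1 / p)"
    using min unfolding lam_def[symmetric] Ju by fastforce
  moreover have "1 / q - 1 / p < 0" using pq pos by (simp add: field_simps)
  ultimately have B: "vol * \<kappa> * t powr p \<le> B"
    by (simp add: mult_le_cancel_right)
  have \<kappa>t: "\<kappa> * t powr p = \<kappa> powr (q / (q - p))"
  proof -
    have "\<kappa> powr (q / (q - p)) = \<kappa> powr (1 + p / (q - p))" using pq by (simp add: field_simps)
    also have "\<dots> = \<kappa> * t powr p" using \<kappa> by (simp add: t_def powr_powr powr_add)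
    finally show ?thesis by simp
  qed
  have "0 < B" using B vol_pos \<kappa> t by (smt (verit) mult_pos_pos powr_gt_zero)
  then have b: "0 < b" using nn(2) pos by (auto simp: B_def less_le)
  have BM: "B \<le> lam * M powr p" using neh nn(1) by linarith
  have "M \<le> Kc p * Lnorm \<Omega> p (weak_gradient \<Omega> u)"
    unfolding M_def using W1_0_sup_bound[OF uW cu pq(1)] pq by simp
  also have "\<dots> \<le> Kc p * (vol powr (1 / p - 1 / q) * b)"
    using Lnorm_mono_exponent[OF lmeasurable_dom vol_pos pos(1) _ X_space_gradient(2)[OF u pos(2)]] pq pos inradius_pos
    by (intro mult_left_mono morrey_const_nonneg) (auto simp: b_def)
  finally have "M powr p \<le> (Kc p * (vol powr (1 / p - 1 / q) * b)) powr p"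
    using nn pos by (intro powr_mono2) auto
  also have "\<dots> = Kc p powr p * (vol powr (1 - p / q) * b powr p)"
    using vol_pos b pos morrey_const_nonneg[of inradius "real DIM('a)" p] inradius_pos pq
    by (simp add: powr_mult powr_powr left_diff_distrib)
  finally have "lam * M powr p \<le> lam * (Kc p powr p * (vol powr (1 - p / q) * b powr p))"
    using c vol_pos by (intro mult_left_mono) (auto simp: lam_def)
  with BM have "b powr q \<le> (c * vol * (Kc p / inradius) powr p * vol powr (1 - p / q)) * b powr p"
    using inradius_pos morrey_const_nonneg[of inradius "real DIM('a)" p] pq ndim_ge_1
    by (simp add: B_def lam_def Lambda_inf_eq powr_divide mult_ac)
  then have "b powr (q - p) \<le> c * vol * (Kc p / inradius) powr p * vol powr (1 - p / q)"
    by (rule powr_diff_le_of_le_mult[OF b])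
  then show "Lnorm \<Omega> q (weak_gradient \<Omega> u) \<le> (c * vol * (Kc p / inradius) powr p * vol powr (1 - p / q)) powr (1 / (q - p))"
    unfolding b_def[symmetric] using pq nn by (intro le_powr_inverse) auto
  show "inradius * (vol * \<kappa> powr (q / (q - p)) / (c * vol)) powr (1 / p) \<le> Linf_norm \<Omega> u"
  proof (rule lower_bound_max[OF pos(1)])
    show "vol * \<kappa> powr (q / (q - p)) \<le> c * vol * Lambda_inf \<Omega> powr p * Linf_norm \<Omega> u powr p"
      using B BM \<kappa>t by (simp add: lam_def M_def mult.assoc)
  qed (use c vol_pos Linf_norm_nonneg in auto)
qed

text \<open>Here \<open>1 / q - 1 / p\<close> is positive and the two bounds exchange their origins:
  minimality bounds \<open>B\<close>, hence the gradient, from above, while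
  \<open>b powr q \<le> X * b powr p\<close> with \<open>q < p\<close> bounds \<open>b\<close> from
  below, which the Nehari identity turns into a lower bound for the maximum. Morrey's inequality is
  used at the exponent \<open>q\<close> directly.\<close>

lemma bounds_sublinear:
  assumes c: "1 < c" and pq: "real DIM('a) < q" "q < p"
    and u: "u \<in> Nehari \<Omega> p q (c * vol * Lambda_inf \<Omega> powr p)"
    and min: "\<And>v. v \<in> Nehari \<Omega> p q (c * vol * Lambda_inf \<Omega> powr p) \<Longrightarrow>
      J_energy \<Omega> p q (c * vol * Lambda_inf \<Omega> powr p) u \<le> J_energy \<Omega> p q (c * vol * Lambda_inf \<Omega> powr p) v"
  defines "\<kappa> \<equiv> (c - 1) / 2"
  shows "Lnorm \<Omega> q (weak_gradient \<Omega> u) \<le> (vol * \<kappa> powr (- q / (p - q))) powr (1 / q)"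
    and "inradius * (((c * vol * (Kc q / inradius) powr p) powr (- q / (p - q))) / (c * vol)) powr (1 / p) \<le> Linf_norm \<Omega> u"
proof -
  define lam where "lam = c * vol * Lambda_inf \<Omega> powr p"
  have lam: "0 < lam" using c vol_pos Lambda_inf_pos by (simp add: lam_def)
  have pos: "0 < p" "0 < q" "1 \<le> p" "1 \<le> q" using pq ndim_ge_1 by linarith+
  have \<kappa>: "0 < \<kappa>" using c by (simp add: \<kappa>_def)
  have J: "J_energy \<Omega> p q lam v = Lnorm \<Omega> q (weak_gradient \<Omega> v) powr q * (1 / q - 1 / p)"
    if "v \<in> Nehari \<Omega> p q lam" for v
  proof -
    have neh: "Lnorm \<Omega> p (weak_gradient \<Omega> v) powr p + Lnorm \<Omega> q (weak_gradient \<Omega> v) powr q = lam * Linf_norm \<Omega> v powr p"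
      using that by (simp add: Nehari_def)
    have "J_energy \<Omega> p q lam v = 1 / p * Lnorm \<Omega> p (weak_gradient \<Omega> v) powr p + 1 / q * Lnorm \<Omega> q (weak_gradient \<Omega> v) powr q
        - 1 / p * (lam * Linf_norm \<Omega> v powr p)"
      by (simp add: J_energy_def)
    then show ?thesis unfolding neh[symmetric] by (simp add: algebra_simps add_divide_distrib diff_divide_distrib)
  qed
  have uX: "u \<in> X_space \<Omega> p q" using u by (simp add: Nehari_def)
  have cu: "continuous_on (closure \<Omega>) u" and uW: "u \<in> W1_0 \<Omega> p"
    using uX pq by (auto simp: X_space_def max_def)
  define A where "A = Lnorm \<Omega> p (weak_gradient \<Omega> u) powr p"
  define b where "b = Lnorm \<Omega> q (weak_gradient \<Omega> u)"
  define B where "B = b powr q"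
  define M where "M = Linf_norm \<Omega> u"
  have nn: "0 \<le> A" "0 \<le> b" "0 \<le> B" "0 \<le> M" by (simp_all add: A_def b_def B_def M_def Lnorm_nonneg Linf_norm_nonneg)
  have neh: "A + B = lam * M powr p"
    using u by (simp add: Nehari_def A_def B_def b_def M_def lam_def)
  obtain \<phi> where \<phi>: "test_function \<Omega> \<phi>" "\<And>x. norm (gradient \<phi> x) \<le> 1"
    "vol * \<kappa> \<le> lam * Linf_norm \<Omega> \<phi> powr p - Lnorm \<Omega> p (weak_gradient \<Omega> \<phi>) powr p"
    using competitor[OF c pos(1)] unfolding \<kappa>_def lam_def by metis
  have \<phi>X: "\<phi> \<in> X_space \<Omega> p q" by (rule test_function_X_space[OF \<phi>(1) pos(1)])
  have c\<phi>: "continuous_on (closure \<Omega>) \<phi>" using \<phi>X by (simp add: X_space_def)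
  define A\<phi> where "A\<phi> = Lnorm \<Omega> p (weak_gradient \<Omega> \<phi>) powr p"
  define B\<phi> where "B\<phi> = Lnorm \<Omega> q (weak_gradient \<Omega> \<phi>) powr q"
  define M\<phi> where "M\<phi> = Linf_norm \<Omega> \<phi>"
  have gap: "vol * \<kappa> \<le> lam * M\<phi> powr p - A\<phi>" using \<phi>(3) by (simp add: M\<phi>_def A\<phi>_def)
  have gap0: "0 < lam * M\<phi> powr p - A\<phi>" using gap vol_pos \<kappa> by (smt (verit) mult_pos_pos)
  have "M\<phi> \<noteq> 0"
    using gap0 by (auto simp: A\<phi>_def)
  then have M\<phi>: "0 < M\<phi>" using Linf_norm_nonneg[of \<phi>] by (simp add: M\<phi>_def)
  \<comment> \<open>Needed for a positive scaling factor below. Morrey's inequality excludes a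
    vanishing gradient norm because the maximum of \<open>\<phi>\<close> is positive.\<close>
  have B\<phi>: "0 < B\<phi>"
  proof -
    have "M\<phi> \<le> Kc q * Lnorm \<Omega> q (weak_gradient \<Omega> \<phi>)"
      unfolding M\<phi>_def using pq \<phi>X
      by (intro W1_0_sup_bound[of _ p] c\<phi>) (auto simp: X_space_def max_def)
    with M\<phi> have "Lnorm \<Omega> q (weak_gradient \<Omega> \<phi>) \<noteq> 0" by auto
    then show ?thesis by (simp add: B\<phi>_def)
  qed
  \<comment> \<open>The positive factor that puts \<open>t * \<phi>\<close> on the Nehari set: it
    solves \<open>t powr p * (lam * M\<phi> powr p - A\<phi>) = t powr q * B\<phi>\<close>.\<close>
  define t where "t = (B\<phi> / (lam * M\<phi> powr p - A\<phi>)) powr (1 / (p - q))"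
  have t: "0 < t" using B\<phi> gap0 by (simp add: t_def)
  have tpq: "t powr p = t powr q * (B\<phi> / (lam * M\<phi> powr p - A\<phi>))"
  proof -
    have "t powr (p - q) = B\<phi> / (lam * M\<phi> powr p - A\<phi>)" using B\<phi> gap0 pq by (simp add: t_def powr_powr)
    then show ?thesis using t by (metis add.commute diff_add_cancel powr_add mult.commute)
  qed
  define v where "v x = t * \<phi> x" for x
  have vX: "v \<in> X_space \<Omega> p q" unfolding v_def by (rule X_space_scale[OF \<phi>X pos(3)])
  have Av: "Lnorm \<Omega> p (weak_gradient \<Omega> v) powr p = t powr p * A\<phi>"
    and Bv: "Lnorm \<Omega> q (weak_gradient \<Omega> v) powr q = t powr q * B\<phi>"
    unfolding v_def A\<phi>_def B\<phi>_def using X_space_Lnorm_scale[OF \<phi>X _ _ t] pos by auto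
  have Mv: "Linf_norm \<Omega> v powr p = t powr p * M\<phi> powr p"
    unfolding v_def M\<phi>_def using Linf_norm_scale[OF c\<phi> t] t by (simp add: powr_mult Linf_norm_nonneg)
  have vN: "v \<in> Nehari \<Omega> p q lam"
  proof -
    have "\<exists>x\<in>\<Omega>. v x \<noteq> 0"
    proof (rule ccontr)
      assume "\<not> (\<exists>x\<in>\<Omega>. v x \<noteq> 0)"
      then have "Linf_norm \<Omega> \<phi> \<le> 0"
        using t by (intro Linf_norm_continuous(3)[OF c\<phi>]) (auto simp: v_def)
      with M\<phi> show False by (simp add: M\<phi>_def)
    qed
    moreover have "t powr p * A\<phi> + t powr q * B\<phi> = lam * (t powr p * M\<phi> powr p)"
    proof -
      have "t powr p * (lam * M\<phi> powr p - A\<phi>) = t powr q * B\<phi>"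
        using gap0 by (simp add: tpq)
      then show ?thesis by (simp add: algebra_simps)
    qed
    ultimately show ?thesis using vX by (simp add: Nehari_def Av Bv Mv)
  qed
  have "B * (1 / q - 1 / p) \<le> (t powr q * B\<phi>) * (1 / q - 1 / p)"
    using min[of v] vN J[of u] J[of v] u by (simp add: lam_def[symmetric] B_def b_def Bv)
  moreover have "0 < 1 / q - 1 / p" using pq pos by (simp add: field_simps)
  ultimately have "B \<le> t powr q * B\<phi>" by simp
  also have "\<dots> \<le> \<kappa> powr (- q / (p - q)) * vol"
  proof (rule mult_mono)
    have B\<phi>vol: "B\<phi> \<le> vol" unfolding B\<phi>_def by (rule integral_gradient_le_vol[OF \<phi>(1,2) pos(2)])
    then show "B\<phi> \<le> vol" .
    have "B\<phi> / (lam * M\<phi> powr p - A\<phi>) \<le> vol / (vol * \<kappa>)"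
      using B\<phi>vol gap B\<phi> vol_pos \<kappa> by (intro frac_le) auto
    then have "B\<phi> / (lam * M\<phi> powr p - A\<phi>) \<le> 1 / \<kappa>" using vol_pos by simp
    then have "(B\<phi> / (lam * M\<phi> powr p - A\<phi>)) powr (q / (p - q)) \<le> (1 / \<kappa>) powr (q / (p - q))"
      using B\<phi> gap0 pq pos by (intro powr_mono2) auto
    then show "t powr q \<le> \<kappa> powr (- q / (p - q))"
      using \<kappa> by (simp add: t_def powr_powr powr_minus_divide powr_divide)
  qed (use B\<phi> in auto)
  finally have "b powr q \<le> vol * \<kappa> powr (- q / (p - q))" by (simp add: B_def mult.commute)
  then show "Lnorm \<Omega> q (weak_gradient \<Omega> u) \<le> (vol * \<kappa> powr (- q / (p - q))) powr (1 / q)"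
    unfolding b_def[symmetric] using nn pos by (intro le_powr_inverse) auto
  have K0: "0 \<le> Kc q" using inradius_pos ndim_ge_1 pq by (intro morrey_const_nonneg) auto
  have MK: "M \<le> Kc q * b"
    unfolding M_def b_def using pq by (intro W1_0_sup_bound[OF uW cu]) auto
  have M: "0 < M"
  proof -
    obtain x where x: "x \<in> \<Omega>" "u x \<noteq> 0" using u by (auto simp: Nehari_def)
    then have "\<bar>u x\<bar> \<le> M" unfolding M_def using closure_subset[of \<Omega>] by (intro Linf_norm_continuous(2)[OF cu]) auto
    with x show ?thesis by linarith
  qed
  then have b: "0 < b" and K: "0 < Kc q" using MK nn K0 by (auto simp: less_le)
  have BM: "B \<le> lam * M powr p" using neh nn(1) by linarith
  define X where "X = c * vol * (Kc q / inradius) powr p"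
  have X: "0 < X" using c vol_pos K inradius_pos by (simp add: X_def)
  have "M powr p \<le> (Kc q * b) powr p"
    using MK nn pos by (intro powr_mono2) auto
  then have "lam * M powr p \<le> lam * (Kc q powr p * b powr p)"
    using lam K b by (simp add: powr_mult)
  with BM have "b powr q \<le> X * b powr p"
    using inradius_pos K by (simp add: B_def lam_def X_def Lambda_inf_eq powr_divide mult_ac)
  then have "b powr (q - p) \<le> X" by (rule powr_diff_le_of_le_mult[OF b])
  \<comment> \<open>The exponent is negative and reverses the inequality; it is the one that turns
    \<open>b powr (q - p)\<close> into \<open>b powr q\<close>.\<close>
  then have "X powr (- q / (p - q)) \<le> (b powr (q - p)) powr (- q / (p - q))"
    using b pq pos by (intro powr_mono2') auto
  also have "\<dots> = b powr q"
  proof -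
    have "(q - p) * (- q / (p - q)) = q" using pq by (simp add: field_simps)
    then show ?thesis by (simp only: powr_powr)
  qed
  finally have "X powr (- q / (p - q)) \<le> lam * M powr p" using BM by (simp add: B_def)
  then show "inradius * (((c * vol * (Kc q / inradius) powr p) powr (- q / (p - q))) / (c * vol)) powr (1 / p) \<le> Linf_norm \<Omega> u"
    unfolding X_def lam_def M_def using c Linf_norm_nonneg by (intro lower_bound_max[OF pos(1)]) auto
qed

end

section \<open>Passage to the limit\<close>

text \<open>The quotients are rewritten in terms of \<open>q p / p\<close>; for
  \<open>Q \<noteq> 1\<close> the difference \<open>q p - p\<close> is of the order of
  \<open>p\<close>.\<close>

lemma ratio_limits:
  fixes q :: "real \<Rightarrow> real"
  assumes r: "((\<lambda>p. q p / p) \<longlongrightarrow> Q) at_top" and Q: "0 < Q"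
  shows "filterlim q at_top at_top"
    and "((\<lambda>p. 1 / p :: real) \<longlongrightarrow> 0) at_top"
    and "((\<lambda>p. 1 / q p) \<longlongrightarrow> 0) at_top"
    and "((\<lambda>p. p / q p) \<longlongrightarrow> 1 / Q) at_top"
    and "Q \<noteq> 1 \<Longrightarrow> ((\<lambda>p. p / (q p - p)) \<longlongrightarrow> 1 / (Q - 1)) at_top"
    and "Q \<noteq> 1 \<Longrightarrow> ((\<lambda>p. q p / (q p - p)) \<longlongrightarrow> Q / (Q - 1)) at_top"
    and "Q \<noteq> 1 \<Longrightarrow> ((\<lambda>p. 1 / (q p - p)) \<longlongrightarrow> 0) at_top"
proof -
  have pos: "\<forall>\<^sub>F p::real in at_top. 0 < p" by (rule eventually_gt_at_top)
  have "filterlim (\<lambda>p. q p / p * p) at_top at_top"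
    by (rule filterlim_tendsto_pos_mult_at_top[OF r Q filterlim_ident])
  moreover have "\<forall>\<^sub>F p in at_top. q p / p * p = q p"
    using pos by eventually_elim simp
  ultimately show q: "filterlim q at_top at_top"
    using filterlim_cong[OF refl refl, of "\<lambda>p. q p / p * p" q at_top at_top] by simp
  show p: "((\<lambda>p. 1 / p :: real) \<longlongrightarrow> 0) at_top" by real_asymp
  show "((\<lambda>p. 1 / q p) \<longlongrightarrow> 0) at_top"
    by (rule filterlim_compose[OF p q])
  have "((\<lambda>p. 1 / (q p / p)) \<longlongrightarrow> 1 / Q) at_top"
    using Q by (intro tendsto_divide r tendsto_const) auto
  then show "((\<lambda>p. p / q p) \<longlongrightarrow> 1 / Q) at_top" by simp
  assume Q1: "Q \<noteq> 1"
  have l: "((\<lambda>p. 1 / (q p / p - 1)) \<longlongrightarrow> 1 / (Q - 1)) at_top"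
    using Q1 by (intro tendsto_intros r) auto
  have "\<forall>\<^sub>F p in at_top. 1 / (q p / p - 1) = p / (q p - p)"
    using pos by eventually_elim (simp add: field_simps)
  with l show lim: "((\<lambda>p. p / (q p - p)) \<longlongrightarrow> 1 / (Q - 1)) at_top"
    by (rule Lim_transform_eventually)
  have "((\<lambda>p. q p / p * (p / (q p - p))) \<longlongrightarrow> Q * (1 / (Q - 1))) at_top"
    by (intro tendsto_intros r lim)
  moreover have "\<forall>\<^sub>F p in at_top. q p / p * (p / (q p - p)) = q p / (q p - p)"
    using pos by eventually_elim simp
  ultimately show "((\<lambda>p. q p / (q p - p)) \<longlongrightarrow> Q / (Q - 1)) at_top"
    using Lim_transform_eventually by fastforce
  have "((\<lambda>p. 1 / p * (p / (q p - p))) \<longlongrightarrow> 0 * (1 / (Q - 1))) at_top"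
    by (intro tendsto_intros p lim)
  moreover have "\<forall>\<^sub>F p in at_top. 1 / p * (p / (q p - p)) = 1 / (q p - p)"
    using pos by eventually_elim simp
  ultimately show "((\<lambda>p. 1 / (q p - p)) \<longlongrightarrow> 0) at_top"
    using Lim_transform_eventually by fastforce
qed

context bounded_open begin

section \<open>Limits of the bounds in the two regimes\<close>

lemma Kc_tendsto: "((\<lambda>p. Kc p / inradius) \<longlongrightarrow> 1) at_top"
proof -
  have "((\<lambda>p. Kc p / inradius) \<longlongrightarrow> inradius / inradius) at_top"
    using inradius_pos ndim_ge_1 by (intro tendsto_intros morrey_const_tendsto) auto
  then show ?thesis using inradius_pos by simp
qed

lemma Kc_nonneg: "real DIM('a) < p \<Longrightarrow> 0 \<le> Kc p / inradius"
  using inradius_pos ndim_ge_1 by (intro divide_nonneg_pos morrey_const_nonneg) auto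

text \<open>Constants end up with exponents tending to 0. Only the power of
  \<open>Kc p / inradius\<close> keeps a nonzero limiting exponent, and its base tends to 1.\<close>

lemma superlinear_limits:
  assumes r: "((\<lambda>p. q p / p) \<longlongrightarrow> Q) at_top" and Q: "1 < Q" and c: "0 < c" and \<kappa>: "0 < \<kappa>"
  shows "((\<lambda>p. (c * vol * (Kc p / inradius) powr p * vol powr (1 - p / q p)) powr (1 / (q p - p))) \<longlongrightarrow> 1) at_top"
    and "((\<lambda>p. inradius * (vol * \<kappa> powr (q p / (q p - p)) / (c * vol)) powr (1 / p)) \<longlongrightarrow> inradius) at_top"
proof -
  have Q0: "0 < Q" "Q \<noteq> 1" using Q by auto
  note l = ratio_limits[OF r Q0(1)] and l1 = ratio_limits(5-7)[OF r Q0(1) Q0(2)]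
  have K0: "\<forall>\<^sub>F p in at_top. 0 \<le> Kc p / inradius"
    using eventually_gt_at_top[of "real DIM('a)"] by eventually_elim (rule Kc_nonneg)
  have "((\<lambda>p. (c * vol) powr (1 / (q p - p)) * (Kc p / inradius) powr (p / (q p - p)) * (vol powr (1 - p / q p)) powr (1 / (q p - p)))
     \<longlongrightarrow> (c * vol) powr 0 * 1 powr (1 / (Q - 1)) * (vol powr (1 - 1 / Q)) powr 0) at_top"
    using c vol_pos by (intro tendsto_intros Kc_tendsto l l1) auto
  then have "((\<lambda>p. (c * vol) powr (1 / (q p - p)) * (Kc p / inradius) powr (p / (q p - p)) * (vol powr (1 - p / q p)) powr (1 / (q p - p)))
     \<longlongrightarrow> 1) at_top"
    using c vol_pos by simp
  moreover have "\<forall>\<^sub>F p in at_top. (c * vol) powr (1 / (q p - p)) * (Kc p / inradius) powr (p / (q p - p)) * (vol powr (1 - p / q p)) powr (1 / (q p - p))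
      = (c * vol * (Kc p / inradius) powr p * vol powr (1 - p / q p)) powr (1 / (q p - p))"
    using K0
  proof eventually_elim
    case (elim p)
    then show ?case
      using c vol_pos powr_mult[of "c * vol * (Kc p / inradius) powr p" "vol powr (1 - p / q p)" "1 / (q p - p)"]
        powr_mult[of "c * vol" "(Kc p / inradius) powr p" "1 / (q p - p)"] powr_powr[of "Kc p / inradius" p "1 / (q p - p)"]
      by simp
  qed
  ultimately show "((\<lambda>p. (c * vol * (Kc p / inradius) powr p * vol powr (1 - p / q p)) powr (1 / (q p - p))) \<longlongrightarrow> 1) at_top"
    by (rule Lim_transform_eventually)
  have "((\<lambda>p. inradius * (vol * \<kappa> powr (q p / (q p - p)) / (c * vol)) powr (1 / p))
    \<longlongrightarrow> inradius * (vol * \<kappa> powr (Q / (Q - 1)) / (c * vol)) powr 0) at_top"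
    using c vol_pos \<kappa> by (intro tendsto_intros l l1) auto
  then show "((\<lambda>p. inradius * (vol * \<kappa> powr (q p / (q p - p)) / (c * vol)) powr (1 / p)) \<longlongrightarrow> inradius) at_top"
    using c vol_pos \<kappa> by simp
qed

text \<open>After the \<open>p\<close>-th root the base \<open>Kc (q p) / inradius\<close>, which
  tends to 1 because \<open>q p\<close> tends to infinity, carries the exponent
  \<open>- q p / (p - q p)\<close> with the finite limit \<open>Q / (Q - 1)\<close>. The remaining
  constants have exponents tending to 0.\<close>

lemma sublinear_limits:
  assumes r: "((\<lambda>p. q p / p) \<longlongrightarrow> Q) at_top" and Q: "0 < Q" "Q < 1" and c: "0 < c" and \<kappa>: "0 < \<kappa>"
  shows "((\<lambda>p. (vol * \<kappa> powr (- q p / (p - q p))) powr (1 / q p)) \<longlongrightarrow> 1) at_top"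
    and "((\<lambda>p. inradius * (((c * vol * (Kc (q p) / inradius) powr p) powr (- q p / (p - q p))) / (c * vol)) powr (1 / p))
        \<longlongrightarrow> inradius) at_top"
proof -
  have Q0: "Q \<noteq> 1" using Q by auto
  note l = ratio_limits[OF r Q(1)] and l1 = ratio_limits(5-7)[OF r Q(1) Q0]
  have flip: "- q p / (p - q p) = q p / (q p - p)" for p
    using minus_divide_divide[of "q p" "q p - p"] by simp
  have l2: "((\<lambda>p. - q p / (p - q p)) \<longlongrightarrow> Q / (Q - 1)) at_top"
    unfolding flip by (rule l1(2))
  have "((\<lambda>p. (vol * \<kappa> powr (- q p / (p - q p))) powr (1 / q p)) \<longlongrightarrow> (vol * \<kappa> powr (Q / (Q - 1))) powr 0) at_top"
    using vol_pos \<kappa> by (intro tendsto_powr tendsto_mult tendsto_const l l2) auto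
  then show "((\<lambda>p. (vol * \<kappa> powr (- q p / (p - q p))) powr (1 / q p)) \<longlongrightarrow> 1) at_top"
    using vol_pos \<kappa> by simp
  have Kq: "((\<lambda>p. Kc (q p) / inradius) \<longlongrightarrow> 1) at_top"
    by (rule filterlim_compose[OF Kc_tendsto l(1)])
  have "((\<lambda>p. inradius * ((c * vol) powr ((- q p / (p - q p)) * (1 / p)) * (Kc (q p) / inradius) powr (- q p / (p - q p)) / (c * vol) powr (1 / p)))
    \<longlongrightarrow> inradius * ((c * vol) powr ((Q / (Q - 1)) * 0) * 1 powr (Q / (Q - 1)) / (c * vol) powr 0)) at_top"
    using c vol_pos by (intro tendsto_mult tendsto_divide tendsto_powr tendsto_const l l2 Kq) auto
  then have "((\<lambda>p. inradius * ((c * vol) powr ((- q p / (p - q p)) * (1 / p)) * (Kc (q p) / inradius) powr (- q p / (p - q p)) / (c * vol) powr (1 / p)))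
    \<longlongrightarrow> inradius) at_top"
    using c vol_pos by simp
  moreover have "\<forall>\<^sub>F p in at_top. 0 \<le> Kc (q p) / inradius"
  proof -
    have "\<forall>\<^sub>F p in at_top. real DIM('a) < q p"
      using l(1) by (simp add: filterlim_at_top_dense)
    then show ?thesis by eventually_elim (rule Kc_nonneg)
  qed
  then have "\<forall>\<^sub>F p in at_top. inradius * ((c * vol) powr ((- q p / (p - q p)) * (1 / p)) * (Kc (q p) / inradius) powr (- q p / (p - q p)) / (c * vol) powr (1 / p))
     = inradius * (((c * vol * (Kc (q p) / inradius) powr p) powr (- q p / (p - q p))) / (c * vol)) powr (1 / p)"
    using eventually_gt_at_top[of 0]
  proof eventually_elim
    case (elim p)
    define e where "e = - q p / (p - q p)"
    define k where "k = Kc (q p) / inradius"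
    have k: "0 \<le> k" using elim by (simp add: k_def)
    have "(c * vol * k powr p) powr e = (c * vol) powr e * k powr (p * e)"
      using c vol_pos powr_mult[of "c * vol" "k powr p" e] by (simp add: powr_powr)
    then have "((c * vol * k powr p) powr e / (c * vol)) powr (1 / p) = ((c * vol) powr e * k powr (p * e)) powr (1 / p) / (c * vol) powr (1 / p)"
      using c vol_pos by (simp add: powr_divide)
    also have "((c * vol) powr e * k powr (p * e)) powr (1 / p) = (c * vol) powr (e * (1 / p)) * k powr e"
      using c vol_pos elim powr_mult[of "(c * vol) powr e" "k powr (p * e)" "1 / p"] by (simp add: powr_powr)
    finally show ?case unfolding e_def[symmetric] k_def[symmetric] by simp
  qed
  ultimately show "((\<lambda>p. inradius * (((c * vol * (Kc (q p) / inradius) powr p) powr (- q p / (p - q p))) / (c * vol)) powr (1 / p))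
        \<longlongrightarrow> inradius) at_top"
    by (rule Lim_transform_eventually)
qed

text \<open>The explicit bounds differ between the regimes; hiding them behind \<open>U\<close> and
  \<open>W\<close> leaves only their limits, which agree.\<close>

lemma least_energy_bounds:
  assumes r: "((\<lambda>p. q p / p) \<longlongrightarrow> Q) at_top"
    and Q: "(0 < Q \<and> Q < 1 \<and> (\<forall>\<^sub>F p in at_top. real DIM('a) < q p \<and> q p < p)) \<or>
         (1 < Q \<and> (\<forall>\<^sub>F p in at_top. real DIM('a) < p \<and> p < q p))"
    and c: "1 < c"
    and les: "\<forall>\<^sub>F p in at_top. least_energy_solution \<Omega> p (q p) (c * vol * Lambda_inf \<Omega> powr p) (u p)"
  obtains U W where "(U \<longlongrightarrow> 1) at_top" "(W \<longlongrightarrow> inradius) at_top"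
    "\<forall>\<^sub>F p in at_top. u p \<in> X_space \<Omega> p (q p) \<and> Lnorm \<Omega> (q p) (weak_gradient \<Omega> (u p)) \<le> U p \<and> W p \<le> Linf_norm \<Omega> (u p)"
proof -
  define \<kappa> where "\<kappa> = (c - 1) / 2"
  have pos: "0 < c" "0 < \<kappa>" using c by (auto simp: \<kappa>_def)
  from Q show thesis
  proof (elim disjE conjE)
    assume Q: "0 < Q" "Q < 1" and ev: "\<forall>\<^sub>F p in at_top. real DIM('a) < q p \<and> q p < p"
    show thesis
    proof (rule that[OF sublinear_limits[OF r Q pos]])
      show "\<forall>\<^sub>F p in at_top. u p \<in> X_space \<Omega> p (q p) \<and>
          Lnorm \<Omega> (q p) (weak_gradient \<Omega> (u p)) \<le> (vol * \<kappa> powr (- q p / (p - q p))) powr (1 / q p) \<and>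
          inradius * (((c * vol * (Kc (q p) / inradius) powr p) powr (- q p / (p - q p))) / (c * vol)) powr (1 / p) \<le> Linf_norm \<Omega> (u p)"
        using ev les
      proof eventually_elim
        case (elim p)
        then have u: "u p \<in> Nehari \<Omega> p (q p) (c * vol * Lambda_inf \<Omega> powr p)"
          and min: "\<And>v. v \<in> Nehari \<Omega> p (q p) (c * vol * Lambda_inf \<Omega> powr p) \<Longrightarrow>
             J_energy \<Omega> p (q p) (c * vol * Lambda_inf \<Omega> powr p) (u p) \<le> J_energy \<Omega> p (q p) (c * vol * Lambda_inf \<Omega> powr p) v"
          by (auto simp: least_energy_solution_def)
        show ?case
          using bounds_sublinear[OF c _ _ u min] elim u by (auto simp: \<kappa>_def Nehari_def)
      qed
    qed
  next
    assume Q: "1 < Q" and ev: "\<forall>\<^sub>F p in at_top. real DIM('a) < p \<and> p < q p"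
    show thesis
    proof (rule that[OF superlinear_limits[OF r Q pos]])
      show "\<forall>\<^sub>F p in at_top. u p \<in> X_space \<Omega> p (q p) \<and>
          Lnorm \<Omega> (q p) (weak_gradient \<Omega> (u p)) \<le> (c * vol * (Kc p / inradius) powr p * vol powr (1 - p / q p)) powr (1 / (q p - p)) \<and>
          inradius * (vol * \<kappa> powr (q p / (q p - p)) / (c * vol)) powr (1 / p) \<le> Linf_norm \<Omega> (u p)"
        using ev les
      proof eventually_elim
        case (elim p)
        then have u: "u p \<in> X_space \<Omega> p (q p)"
          and min: "\<And>v. v \<in> X_space \<Omega> p (q p) \<Longrightarrow>
             J_energy \<Omega> p (q p) (c * vol * Lambda_inf \<Omega> powr p) (u p) \<le> J_energy \<Omega> p (q p) (c * vol * Lambda_inf \<Omega> powr p) v"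
          by (auto simp: least_energy_solution_def)
        show ?case
          using bounds_superlinear[OF c _ _ u min] elim u by (auto simp: \<kappa>_def)
      qed
    qed
  qed
qed

end

text \<open>Records the outcome of the energy estimates in the form common to both regimes, so that
  the passage to the limit is carried out once.\<close>

locale asymptotic_family = bounded_open +
  fixes u :: "real \<Rightarrow> 'a \<Rightarrow> real" and q U W :: "real \<Rightarrow> real"
  assumes q_lim: "filterlim q at_top at_top"
    and U_lim: "(U \<longlongrightarrow> 1) at_top"
    and W_lim: "(W \<longlongrightarrow> inradius) at_top"
    and bounds: "\<forall>\<^sub>F p in at_top. u p \<in> X_space \<Omega> p (q p) \<and>
      Lnorm \<Omega> (q p) (weak_gradient \<Omega> (u p)) \<le> U p \<and> W p \<le> Linf_norm \<Omega> (u p)"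
    and nonneg: "\<forall>\<^sub>F p in at_top. \<forall>y\<in>closure \<Omega>. 0 \<le> u p y"
begin

lemma gradient_bound:
  assumes m: "0 < m"
  shows "\<forall>\<^sub>F p in at_top. m \<le> q p \<and> u p \<in> X_space \<Omega> p (q p) \<and>
    Lnorm \<Omega> m (weak_gradient \<Omega> (u p)) \<le> vol powr (1 / m - 1 / q p) * U p"
proof -
  have "\<forall>\<^sub>F p in at_top. m \<le> q p" using q_lim by (simp add: filterlim_at_top)
  then show ?thesis
    using bounds
  proof eventually_elim
    case (elim p)
    have "Lnorm \<Omega> m (weak_gradient \<Omega> (u p)) \<le> vol powr (1 / m - 1 / q p) * Lnorm \<Omega> (q p) (weak_gradient \<Omega> (u p))"
      using elim m by (intro Lnorm_mono_exponent lmeasurable_dom vol_pos X_space_gradient(2)[of "u p" p "q p"]) auto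
    also have "\<dots> \<le> vol powr (1 / m - 1 / q p) * U p"
      using elim by (intro mult_left_mono) auto
    finally show ?case using elim by blast
  qed
qed

lemma gradient_bound_tendsto: "0 < m \<Longrightarrow> ((\<lambda>p. vol powr (1 / m - 1 / q p) * U p) \<longlongrightarrow> vol powr (1 / m)) at_top"
proof -
  have "((\<lambda>p. 1 / q p) \<longlongrightarrow> 0) at_top"
    by (rule filterlim_compose[OF _ q_lim]) real_asymp
  then have "((\<lambda>p. vol powr (1 / m - 1 / q p) * U p) \<longlongrightarrow> vol powr (1 / m - 0) * 1) at_top"
    using vol_pos by (intro tendsto_intros U_lim) auto
  then show ?thesis by simp
qed

lemma Limsup_gradient:
  assumes "0 < m"
  shows "Limsup at_top (\<lambda>p. ereal (Lnorm \<Omega> m (weak_gradient \<Omega> (u p)))) \<le> ereal (vol powr (1 / m))"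
proof -
  have "Limsup at_top (\<lambda>p. ereal (Lnorm \<Omega> m (weak_gradient \<Omega> (u p)))) \<le>
      Limsup at_top (\<lambda>p. ereal (vol powr (1 / m - 1 / q p) * U p))"
    by (rule Limsup_mono) (use gradient_bound[OF assms] in \<open>auto elim: eventually_mono\<close>)
  also have "\<dots> = ereal (vol powr (1 / m))"
    by (rule lim_imp_Limsup) (auto intro: tendsto_ereal gradient_bound_tendsto[OF assms])
  finally show ?thesis .
qed

lemma Liminf_max: "ereal inradius \<le> Liminf at_top (\<lambda>p. ereal (Linf_norm \<Omega> (u p)))"
proof -
  have "ereal inradius = Liminf at_top (\<lambda>p. ereal (W p))"
    by (rule lim_imp_Liminf[symmetric]) (auto intro: tendsto_ereal W_lim)
  also have "\<dots> \<le> Liminf at_top (\<lambda>p. ereal (Linf_norm \<Omega> (u p)))"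
    by (rule Liminf_mono) (use bounds in \<open>auto elim: eventually_mono\<close>)
  finally show ?thesis .
qed

text \<open>The Lipschitz constant 1 takes two limits in turn. At a fixed exponent \<open>m\<close>
  the family passes to its uniform limit, with the bound \<open>morrey_const\<close> times
  \<open>vol powr (1 / m)\<close>; then \<open>m\<close> tends to infinity, where the first factor
  tends to the distance and the second to 1.\<close>

lemma limit_properties:
  assumes pn: "filterlim pn at_top sequentially"
    and lim: "uniform_limit (closure \<Omega>) (\<lambda>n. u (pn n)) u0 sequentially"
  shows "continuous_on (closure \<Omega>) u0"
    and "x \<in> frontier \<Omega> \<Longrightarrow> u0 x = 0"
    and "x \<in> closure \<Omega> \<Longrightarrow> 0 \<le> u0 x"
    and "\<bar>zero_ext u0 x - zero_ext u0 y\<bar> \<le> norm (x - y)"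
proof -
  have ev: "\<forall>\<^sub>F n in sequentially. P (pn n)" if "\<forall>\<^sub>F p in at_top. P p" for P
    using pn that by (rule eventually_compose_filterlim[rotated])
  have q1: "\<forall>\<^sub>F n in sequentially. real DIM('a) < q (pn n)"
    using ev[of "\<lambda>p. real DIM('a) < q p"] q_lim by (simp add: filterlim_at_top_dense)
  have pt: "(\<lambda>n. u (pn n) x) \<longlonglongrightarrow> u0 x" if "x \<in> closure \<Omega>" for x
    by (rule tendsto_uniform_limitI[OF lim that])
  show "continuous_on (closure \<Omega>) u0"
  proof (rule uniform_limit_theorem[OF _ lim])
    show "\<forall>\<^sub>F n in sequentially. continuous_on (closure \<Omega>) (u (pn n))"
      using ev[OF bounds] by eventually_elim (simp add: X_space_def)
  qed simp
  show "0 \<le> u0 x" if "x \<in> closure \<Omega>" for x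
    by (rule tendsto_lowerbound[OF pt[OF that]]) (use ev[OF nonneg] that in \<open>auto elim: eventually_mono\<close>)
  show "u0 x = 0" if x: "x \<in> frontier \<Omega>" for x
  proof -
    have "\<forall>\<^sub>F n in sequentially. u (pn n) x = 0"
      using ev[OF bounds] q1 by eventually_elim (use X_space_frontier x in blast)
    then have "(\<lambda>n. u (pn n) x) \<longlonglongrightarrow> 0" by (rule tendsto_eventually)
    moreover have "x \<in> closure \<Omega>" using x by (simp add: frontier_def)
    ultimately show ?thesis using pt LIMSEQ_unique by blast
  qed
  have ze: "(\<lambda>n. zero_ext (u (pn n)) x) \<longlonglongrightarrow> zero_ext u0 x" for x
    using pt[of x] closure_subset[of \<Omega>] by (auto simp: zero_ext_def)
  have fixed_m: "\<bar>zero_ext u0 x - zero_ext u0 y\<bar> \<le> morrey_const (real DIM('a)) m (norm (x - y)) * vol powr (1 / m)"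
    if m: "real DIM('a) < m" for m
  proof -
    have m0: "0 < m" using m ndim_ge_1 by linarith
    show ?thesis
    proof (rule tendsto_le)
      show "(\<lambda>n. \<bar>zero_ext (u (pn n)) x - zero_ext (u (pn n)) y\<bar>) \<longlonglongrightarrow> \<bar>zero_ext u0 x - zero_ext u0 y\<bar>"
        by (intro tendsto_intros ze)
      show "(\<lambda>n. morrey_const (real DIM('a)) m (norm (x - y)) * (vol powr (1 / m - 1 / q (pn n)) * U (pn n)))
          \<longlonglongrightarrow> morrey_const (real DIM('a)) m (norm (x - y)) * vol powr (1 / m)"
        by (intro tendsto_mult tendsto_const filterlim_compose[OF gradient_bound_tendsto[OF m0] pn])
      show "\<forall>\<^sub>F n in sequentially. \<bar>zero_ext (u (pn n)) x - zero_ext (u (pn n)) y\<bar>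
          \<le> morrey_const (real DIM('a)) m (norm (x - y)) * (vol powr (1 / m - 1 / q (pn n)) * U (pn n))"
        using ev[OF gradient_bound[OF m0]]
      proof eventually_elim
        case (elim n)
        then have "\<bar>zero_ext (u (pn n)) x - zero_ext (u (pn n)) y\<bar>
          \<le> morrey_const (real DIM('a)) m (norm (x - y)) * Lnorm \<Omega> m (weak_gradient \<Omega> (u (pn n)))"
          using X_space_W1_0[of "u (pn n)" "pn n" "q (pn n)"] m
          by (intro W1_0_morrey(1)[of _ "max (pn n) (q (pn n))"]) auto
        also have "\<dots> \<le> morrey_const (real DIM('a)) m (norm (x - y)) * (vol powr (1 / m - 1 / q (pn n)) * U (pn n))"
          using elim m ndim_ge_1 by (intro mult_left_mono morrey_const_nonneg) auto
        finally show ?case .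
      qed
    qed simp
  qed
  show "\<bar>zero_ext u0 x - zero_ext u0 y\<bar> \<le> norm (x - y)"
  proof (cases "x = y")
    case False
    have "((\<lambda>m. morrey_const (real DIM('a)) m (norm (x - y)) * vol powr (1 / m)) \<longlongrightarrow> norm (x - y) * vol powr 0) at_top"
      using False vol_pos ndim_ge_1
      by (intro tendsto_intros morrey_const_tendsto ratio_limits(2)[of "\<lambda>p. p" 1]) (auto intro!: tendsto_eventually eventually_mono[OF eventually_gt_at_top[of 0]])
    then have "((\<lambda>m. morrey_const (real DIM('a)) m (norm (x - y)) * vol powr (1 / m)) \<longlongrightarrow> norm (x - y)) at_top"
      using vol_pos by simp
    then show ?thesis
      by (rule tendsto_lowerbound) (auto intro: eventually_mono[OF eventually_gt_at_top[of "real DIM('a)"] fixed_m])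
  qed simp
qed

lemma limit_le_bdist:
  assumes pn: "filterlim pn at_top sequentially"
    and lim: "uniform_limit (closure \<Omega>) (\<lambda>n. u (pn n)) u0 sequentially"
    and x: "x \<in> closure \<Omega>"
  shows "u0 x \<le> bdist \<Omega> x"
proof -
  note L = limit_properties[OF pn lim]
  obtain y where y: "y \<in> frontier \<Omega>" "bdist \<Omega> x = dist x y" by (rule bdist_nearest)
  have "zero_ext u0 y = 0" using frontier_not_in_dom[OF y(1)] by (simp add: zero_ext_def)
  then show ?thesis
    using L(4)[of x y] zero_ext_closure[OF L(2) x] y(2) by (simp add: dist_norm)
qed

lemma limit_pair_exists:
  assumes max: "\<forall>\<^sub>F p in at_top. max_points \<Omega> (u p) = {x p}"
  shows "\<exists>pn u0 x0. limit_pair \<Omega> u x pn u0 x0"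
proof -
  let ?N = "real DIM('a)"
  \<comment> \<open>Any fixed exponent above the dimension gives a modulus of continuity common to
    the whole family.\<close>
  define m where "m = ?N + 1"
  have m: "?N < m" "0 < m" "0 < ?N" using ndim_ge_1 by (auto simp: m_def)
  define C where "C = vol powr (1 / m) + 1"
  have C: "0 < C" by (simp add: C_def add_nonneg_pos)
  have "\<forall>\<^sub>F p in at_top. vol powr (1 / m - 1 / q p) * U p < C"
    by (rule order_tendstoD(2)[OF gradient_bound_tendsto[OF m(2)]]) (simp add: C_def)
  then have "\<forall>\<^sub>F p in at_top. u p \<in> X_space \<Omega> p (q p) \<and> m \<le> q p \<and> Lnorm \<Omega> m (weak_gradient \<Omega> (u p)) \<le> C
      \<and> W p \<le> Linf_norm \<Omega> (u p) \<and> (\<forall>y\<in>closure \<Omega>. 0 \<le> u p y) \<and> max_points \<Omega> (u p) = {x p}"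
    using gradient_bound[OF m(2)] bounds nonneg max by eventually_elim auto
  then obtain p0 where p0: "\<And>p. p0 \<le> p \<Longrightarrow> u p \<in> X_space \<Omega> p (q p) \<and> m \<le> q p \<and> Lnorm \<Omega> m (weak_gradient \<Omega> (u p)) \<le> C
      \<and> W p \<le> Linf_norm \<Omega> (u p) \<and> (\<forall>y\<in>closure \<Omega>. 0 \<le> u p y) \<and> max_points \<Omega> (u p) = {x p}"
    unfolding eventually_at_top_linorder by blast
  \<comment> \<open>Starting at \<open>p0\<close> makes all properties that hold for large
    \<open>p\<close> available at every index.\<close>
  define pk where "pk k = p0 + real k" for k
  have pk: "p0 \<le> pk k" for k by (simp add: pk_def)
  note P = p0[OF pk]
  define F where "F k = zero_ext (u (pk k))" for k
  have Fu: "F k y = u (pk k) y" if "y \<in> closure \<Omega>" for k y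
    unfolding F_def
  proof (rule zero_ext_closure[OF _ that])
    show "u (pk k) z = 0" if "z \<in> frontier \<Omega>" for z
      using P[of k] m(1) that by (intro X_space_frontier[of _ "pk k" "q (pk k)"]) auto
  qed
  have mor: "\<bar>F k y - F k z\<bar> \<le> morrey_const ?N m (norm (y - z)) * C" for k y z
  proof -
    have "\<bar>F k y - F k z\<bar> \<le> morrey_const ?N m (norm (y - z)) * Lnorm \<Omega> m (weak_gradient \<Omega> (u (pk k)))"
      unfolding F_def using X_space_W1_0[of "u (pk k)" "pk k" "q (pk k)"] P[of k] m
      by (intro W1_0_morrey(1)[of _ "max (pk k) (q (pk k))"]) auto
    also have "\<dots> \<le> morrey_const ?N m (norm (y - z)) * C"
      using P[of k] m by (intro mult_left_mono morrey_const_nonneg) auto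
    finally show ?thesis .
  qed
  have small: "\<exists>d>0. \<forall>k y. y \<in> closure \<Omega> \<and> norm (z - y) < d \<longrightarrow> norm (F k z - F k y) < e"
    if e: "0 < e" for z e
  proof -
    have "(\<lambda>n. morrey_const ?N m (inverse (real (Suc n))) * C) \<longlonglongrightarrow> morrey_const ?N m 0 * C"
      using m by (intro tendsto_intros morrey_const_tendsto_const LIMSEQ_inverse_real_of_nat) auto
    then have "\<forall>\<^sub>F n in sequentially. morrey_const ?N m (inverse (real (Suc n))) * C < e"
      using e by (intro order_tendstoD(2)) auto
    then obtain n where n: "morrey_const ?N m (inverse (real (Suc n))) * C < e"
      by (auto simp: eventually_sequentially)
    show ?thesis
    proof (intro exI[of _ "inverse (real (Suc n))"] conjI allI impI)
      fix k y assume y: "y \<in> closure \<Omega> \<and> norm (z - y) < inverse (real (Suc n))"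
      have "\<bar>F k z - F k y\<bar> \<le> morrey_const ?N m (norm (z - y)) * C" by (rule mor)
      also have "\<dots> \<le> morrey_const ?N m (inverse (real (Suc n))) * C"
        using y m C by (intro mult_right_mono morrey_const_mono) auto
      finally show "norm (F k z - F k y) < e" using n by simp
    qed simp
  qed
  have Fb: "norm (F k y) \<le> Kc m * C" if y: "y \<in> closure \<Omega>" for k y
  proof -
    have X: "u (pk k) \<in> W1_0 \<Omega> (max (pk k) (q (pk k)))" "continuous_on (closure \<Omega>) (u (pk k))"
      using X_space_W1_0 P[of k] by blast+
    have "\<bar>u (pk k) y\<bar> \<le> Linf_norm \<Omega> (u (pk k))"
      by (rule Linf_norm_continuous(2)[OF X(2) y])
    also have "\<dots> \<le> Kc m * Lnorm \<Omega> m (weak_gradient \<Omega> (u (pk k)))"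
      using P[of k] by (intro W1_0_sup_bound[OF X m(1)]) auto
    also have "\<dots> \<le> Kc m * C"
      using P[of k] m inradius_pos by (intro mult_left_mono morrey_const_nonneg) auto
    finally show ?thesis by (simp add: Fu[OF y])
  qed
  obtain g k where g: "continuous_on (closure \<Omega>) g" "strict_mono (k :: nat \<Rightarrow> nat)"
    "\<And>e. 0 < e \<Longrightarrow> \<exists>N. \<forall>n y. N \<le> n \<and> y \<in> closure \<Omega> \<longrightarrow> norm (F (k n) y - g y) < e"
    using Arzela_Ascoli[OF compact_closure_dom, of F "Kc m * C", OF Fb] small by metis
  have xcl: "x (pk n) \<in> closure \<Omega>" "\<And>y. y \<in> closure \<Omega> \<Longrightarrow> u (pk n) y \<le> u (pk n) (x (pk n))" for n
    using P[of n] by (auto simp: max_points_def)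
  \<comment> \<open>A second extraction makes the maximum points converge as well.\<close>
  obtain x0 l where x0: "x0 \<in> closure \<Omega>" "strict_mono (l :: nat \<Rightarrow> nat)" "((\<lambda>n. x (pk (k n))) \<circ> l) \<longlonglongrightarrow> x0"
    using compact_closure_dom[unfolded compact_def, rule_format, of "\<lambda>n. x (pk (k n))"] xcl(1) by blast
  define pn where "pn n = pk (k (l n))" for n
  have kl: "strict_mono (\<lambda>n. k (l n))" using g(2) x0(2) by (simp add: strict_mono_def)
  have pn: "filterlim pn at_top sequentially"
  proof -
    have "filterlim (\<lambda>n. k (l n)) at_top sequentially" by (rule filterlim_subseq[OF kl])
    then have "filterlim (\<lambda>n. real (k (l n))) at_top sequentially"
      by (rule filterlim_compose[OF filterlim_real_sequentially])
    then show ?thesis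
      unfolding pn_def pk_def by (rule filterlim_tendsto_add_at_top[OF tendsto_const])
  qed
  have lim: "uniform_limit (closure \<Omega>) (\<lambda>n. u (pn n)) g sequentially"
    unfolding uniform_limit_iff
  proof (intro allI impI)
    fix e :: real assume "0 < e"
    then obtain N where N: "\<And>n y. N \<le> n \<Longrightarrow> y \<in> closure \<Omega> \<Longrightarrow> norm (F (k n) y - g y) < e"
      using g(3) by blast
    have "\<forall>\<^sub>F n in sequentially. N \<le> l n"
      using filterlim_subseq[OF x0(2)] by (simp add: filterlim_at_top)
    then show "\<forall>\<^sub>F n in sequentially. \<forall>y\<in>closure \<Omega>. dist (u (pn n) y) (g y) < e"
      by eventually_elim (use N Fu in \<open>auto simp: pn_def dist_norm\<close>)
  qed
  note L = limit_properties[OF pn lim]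
  have xlim: "(\<lambda>n. x (pn n)) \<longlonglongrightarrow> x0" using x0(3) by (simp add: pn_def comp_def)
  \<comment> \<open>Uniform convergence and continuity of the limit allow function and point to vary
    together.\<close>
  have vlim: "(\<lambda>n. u (pn n) (x (pn n))) \<longlonglongrightarrow> g x0"
  proof -
    have "(\<lambda>n. g (x (pn n))) \<longlonglongrightarrow> g x0"
      using xcl(1) by (intro continuous_on_tendsto_compose[OF g(1) xlim x0(1)]) (auto simp: pn_def)
    moreover have "(\<lambda>n. u (pn n) (x (pn n)) - g (x (pn n))) \<longlonglongrightarrow> 0"
    proof (rule tendstoI)
      fix e :: real assume "0 < e"
      with lim have "\<forall>\<^sub>F n in sequentially. \<forall>y\<in>closure \<Omega>. dist (u (pn n) y) (g y) < e"
        unfolding uniform_limit_iff by blast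
      then show "\<forall>\<^sub>F n in sequentially. dist (u (pn n) (x (pn n)) - g (x (pn n))) 0 < e"
        by eventually_elim (use xcl(1) in \<open>auto simp: pn_def dist_norm\<close>)
    qed
    ultimately show ?thesis using tendsto_add by fastforce
  qed
  have "inradius \<le> g x0"
  proof (rule LIMSEQ_le)
    show "(\<lambda>n. W (pn n)) \<longlonglongrightarrow> inradius" by (rule filterlim_compose[OF W_lim pn])
    show "(\<lambda>n. u (pn n) (x (pn n))) \<longlonglongrightarrow> g x0" by (rule vlim)
    have "W (pn n) \<le> u (pn n) (x (pn n))" for n
    proof -
      have "Linf_norm \<Omega> (u (pn n)) = u (pn n) (x (pn n))"
        unfolding pn_def using P[of "k (l n)"] by (intro Linf_norm_max) (auto simp: X_space_def)
      then show ?thesis unfolding pn_def using P[of "k (l n)"] by simp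
    qed
    then show "\<exists>N. \<forall>n\<ge>N. W (pn n) \<le> u (pn n) (x (pn n))" by blast
  qed
  \<comment> \<open>The frontier is excluded since \<open>g\<close> vanishes there, whereas
    \<open>g x0\<close> is at least the positive inradius.\<close>
  have "x0 \<in> \<Omega>"
    using closure_cases[OF x0(1)] L(2) \<open>inradius \<le> g x0\<close> inradius_pos by force
  have "x0 \<in> max_points \<Omega> g"
    unfolding max_points_def
  proof (intro CollectI conjI ballI x0(1))
    fix y assume y: "y \<in> closure \<Omega>"
    show "g y \<le> g x0"
      by (rule LIMSEQ_le[OF tendsto_uniform_limitI[OF lim y] vlim]) (use xcl(2)[OF y] in \<open>auto simp: pn_def\<close>)
  qed
  then have norm_g: "Linf_norm \<Omega> g = g x0"
    using Linf_norm_max[OF L(1) L(3)] by blast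
  have lip: "\<bar>zero_ext g y - zero_ext g z\<bar> \<le> 1 * norm (y - z)" for y z
    using L(4) by simp
  have "limit_pair \<Omega> u x pn g x0"
    unfolding limit_pair_def
    using pn \<open>x0 \<in> \<Omega>\<close> W1_inf_of_lipschitz[OF lip] L(1,2) xlim lim norm_g \<open>inradius \<le> g x0\<close>
    by (auto simp: C_0_def Lambda_inf_eq)
  then show ?thesis by blast
qed

text \<open>The chain \<open>inradius \<le> u0 x0 \<le> bdist \<Omega> x0 \<le> inradius\<close>
  forces equality throughout. The gradient norm is at most 1 for every limit pair, and at least 1
  because the quotient of \<open>u0\<close> is bounded below by \<open>1 / inradius\<close>.\<close>

lemma limit_pair_properties:
  assumes "limit_pair \<Omega> u x pn u0 x0"
  shows "Linf_norm \<Omega> u0 = 1 / Lambda_inf \<Omega>"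
    and "Lambda_inf \<Omega> = Linf_norm \<Omega> (weak_gradient \<Omega> u0) / Linf_norm \<Omega> u0"
    and "x0 \<in> max_points \<Omega> (bdist \<Omega>)"
    and "\<forall>y\<in>closure \<Omega>. 0 \<le> u0 y \<and> u0 y \<le> bdist \<Omega> y"
    and "\<forall>y\<in>frontier \<Omega> \<union> {x0}. u0 y = bdist \<Omega> y"
proof -
  have pn: "filterlim pn at_top sequentially" and x0: "x0 \<in> \<Omega>" and W: "u0 \<in> W1_inf \<Omega>" "u0 \<in> C_0 \<Omega>"
    and lim: "uniform_limit (closure \<Omega>) (\<lambda>n. u (pn n)) u0 sequentially"
    and G: "Linf_norm \<Omega> (weak_gradient \<Omega> u0) \<le> 1"
    and M: "u0 x0 = Linf_norm \<Omega> u0" "inradius \<le> Linf_norm \<Omega> u0"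
    using assms by (auto simp: limit_pair_def Lambda_inf_eq)
  note L = limit_properties[OF pn lim] and D = limit_le_bdist[OF pn lim]
  have x0c: "x0 \<in> closure \<Omega>" using x0 closure_subset by blast
  have eq: "u0 x0 = inradius" "bdist \<Omega> x0 = inradius"
    using D[OF x0c] bdist_le_inradius[OF x0c] M by auto
  show 1: "Linf_norm \<Omega> u0 = 1 / Lambda_inf \<Omega>"
    using eq M by (simp add: Lambda_inf_eq)
  have "1 / inradius \<le> Linf_norm \<Omega> (weak_gradient \<Omega> u0) / Linf_norm \<Omega> u0"
    using Lambda_inf_quotient(2)[OF W x0] eq inradius_pos by simp
  with G have "Linf_norm \<Omega> (weak_gradient \<Omega> u0) = 1"
    using 1 inradius_pos by (simp add: Lambda_inf_eq divide_le_cancel)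
  then show "Lambda_inf \<Omega> = Linf_norm \<Omega> (weak_gradient \<Omega> u0) / Linf_norm \<Omega> u0"
    using 1 by simp
  show "x0 \<in> max_points \<Omega> (bdist \<Omega>)"
    using x0c bdist_le_inradius eq by (auto simp: max_points_def)
  show "\<forall>y\<in>closure \<Omega>. 0 \<le> u0 y \<and> u0 y \<le> bdist \<Omega> y"
    using L(3) D by blast
  show "\<forall>y\<in>frontier \<Omega> \<union> {x0}. u0 y = bdist \<Omega> y"
    using L(2) bdist_frontier eq by auto
qed

end

theorem corollary4p5:
  fixes \<Omega> :: "'a::euclidean_space set"
    and q :: "real \<Rightarrow> real" and Q c :: real
    and u :: "real \<Rightarrow> 'a \<Rightarrow> real" and x :: "real \<Rightarrow> 'a"
  assumes "DIM('a) \<ge> 2"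
    and "smooth_bounded_domain \<Omega>"
    and "((\<lambda>p. q p / p) \<longlongrightarrow> Q) at_top"
    and "(0 < Q \<and> Q < 1 \<and> (\<forall>\<^sub>F p in at_top. real DIM('a) < q p \<and> q p < p)) \<or>
         (1 < Q \<and> (\<forall>\<^sub>F p in at_top. real DIM('a) < p \<and> p < q p))"
    and "c > 1"
    and "\<forall>\<^sub>F p in at_top.
           least_energy_solution \<Omega> p (q p) (c * measure lebesgue \<Omega> * Lambda_inf \<Omega> powr p) (u p) \<and>
           (\<forall>y\<in>closure \<Omega>. 0 \<le> u p y) \<and>
           max_points \<Omega> (u p) = {x p}"
  shows
    "((\<forall>m > real DIM('a).
         Limsup at_top (\<lambda>p. ereal (Lnorm \<Omega> m (weak_gradient \<Omega> (u p))))
           \<le> ereal (measure lebesgue \<Omega> powr (1 / m))) \<and>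
      Liminf at_top (\<lambda>p. ereal (Linf_norm \<Omega> (u p))) \<ge> ereal (1 / Lambda_inf \<Omega>)) \<and>
     (\<exists>pn u0 x0. limit_pair \<Omega> u x pn u0 x0) \<and>
     (\<forall>pn u0 x0. limit_pair \<Omega> u x pn u0 x0 \<longrightarrow>
        Linf_norm \<Omega> u0 = 1 / Lambda_inf \<Omega> \<and>
        Lambda_inf \<Omega> = Linf_norm \<Omega> (weak_gradient \<Omega> u0) / Linf_norm \<Omega> u0 \<and>
        x0 \<in> max_points \<Omega> (bdist \<Omega>) \<and>
        (\<forall>y\<in>closure \<Omega>. 0 \<le> u0 y \<and> u0 y \<le> bdist \<Omega> y) \<and>
        (\<forall>y\<in>frontier \<Omega> \<union> {x0}. u0 y = bdist \<Omega> y))"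
proof -
  interpret bounded_open \<Omega>
    using assms(2) by unfold_locales (auto simp: smooth_bounded_domain_def)
  have les: "\<forall>\<^sub>F p in at_top. least_energy_solution \<Omega> p (q p) (c * vol * Lambda_inf \<Omega> powr p) (u p)"
    and nn: "\<forall>\<^sub>F p in at_top. \<forall>y\<in>closure \<Omega>. 0 \<le> u p y"
    and max: "\<forall>\<^sub>F p in at_top. max_points \<Omega> (u p) = {x p}"
    using assms(6) by (auto elim: eventually_mono)
  have Q: "0 < Q" using assms(4) by auto
  obtain U W where UW: "(U \<longlongrightarrow> 1) at_top" "(W \<longlongrightarrow> inradius) at_top"
    "\<forall>\<^sub>F p in at_top. u p \<in> X_space \<Omega> p (q p) \<and> Lnorm \<Omega> (q p) (weak_gradient \<Omega> (u p)) \<le> U p \<and> W p \<le> Linf_norm \<Omega> (u p)"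
    using least_energy_bounds[OF assms(3,4,5) les] by blast
  interpret asymptotic_family \<Omega> u q U W
    using UW nn ratio_limits(1)[OF assms(3) Q] by unfold_locales
  show ?thesis
  proof (intro conjI allI impI)
    show "Limsup at_top (\<lambda>p. ereal (Lnorm \<Omega> m (weak_gradient \<Omega> (u p)))) \<le> ereal (vol powr (1 / m))"
      if "real DIM('a) < m" for m
      using that ndim_ge_1 by (intro Limsup_gradient) linarith
    show "ereal (1 / Lambda_inf \<Omega>) \<le> Liminf at_top (\<lambda>p. ereal (Linf_norm \<Omega> (u p)))"
      using Liminf_max by (simp add: Lambda_inf_eq)
    show "\<exists>pn u0 x0. limit_pair \<Omega> u x pn u0 x0"
      by (rule limit_pair_exists[OF max])
  qed (fact limit_pair_properties)+
qed

end
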